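(* Let $P$ be a hyperbolic right-angled polytope equipped with a set of moves and a compatible initial state, and let $C$ be the cube complex dual to the tessellation of the associated Löbell manifold into copies of $P$. There exists a Bestvina-Brady Morse function $f\colon \mathrm{sd}\,C\to S^1$ on the barycentric subdivision of $C$ such that the following holds for any copy $P'_{[v]}$ of any face $P'$ of $P$. (1) If the inherited state on $P'_{[v]}$ is $m$-legal for some $m\in\mathbb N$, then the ascending and descending links of $f$ at the barycentre of $P'_{[v]}$ are $m$-connected. (2) If either $P'$ is good or the inherited state on $P'_{[v]}$ is totally legal, then the ascending and descending links of $f$ at the barycentre of $P'_{[v]}$ are collapsible.
   Context: Polytopes. A hyperbolic $n$-polytope is a finite-volume intersection of finitely many half-spaces of $\mathbb H^n$. Its faces are $P$ itself and the non-empty intersections of $P$ with the boundary of a half-space containing it (the empty set and ideal vertices are not faces); facets are the faces of codimension $1$. $P$ is right-angled if any two adjacent facets meet at dihedral angle $\pi/2$. Let $F_1,\dots,F_c$ be its facets. A face of codimension $k$ is the intersection of exactly $k$ facets, its defining facets (the facets containing it). Löbell manifold and dual cube complex. For each $v\in(\mathbb Z/2)^c$ take a copy $P_v$ of $P$ and glue $P_v$ to $P_{v+e_i}$ along $F_i$ by the identity, for all $v,i$; this gives a finite-volume hyperbolic manifold $M$ tessellated by the $P_v$. The copies in $M$ of a face $P'$ with defining facets $F_{i_1},\dots,F_{i_k}$ correspond to the classes $[v]\in(\mathbb Z/2)^c/\langle e_{i_1},\dots,e_{i_k}\rangle$; $P'_{[v]}$ is contained in $P_w$ for $w\in[v]$.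 The dual cube complex $C$ has a vertex $v$ for each $P_v$ and a $k$-cube for each copy $P'_{[v]}$ of a codimension-$k$ face, with vertex set the coset $[v]$; inclusion of cubes is reverse inclusion of dual cells. The barycentre of $P'_{[v]}$ means the barycentre of its dual cube, a vertex of $\mathrm{sd}\,C$. Moves and states. A set of moves is a partition of the facets of $P$; its parts are called moves. A state $s$ is a labelling of the facets by $I$ or $O$ (the status). It is compatible (with the set of moves) if adjacent facets in the same move have the same status. A move acts on states by inverting the status of exactly the facets in it. Let $(\mathbb Z/2)^c$ act on states by letting $e_i$ act as the move containing $F_i$. Given an initial state $s_0$, the polytope $P_v$ gets the state $s_v=v\cdot s_0$. A face $P'$ is good if some move contains exactly one of its defining facets, and bad otherwise. The inherited state on $P'_{[v]}$: each facet of $P'$ is of the form $F\cap P'$ for a facet $F$ of $P$; it gets status $s_v(F)$ if $F$ is in a different move from all the defining facets of $P'$, and status $O$ otherwise (this does not depend on the representative $v$). Legality. For a right-angled polytope $R$ (such as a face $P'$), let $R^*$ be the simplicial complex with one vertex for each facet of $R$, a set of vertices spanning a simplex iff the corresponding facets have non-empty common intersection. A state on $R$ determines the full subcomplexes $s_O,s_I$ of $R^*$ spanned by the vertices labelled $O$, respectively $I$. The state is $m$-legal if $s_O$ and $s_I$ are both $m$-connected, and totally legal if they are both collapsible (the empty complex is neither). Bestvina-Brady Morse functions. An affine cell complex is a cell complex whose cells are identified with affine polytopes compatibly (via affine maps) with face inclusions; simplicial and cube complexes and their subdivisions are examples. A map $f\colon X\to S^1=\mathbb R/\mathbb Z$ on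 an affine cell complex is a Bestvina-Brady Morse function if on each positive-dimensional cell it lifts to a non-constant affine real-valued function. The ascending (descending) link of a vertex $v$ is the subcomplex of the link of $v$ spanned by the cells $\sigma$ containing $v$ such that $v$ is the minimum (maximum) of a lift of $f|_\sigma$ to $\mathbb R$. *)

theory Defs
  imports "HOL-Analysis.Analysis" "HOL-Library.Disjoint_Sets"
begin

section \<open>Hyperbolic polytopes\<close>

text \<open>
  Hyperbolic \<open>n\<close>-space is the upper sheet of the hyperboloid in Minkowski space
  \<open>'a \<times> real\<close>, where \<open>n = DIM('a)\<close> and the second component is the time coordinate.
\<close>

type_synonym 'a mink = "'a \<times> real"

definition lor :: "'a::euclidean_space mink \<Rightarrow> 'a mink \<Rightarrow> real" where
  "lor p q = fst p \<bullet> fst q - snd p * snd q"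

definition hyp_space :: "'a::euclidean_space mink set" where
  "hyp_space = {p. lor p p = -1 \<and> snd p > 0}"

text \<open>A half-space and its boundary hyperplane are given by a spacelike normal vector \<open>u\<close>.\<close>

definition spacelike :: "'a::euclidean_space mink \<Rightarrow> bool" where
  "spacelike u \<longleftrightarrow> lor u u > 0"

definition half_space :: "'a::euclidean_space mink \<Rightarrow> 'a mink set" where
  "half_space u = {p \<in> hyp_space. lor p u \<le> 0}"

definition wall :: "'a::euclidean_space mink \<Rightarrow> 'a mink set" where
  "wall u = {p \<in> hyp_space. lor p u = 0}"

text \<open>
  In the chart \<open>x \<mapsto> (x, sqrt (1 + |x|\<^sup>2))\<close> the metric of the hyperboloid is
  \<open>I - x x\<^sup>T / (1 + |x|\<^sup>2)\<close>, with determinant \<open>1 / (1 + |x|\<^sup>2)\<close>.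
\<close>

definition hyp_volume :: "'a::euclidean_space mink set \<Rightarrow> ennreal" where
  "hyp_volume S = (\<integral>\<^sup>+ x. ennreal (1 / sqrt (1 + (norm x)\<^sup>2)) *
                         indicator S (x, sqrt (1 + (norm x)\<^sup>2)) \<partial>lborel)"

text \<open>
  \<open>dim\<close> is the dimension of the linear span, which exceeds the hyperbolic dimension
  by one.  The last condition says that an \<open>n\<close>-polytope is \<open>n\<close>-dimensional.
\<close>

definition hyp_polytope :: "'a::euclidean_space mink set \<Rightarrow> bool" where
  "hyp_polytope P \<longleftrightarrow>
     (\<exists>U. finite U \<and> (\<forall>u\<in>U. spacelike u) \<and> P = hyp_space \<inter> (\<Inter>u\<in>U. half_space u)) \<and>
     hyp_volume P < \<infinity> \<and>
     dim P = DIM('a) + 1"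

text \<open>
  The next notions are also applied to a face \<open>R\<close> of a polytope, regarded as a polytope
  in the hyperbolic subspace it spans.  A half-space of that subspace is cut out by a
  half-space of the ambient space, so ambient half-spaces may be used.
\<close>

definition hface :: "'a::euclidean_space mink set \<Rightarrow> 'a mink set \<Rightarrow> bool" where
  "hface Q R \<longleftrightarrow> Q = R \<or>
     (Q \<noteq> {} \<and> (\<exists>u. spacelike u \<and> R \<subseteq> half_space u \<and> Q = R \<inter> wall u))"

definition hfacets :: "'a::euclidean_space mink set \<Rightarrow> 'a mink set set" where
  "hfacets R = {F. hface F R \<and> dim F + 1 = dim R}"

definition adjacent :: "'b set \<Rightarrow> 'b set \<Rightarrow> bool" where
  "adjacent F G \<longleftrightarrow> F \<noteq> G \<and> F \<inter> G \<noteq> {}"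

definition outward_normal :: "'a::euclidean_space mink set \<Rightarrow> 'a mink set \<Rightarrow> 'a mink" where
  "outward_normal P F = (THE u. lor u u = 1 \<and> P \<subseteq> half_space u \<and> F = P \<inter> wall u)"

definition dihedral_angle :: "'a::euclidean_space mink set \<Rightarrow> 'a mink set \<Rightarrow> 'a mink set \<Rightarrow> real" where
  "dihedral_angle P F G = arccos (- lor (outward_normal P F) (outward_normal P G))"

definition right_angled :: "'a::euclidean_space mink set \<Rightarrow> bool" where
  "right_angled P \<longleftrightarrow>
     (\<forall>F\<in>hfacets P. \<forall>G\<in>hfacets P. adjacent F G \<longrightarrow> dihedral_angle P F G = pi / 2)"

definition defining_facets :: "'a::euclidean_space mink set \<Rightarrow> 'a mink set \<Rightarrow> 'a mink set set" where
  "defining_facets P Q = {F \<in> hfacets P. Q \<subseteq> F}"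


section \<open>The Loebell manifold and the dual cube complex\<close>

text \<open>
  An element of \<open>(\<int>/2)\<^sup>c\<close> is represented by its support, a subset of the set of facets;
  addition is symmetric difference and the basis vectors are the singletons.
\<close>

definition vadd :: "'b set \<Rightarrow> 'b set \<Rightarrow> 'b set" where
  "vadd v w = (v - w) \<union> (w - v)"

text \<open>The pair \<open>(v, p)\<close> is the point \<open>p\<close> of the copy of \<open>P\<close> indexed by \<open>v\<close>.\<close>

definition glue :: "'a::euclidean_space mink set \<Rightarrow> (('a mink set set \<times> 'a mink) \<times> ('a mink set set \<times> 'a mink)) set" where
  "glue P = {((v, p), (vadd v {F}, p)) | v F p. v \<subseteq> hfacets P \<and> F \<in> hfacets P \<and> p \<in> F}"

text \<open>The relation \<open>glue P\<close> is symmetric, so that its reflexive transitive closure is an equivalence.\<close>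

definition loebell_manifold :: "'a::euclidean_space mink set \<Rightarrow> ('a mink set set \<times> 'a mink) set set" where
  "loebell_manifold P = (Pow (hfacets P) \<times> P) // (glue P)\<^sup>*"

definition copy_of :: "'a::euclidean_space mink set \<Rightarrow> 'a mink set \<Rightarrow> 'a mink set set \<Rightarrow>
    ('a mink set set \<times> 'a mink) set set" where
  "copy_of P Q v = {X \<in> loebell_manifold P. \<exists>p\<in>Q. (v, p) \<in> X}"

definition loebell_cells :: "'a::euclidean_space mink set \<Rightarrow> ('a mink set set \<times> 'a mink) set set set" where
  "loebell_cells P = {copy_of P Q v | Q v. hface Q P \<and> v \<subseteq> hfacets P}"

text \<open>
  A cube of the dual complex is represented by its vertex set, where the vertex dual to
  the copy of \<open>P\<close> indexed by \<open>w\<close> is \<open>w\<close> itself.  By the lemmas below, the vertex set of the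
  cube dual to the copy \<open>Q\<^bsub>[v]\<^esub>\<close> is the coset \<open>[v]\<close>.  A face is the intersection of \<open>P\<close> with
  its defining facets, so the cube determines the copy, and inclusion of vertex sets is
  reverse inclusion of copies.
\<close>

definition dual_cube :: "'a::euclidean_space mink set \<Rightarrow> ('a mink set set \<times> 'a mink) set set \<Rightarrow>
    'a mink set set set" where
  "dual_cube P X = {w. w \<subseteq> hfacets P \<and> X \<subseteq> copy_of P P w}"

definition dual_cube_complex :: "'a::euclidean_space mink set \<Rightarrow> 'a mink set set set set" where
  "dual_cube_complex P = dual_cube P ` loebell_cells P"

lemma vadd_simps:
  "vadd (vadd v w) w = v" "vadd v (vadd v w) = w"
  by (auto simp: vadd_def)

lemma sym_glue: "sym (glue P)"
proof (rule symI)
  fix a b assume "(a, b) \<in> glue P"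
  then obtain v F p where *: "a = (v, p)" "b = (vadd v {F}, p)" "v \<subseteq> hfacets P" "F \<in> hfacets P" "p \<in> F"
    by (auto simp: glue_def)
  then have "(b, (vadd (vadd v {F}) {F}, p)) \<in> glue P"
    unfolding glue_def by (force simp: vadd_def)
  then show "(b, a) \<in> glue P" using * by (simp add: vadd_simps)
qed

lemma glue_rtrancl:
  assumes "finite (hfacets P)" "v \<subseteq> hfacets P"
  shows "((v, p), y) \<in> (glue P)\<^sup>* \<longleftrightarrow>
     (\<exists>w. y = (w, p) \<and> w \<subseteq> hfacets P \<and> vadd v w \<subseteq> {F \<in> hfacets P. p \<in> F})"
proof
  assume "((v, p), y) \<in> (glue P)\<^sup>*"
  then show "\<exists>w. y = (w, p) \<and> w \<subseteq> hfacets P \<and> vadd v w \<subseteq> {F \<in> hfacets P. p \<in> F}"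
  proof (induction rule: rtrancl_induct)
    case base show ?case using assms by (auto simp: vadd_def)
  next
    case (step y z)
    then obtain w where w: "y = (w, p)" "w \<subseteq> hfacets P" "vadd v w \<subseteq> {F \<in> hfacets P. p \<in> F}" by blast
    with step(2) obtain F where "z = (vadd w {F}, p)" "F \<in> hfacets P" "p \<in> F"
      by (auto simp: glue_def)
    with w show ?case by (fastforce simp: vadd_def)
  qed
next
  have step: "((v, p), (vadd v D, p)) \<in> (glue P)\<^sup>*" if "finite D" "D \<subseteq> {F \<in> hfacets P. p \<in> F}" for D
    using that
  proof (induction D rule: finite_induct)
    case empty show ?case by (simp add: vadd_def)
  next
    case (insert F D)
    have e: "vadd v (insert F D) = vadd (vadd v D) {F}" using insert by (auto simp: vadd_def)
    have "vadd v D \<subseteq> hfacets P" "F \<in> hfacets P" "p \<in> F"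
      using insert assms(2) by (auto simp: vadd_def)
    then have "((vadd v D, p), (vadd v (insert F D), p)) \<in> glue P"
      unfolding e glue_def by blast
    then show ?case using insert by (meson insert_subset rtrancl.rtrancl_into_rtrancl)
  qed
  assume "\<exists>w. y = (w, p) \<and> w \<subseteq> hfacets P \<and> vadd v w \<subseteq> {F \<in> hfacets P. p \<in> F}"
  then obtain w where w: "y = (w, p)" "vadd v w \<subseteq> {F \<in> hfacets P. p \<in> F}" by blast
  have "finite (vadd v w)" using finite_subset[OF w(2)] assms(1) by simp
  from step[OF this w(2)] show "((v, p), y) \<in> (glue P)\<^sup>*" by (simp add: vadd_simps w)
qed

lemma copy_of_subset_iff:
  assumes fin: "finite (hfacets P)" and v: "v \<subseteq> hfacets P" and w: "w \<subseteq> hfacets P"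
    and Q: "Q \<subseteq> P" "R \<subseteq> P"
  shows "copy_of P Q v \<subseteq> copy_of P R w \<longleftrightarrow> Q \<subseteq> R \<and> vadd v w \<subseteq> defining_facets P Q"
proof -
  have equiv: "equiv UNIV ((glue P)\<^sup>*)"
    by (simp add: equiv_def refl_rtrancl trans_rtrancl sym_rtrancl sym_glue)
  have cl: "copy_of P S u = (\<lambda>p. (glue P)\<^sup>* `` {(u, p)}) ` S" if S: "S \<subseteq> P" "u \<subseteq> hfacets P" for S u
  proof
    show "copy_of P S u \<subseteq> (\<lambda>p. (glue P)\<^sup>* `` {(u, p)}) ` S"
    proof
      fix X assume "X \<in> copy_of P S u"
      then obtain a p where X: "X = (glue P)\<^sup>* `` {a}" "p \<in> S" "(a, (u, p)) \<in> (glue P)\<^sup>*"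
        unfolding copy_of_def loebell_manifold_def quotient_def by blast
      then have "X = (glue P)\<^sup>* `` {(u, p)}" using equiv_class_eq[OF equiv X(3)] by simp
      with X(2) show "X \<in> (\<lambda>p. (glue P)\<^sup>* `` {(u, p)}) ` S" by blast
    qed
    show "(\<lambda>p. (glue P)\<^sup>* `` {(u, p)}) ` S \<subseteq> copy_of P S u"
    proof
      fix X assume "X \<in> (\<lambda>p. (glue P)\<^sup>* `` {(u, p)}) ` S"
      then obtain p where p: "X = (glue P)\<^sup>* `` {(u, p)}" "p \<in> S" by blast
      then have "X \<in> loebell_manifold P"
        unfolding loebell_manifold_def using S by (auto intro: quotientI)
      with p show "X \<in> copy_of P S u" unfolding copy_of_def by blast
    qed
  qed
  have eq: "(glue P)\<^sup>* `` {(v, p)} = (glue P)\<^sup>* `` {(w, q)} \<longleftrightarrow>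
      p = q \<and> vadd v w \<subseteq> {F \<in> hfacets P. p \<in> F}" for p q
  proof -
    have "(glue P)\<^sup>* `` {(v, p)} = (glue P)\<^sup>* `` {(w, q)} \<longleftrightarrow> ((v, p), (w, q)) \<in> (glue P)\<^sup>*"
      by (rule eq_equiv_class_iff[OF equiv]) auto
    then show ?thesis using glue_rtrancl[OF fin v, of p "(w, q)"] w by auto
  qed
  have "copy_of P Q v \<subseteq> copy_of P R w \<longleftrightarrow>
      (\<forall>p\<in>Q. \<exists>q\<in>R. p = q \<and> vadd v w \<subseteq> {F \<in> hfacets P. p \<in> F})"
    unfolding cl[OF Q(1) v] cl[OF Q(2) w] image_subset_iff image_iff eq by simp
  moreover have "vadd v w \<subseteq> hfacets P" using v w by (auto simp: vadd_def)
  ultimately show ?thesis by (fastforce simp: defining_facets_def)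
qed

lemma dual_cube_copy_of:
  assumes "finite (hfacets P)" "v \<subseteq> hfacets P" "Q \<subseteq> P"
  shows "dual_cube P (copy_of P Q v) = {w. w \<subseteq> hfacets P \<and> vadd v w \<subseteq> defining_facets P Q}"
  unfolding dual_cube_def using assms copy_of_subset_iff[OF assms(1,2) _ assms(3) order_refl] by auto


section \<open>Simplicial complexes\<close>

text \<open>
  A simplicial complex is represented by the family of the vertex sets of its simplices,
  which are finite and non-empty.
\<close>

type_synonym 'v complx = "'v set set"

text \<open>Applied to the cubes of a cube complex, \<open>sd\<close> is the barycentric subdivision; the vertex
  \<open>c\<close> is the barycentre of the cube \<open>c\<close>.\<close>

definition sd :: "'b set set \<Rightarrow> 'b set complx" where
  "sd C = {S. S \<noteq> {} \<and> finite S \<and> S \<subseteq> C \<and> (\<forall>a\<in>S. \<forall>b\<in>S. a \<subseteq> b \<or> b \<subseteq> a)}"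

text \<open>Points of the geometric realization are given by their barycentric coordinates.\<close>

definition simplex_pts :: "'v set \<Rightarrow> ('v \<Rightarrow> real) set" where
  "simplex_pts \<sigma> = {\<alpha>. (\<forall>x. 0 \<le> \<alpha> x) \<and> (\<forall>x. x \<notin> \<sigma> \<longrightarrow> \<alpha> x = 0) \<and> sum \<alpha> \<sigma> = 1}"

definition realization :: "'v complx \<Rightarrow> ('v \<Rightarrow> real) set" where
  "realization K = (\<Union>\<sigma>\<in>K. simplex_pts \<sigma>)"

definition vertex_pt :: "'v \<Rightarrow> 'v \<Rightarrow> real" where
  "vertex_pt x = (\<lambda>y. if y = x then 1 else 0)"

definition full_subcomplex :: "'v complx \<Rightarrow> 'v set \<Rightarrow> 'v complx" where
  "full_subcomplex K V = {\<sigma> \<in> K. \<sigma> \<subseteq> V}"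

text \<open>\<open>nsphere i\<close> is the \<open>i\<close>-dimensional sphere.\<close>

definition m_connected_space :: "nat \<Rightarrow> 'b topology \<Rightarrow> bool" where
  "m_connected_space m X \<longleftrightarrow> topspace X \<noteq> {} \<and>
     (\<forall>i\<le>m. \<forall>g. continuous_map (nsphere i) X g \<longrightarrow>
        (\<exists>a\<in>topspace X. homotopic_with (\<lambda>_. True) (nsphere i) X g (\<lambda>_. a)))"

text \<open>
  The topology on \<open>realization K\<close> is that of pointwise convergence of barycentric
  coordinates.  It is the usual one for finite \<open>K\<close>, and only finite complexes occur below.
\<close>

definition m_connected :: "nat \<Rightarrow> 'v complx \<Rightarrow> bool" where
  "m_connected m K \<longleftrightarrow> m_connected_space m (top_of_set (realization K))"

text \<open>Here \<open>\<tau>\<close> is a free face of \<open>\<sigma>\<close>.\<close>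

definition elementary_collapse :: "'v complx \<Rightarrow> 'v complx \<Rightarrow> bool" where
  "elementary_collapse K L \<longleftrightarrow>
     (\<exists>\<tau> \<sigma>. \<tau> \<in> K \<and> \<sigma> \<in> K \<and> {\<rho> \<in> K. \<tau> \<subset> \<rho>} = {\<sigma>} \<and> L = K - {\<tau>, \<sigma>})"

definition collapsible :: "'v complx \<Rightarrow> bool" where
  "collapsible K \<longleftrightarrow> (\<exists>x. elementary_collapse\<^sup>*\<^sup>* K {{x}})"


section \<open>Bestvina-Brady Morse functions on simplicial complexes\<close>

text \<open>The quotient map from \<open>\<real>\<close> to the circle \<open>\<real>/\<int>\<close>.\<close>

definition to_circle :: "real \<Rightarrow> real set" where
  "to_circle t = {s. s - t \<in> \<int>}"

definition affine_on_simplex :: "'v set \<Rightarrow> (('v \<Rightarrow> real) \<Rightarrow> real) \<Rightarrow> bool" where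
  "affine_on_simplex \<sigma> g \<longleftrightarrow>
     (\<forall>\<alpha>\<in>simplex_pts \<sigma>. \<forall>\<beta>\<in>simplex_pts \<sigma>. \<forall>t\<in>{0..1}.
        g (\<lambda>x. (1 - t) * \<alpha> x + t * \<beta> x) = (1 - t) * g \<alpha> + t * g \<beta>)"

definition affine_lift :: "(('v \<Rightarrow> real) \<Rightarrow> real set) \<Rightarrow> 'v set \<Rightarrow> (('v \<Rightarrow> real) \<Rightarrow> real) \<Rightarrow> bool" where
  "affine_lift f \<sigma> g \<longleftrightarrow> affine_on_simplex \<sigma> g \<and> (\<forall>\<alpha>\<in>simplex_pts \<sigma>. f \<alpha> = to_circle (g \<alpha>))"

definition morse_function :: "'v complx \<Rightarrow> (('v \<Rightarrow> real) \<Rightarrow> real set) \<Rightarrow> bool" where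
  "morse_function K f \<longleftrightarrow> f ` realization K \<subseteq> range to_circle \<and>
     (\<forall>\<sigma>\<in>K. card \<sigma> \<ge> 2 \<longrightarrow>
        (\<exists>g. affine_lift f \<sigma> g \<and> (\<exists>\<alpha>\<in>simplex_pts \<sigma>. \<exists>\<beta>\<in>simplex_pts \<sigma>. g \<alpha> \<noteq> g \<beta>)))"

text \<open>
  The simplex of the link of \<open>x\<close> corresponding to a simplex \<open>\<sigma>\<close> containing \<open>x\<close> is \<open>\<sigma> - {x}\<close>.
\<close>

definition link :: "'v complx \<Rightarrow> 'v \<Rightarrow> 'v complx" where
  "link K x = {\<tau>. \<tau> \<noteq> {} \<and> x \<notin> \<tau> \<and> insert x \<tau> \<in> K}"

definition ascending_link :: "'v complx \<Rightarrow> (('v \<Rightarrow> real) \<Rightarrow> real set) \<Rightarrow> 'v \<Rightarrow> 'v complx" where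
  "ascending_link K f x = {\<tau> \<in> link K x. \<exists>g. affine_lift f (insert x \<tau>) g \<and>
     (\<forall>\<alpha>\<in>simplex_pts (insert x \<tau>). g (vertex_pt x) \<le> g \<alpha>)}"

definition descending_link :: "'v complx \<Rightarrow> (('v \<Rightarrow> real) \<Rightarrow> real set) \<Rightarrow> 'v \<Rightarrow> 'v complx" where
  "descending_link K f x = {\<tau> \<in> link K x. \<exists>g. affine_lift f (insert x \<tau>) g \<and>
     (\<forall>\<alpha>\<in>simplex_pts (insert x \<tau>). g \<alpha> \<le> g (vertex_pt x))}"


section \<open>Moves, states and legality\<close>

datatype status = StI | StO

fun invert :: "status \<Rightarrow> status" where
  "invert StI = StO"
| "invert StO = StI"

text \<open>
  A state on \<open>R\<close> is a function on the facets of \<open>R\<close>; its values elsewhere are irrelevant.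
\<close>

type_synonym 'a state = "'a mink set \<Rightarrow> status"

definition set_of_moves :: "'a::euclidean_space mink set \<Rightarrow> 'a mink set set set \<Rightarrow> bool" where
  "set_of_moves P Ms \<longleftrightarrow> partition_on (hfacets P) Ms"

definition compatible :: "'a::euclidean_space mink set set set \<Rightarrow> 'a state \<Rightarrow> bool" where
  "compatible Ms s \<longleftrightarrow> (\<forall>A\<in>Ms. \<forall>F\<in>A. \<forall>G\<in>A. adjacent F G \<longrightarrow> s F = s G)"

definition apply_move :: "'a::euclidean_space mink set set \<Rightarrow> 'a state \<Rightarrow> 'a state" where
  "apply_move A s = (\<lambda>F. if F \<in> A then invert (s F) else s F)"

definition move_of :: "'a::euclidean_space mink set set set \<Rightarrow> 'a mink set \<Rightarrow> 'a mink set set" where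
  "move_of Ms F = (THE A. A \<in> Ms \<and> F \<in> A)"

text \<open>\<open>act Ms v s\<close> is \<open>v \<cdot> s\<close>: the (commuting) moves of the facets in the support \<open>v\<close> are applied in turn.\<close>

definition act :: "'a::euclidean_space mink set set set \<Rightarrow> 'a mink set set \<Rightarrow> 'a state \<Rightarrow> 'a state" where
  "act Ms v s = Finite_Set.fold (\<lambda>F. apply_move (move_of Ms F)) s v"

definition good :: "'a::euclidean_space mink set \<Rightarrow> 'a mink set set set \<Rightarrow> 'a mink set \<Rightarrow> bool" where
  "good P Ms Q \<longleftrightarrow> (\<exists>A\<in>Ms. \<exists>!F. F \<in> A \<and> F \<in> defining_facets P Q)"

text \<open>In the definition below, \<open>s\<close> is the state of a copy of \<open>P\<close> containing the given copy of \<open>Q\<close>.\<close>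

definition inherited_state :: "'a::euclidean_space mink set \<Rightarrow> 'a mink set set set \<Rightarrow> 'a state \<Rightarrow>
    'a mink set \<Rightarrow> 'a state" where
  "inherited_state P Ms s Q = (\<lambda>G.
     let F = (THE F. F \<in> hfacets P \<and> G = F \<inter> Q)
     in if \<forall>F'\<in>defining_facets P Q. move_of Ms F \<noteq> move_of Ms F' then s F else StO)"

definition facet_complex :: "'a::euclidean_space mink set \<Rightarrow> 'a mink set complx" where
  "facet_complex R = {S. S \<noteq> {} \<and> finite S \<and> S \<subseteq> hfacets R \<and> \<Inter>S \<noteq> {}}"

definition state_complex :: "'a::euclidean_space mink set \<Rightarrow> 'a state \<Rightarrow> status \<Rightarrow> 'a mink set complx" where
  "state_complex R s b = full_subcomplex (facet_complex R) {F \<in> hfacets R. s F = b}"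

definition m_legal :: "nat \<Rightarrow> 'a::euclidean_space mink set \<Rightarrow> 'a state \<Rightarrow> bool" where
  "m_legal m R s \<longleftrightarrow> m_connected m (state_complex R s StO) \<and> m_connected m (state_complex R s StI)"

definition totally_legal :: "'a::euclidean_space mink set \<Rightarrow> 'a state \<Rightarrow> bool" where
  "totally_legal R s \<longleftrightarrow> collapsible (state_complex R s StO) \<and> collapsible (state_complex R s StI)"

end

theory Submission
  imports Defs
begin

text \<open>
  Let \<open>f\<close> send the barycentre of a \<open>k\<close>-cube to \<open>k * \<epsilon>\<close> mod 1, where \<open>\<epsilon> = 1 / (c + 1)\<close>, and let its lift
  change along an inclusion \<open>x \<subset> y\<close> of cubes by the difference of these values minus the number of
  moves that meet the directions of \<open>y\<close>, do not meet those of \<open>x\<close>, and have status \<open>I\<close> there.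
  Compatibility makes this additive along chains, so it defines a Morse function; it ascends from
  \<open>x\<close> to \<open>y\<close> exactly if all directions of \<open>y\<close> have inherited status \<open>O\<close> at \<open>x\<close>.

  The ascending and descending links at a barycentre are therefore joins of a part coming from the
  faces of the cube and a part coming from the cubes above it. Right-angledness makes the normals of
  the facets through a point orthogonal, so the cubes above correspond to the sets of facets of the
  face with a common point. The ascending upper part is thus the subdivision of \<open>s_O\<close>; the
  descending one collapses onto the subdivision of \<open>s_I\<close> by forgetting the facets with status \<open>O\<close>.
  If the face is good, the lower part is collapsible because \<open>f\<close> is monotone along the edge of the
  cube dual to a facet which is alone in its move.

  A join inherits collapsibility, and also \<open>m\<close>-connectedness, from one of its factors, whatever the
  other factor is.
\<close>

section \<open>Collapses\<close>

text \<open>On edges the map looks as follows: all vertices of the cube complex go to 0 mod 1, and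
  the edge dual to a facet runs once around the circle, from its end with status \<open>O\<close> to
  its end with status \<open>I\<close>, rising by \<epsilon> up to the barycentre and by 1 -
  \<epsilon> after it. Such a map is in general not affine on whole cubes: if two facets of a cube
  lie in one move, crossing one of them also changes the status of the other, so parallel edges
  point in opposite directions. Hence the barycentres need values of their own and the domain is
  subdivided. Legality says nothing about the lower factor of the links and goodness nothing about
  the upper one, so the results on joins must allow an arbitrary, possibly empty, second factor. For
  \<open>m\<close>-connectedness this is achieved by extending maps over balls, without homology or
  fundamental groups. Retractions of posets are realized by deleting dominated vertices
  (\<open>strong_step\<close>), because such deletions are collapses and also lift
  \<open>m\<close>-connectedness.\<close>

definition simplicial :: "'v complx \<Rightarrow> bool" where
  "simplicial K \<longleftrightarrow> finite K \<and> (\<forall>\<sigma>\<in>K. \<sigma> \<noteq> {} \<and> finite \<sigma>) \<and> (\<forall>\<sigma>\<in>K. \<forall>\<tau>. \<tau> \<subseteq> \<sigma> \<and> \<tau> \<noteq> {} \<longrightarrow> \<tau> \<in> K)"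

lemma simplicialD:
  assumes "simplicial K"
  shows "finite K" "\<sigma> \<in> K \<Longrightarrow> \<sigma> \<noteq> {}" "\<sigma> \<in> K \<Longrightarrow> finite \<sigma>" "\<sigma> \<in> K \<Longrightarrow> \<tau> \<subseteq> \<sigma> \<Longrightarrow> \<tau> \<noteq> {} \<Longrightarrow> \<tau> \<in> K"
  using assms unfolding simplicial_def by blast+

lemma elementary_collapseE:
  assumes "elementary_collapse K L"
  obtains \<tau> \<sigma> where "\<tau> \<in> K" "\<sigma> \<in> K" "\<tau> \<subset> \<sigma>" "\<And>\<rho>. \<rho> \<in> K \<Longrightarrow> \<tau> \<subset> \<rho> \<Longrightarrow> \<rho> = \<sigma>" "L = K - {\<tau>, \<sigma>}"
proof -
  obtain \<tau> \<sigma> where *: "\<tau> \<in> K" "\<sigma> \<in> K" "{\<rho> \<in> K. \<tau> \<subset> \<rho>} = {\<sigma>}" "L = K - {\<tau>, \<sigma>}"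
    using assms by (auto simp: elementary_collapse_def)
  moreover have "\<rho> \<in> K \<and> \<tau> \<subset> \<rho> \<longleftrightarrow> \<rho> = \<sigma>" for \<rho>
    using *(3) by (metis (mono_tags, lifting) mem_Collect_eq singleton_iff)
  ultimately show ?thesis using that by metis
qed

lemma elementary_collapseI:
  assumes "\<tau> \<in> K" "\<sigma> \<in> K" "{\<rho> \<in> K. \<tau> \<subset> \<rho>} = {\<sigma>}" "L = K - {\<tau>, \<sigma>}"
  shows "elementary_collapse K L"
  using assms unfolding elementary_collapse_def by blast

lemma simplicial_sd:
  assumes "finite Q"
  shows "simplicial (sd Q)"
proof -
  have "sd Q \<subseteq> Pow Q" by (auto simp: sd_def)
  with assms have "finite (sd Q)" by (meson finite_Pow_iff finite_subset)
  then show ?thesis unfolding simplicial_def sd_def by (auto intro: finite_subset)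
qed

text \<open>The pairs \<open>\<tau> \<union> l\<close>, \<open>\<sigma> \<union> l\<close> are
  removed in order of decreasing \<open>l\<close>. By the last hypothesis a simplex above
  \<open>\<tau> \<union> l\<close> is its partner or belongs to a pair with larger \<open>l\<close>,
  so the face is free when \<open>l\<close> is maximal among those left.\<close>

lemma collapse_family:
  assumes "finite \<Lambda>" "\<tau> \<subset> \<sigma>"
    and "\<And>l. l \<in> \<Lambda> \<Longrightarrow> l \<inter> \<sigma> = {} \<and> \<tau> \<union> l \<in> K \<and> \<sigma> \<union> l \<in> K"
    and "\<And>l \<rho>. l \<in> \<Lambda> \<Longrightarrow> \<rho> \<in> K \<Longrightarrow> \<tau> \<union> l \<subset> \<rho> \<Longrightarrow>
           \<rho> = \<sigma> \<union> l \<or> (\<exists>l'\<in>\<Lambda>. l \<subset> l' \<and> (\<rho> = \<tau> \<union> l' \<or> \<rho> = \<sigma> \<union> l'))"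
  shows "elementary_collapse\<^sup>*\<^sup>* K (K - ((\<union>) \<tau> ` \<Lambda> \<union> (\<union>) \<sigma> ` \<Lambda>))"
  using assms(1,3,4)
proof (induction "card \<Lambda>" arbitrary: \<Lambda> K)
  case 0
  then show ?case by simp
next
  case (Suc n)
  then have ne: "\<Lambda> \<noteq> {}" by auto
  obtain l where l: "l \<in> \<Lambda>" "\<And>l'. l' \<in> \<Lambda> \<Longrightarrow> \<not> l \<subset> l'"
    using finite_has_maximal[OF Suc.prems(1) ne] by (metis order.strict_iff_order)
  define K1 where "K1 = K - {\<tau> \<union> l, \<sigma> \<union> l}"
  have dif: "\<tau> \<union> l' \<noteq> \<tau> \<union> l \<and> \<sigma> \<union> l' \<noteq> \<sigma> \<union> l \<and> \<tau> \<union> l' \<noteq> \<sigma> \<union> l \<and> \<sigma> \<union> l' \<noteq> \<tau> \<union> l"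
    if "l' \<in> \<Lambda>" "l' \<noteq> l" for l'
    using Suc.prems(2)[OF that(1)] Suc.prems(2)[OF l(1)] assms(2) that(2) by blast
  have "\<tau> \<union> l \<subset> \<sigma> \<union> l" using Suc.prems(2)[OF l(1)] assms(2) by blast
  moreover have "\<rho> = \<sigma> \<union> l" if "\<rho> \<in> K" "\<tau> \<union> l \<subset> \<rho>" for \<rho>
    using Suc.prems(3)[OF l(1) that] l(2) by auto
  ultimately have "{\<rho> \<in> K. \<tau> \<union> l \<subset> \<rho>} = {\<sigma> \<union> l}"
    using Suc.prems(2)[OF l(1)] by auto
  then have 1: "elementary_collapse K K1"
    unfolding K1_def using Suc.prems(2)[OF l(1)] by (intro elementary_collapseI) auto
  have "elementary_collapse\<^sup>*\<^sup>* K1 (K1 - ((\<union>) \<tau> ` (\<Lambda> - {l}) \<union> (\<union>) \<sigma> ` (\<Lambda> - {l})))"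
  proof (rule Suc.hyps(1))
    show "n = card (\<Lambda> - {l})" using Suc.hyps(2) l(1) Suc.prems(1) by simp
    show "finite (\<Lambda> - {l})" using Suc.prems(1) by simp
    show "l' \<inter> \<sigma> = {} \<and> \<tau> \<union> l' \<in> K1 \<and> \<sigma> \<union> l' \<in> K1" if "l' \<in> \<Lambda> - {l}" for l'
      using Suc.prems(2)[of l'] dif[of l'] that by (auto simp: K1_def)
    show "\<rho> = \<sigma> \<union> l' \<or> (\<exists>l''\<in>\<Lambda> - {l}. l' \<subset> l'' \<and> (\<rho> = \<tau> \<union> l'' \<or> \<rho> = \<sigma> \<union> l''))"
      if "l' \<in> \<Lambda> - {l}" "\<rho> \<in> K1" "\<tau> \<union> l' \<subset> \<rho>" for l' \<rho>
      using Suc.prems(3)[of l' \<rho>] that by (auto simp: K1_def)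
  qed
  moreover have "K1 - ((\<union>) \<tau> ` (\<Lambda> - {l}) \<union> (\<union>) \<sigma> ` (\<Lambda> - {l})) = K - ((\<union>) \<tau> ` \<Lambda> \<union> (\<union>) \<sigma> ` \<Lambda>)"
    using l(1) by (auto simp: K1_def)
  ultimately show ?case using 1 by (metis converse_rtranclp_into_rtranclp)
qed

text \<open>A surviving simplex cannot contain \<tau>, since the only simplex properly above \<tau>
  is removed with it; so none of its faces is lost.\<close>

lemma elementary_collapse_closed:
  assumes "elementary_collapse K L" "simplicial K"
  shows "simplicial L" "L \<subseteq> K"
proof -
  obtain \<tau> \<sigma> where *: "\<tau> \<in> K" "\<sigma> \<in> K" "{\<rho> \<in> K. \<tau> \<subset> \<rho>} = {\<sigma>}" "L = K - {\<tau>, \<sigma>}"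
    using assms(1) by (auto simp: elementary_collapse_def)
  show "L \<subseteq> K" using * by blast
  have *: "\<rho>' \<in> L" if r: "\<rho> \<in> L" "\<rho>' \<subseteq> \<rho>" "\<rho>' \<noteq> {}" for \<rho> \<rho>'
  proof -
    have "\<sigma> \<in> {\<rho> \<in> K. \<tau> \<subset> \<rho>}" unfolding *(3) by simp
    then have "\<tau> \<subset> \<sigma>" by simp
    have "\<rho> \<in> K" "\<rho> \<noteq> \<tau>" "\<rho> \<noteq> \<sigma>" using r(1) unfolding *(4) by auto
    then have "\<not> \<tau> \<subset> \<rho>" using *(3) by auto
    then have "\<rho>' \<noteq> \<tau>" "\<rho>' \<noteq> \<sigma>" using \<open>\<rho> \<noteq> \<tau>\<close> \<open>\<tau> \<subset> \<sigma>\<close> r(2) by auto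
    moreover have "\<rho>' \<in> K" by (rule simplicialD(4)[OF assms(2) \<open>\<rho> \<in> K\<close>]) (use r in auto)
    ultimately show ?thesis unfolding *(4) by auto
  qed
  have "finite L" "\<forall>\<sigma>\<in>L. \<sigma> \<noteq> {} \<and> finite \<sigma>"
    using \<open>L \<subseteq> K\<close> simplicialD[OF assms(2)] by (auto intro: finite_subset)
  with * show "simplicial L" unfolding simplicial_def by auto
qed

text \<open>Both factors are augmented by the empty simplex, so the simplices of \<open>K\<close>
  and \<open>L\<close> themselves belong to the join and an empty factor makes sense. This is the
  usual join when the vertex sets are disjoint.\<close>

definition join :: "'v complx \<Rightarrow> 'v complx \<Rightarrow> 'v complx" where
  "join K L = {\<kappa> \<union> \<mu> |\<kappa> \<mu>. \<kappa> \<in> insert {} K \<and> \<mu> \<in> insert {} L} - {{}}"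

lemma join_commute: "join K L = join L K"
  unfolding join_def by (auto simp: Un_commute)

text \<open>One pair \<tau>, \<sigma> of \<open>K\<close> becomes the family of pairs
  \<open>\<tau> \<union> l\<close>, \<open>\<sigma> \<union> l\<close> with \<open>l\<close> empty
  or in \<open>L\<close>. Disjoint vertex sets make the decomposition of a simplex of the join
  unique.\<close>

lemma collapse_join_step:
  assumes "elementary_collapse K K'" "simplicial K" "simplicial L" "\<Union>K \<inter> \<Union>L = {}"
  shows "elementary_collapse\<^sup>*\<^sup>* (join K L) (join K' L)"
proof -
  obtain \<tau> \<sigma> where *: "\<tau> \<in> K" "\<sigma> \<in> K" "{\<rho> \<in> K. \<tau> \<subset> \<rho>} = {\<sigma>}" "K' = K - {\<tau>, \<sigma>}"
    using assms(1) by (auto simp: elementary_collapse_def)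
  define \<Lambda> where "\<Lambda> = insert {} L"
  have ne: "\<tau> \<noteq> {}" "\<sigma> \<noteq> {}" "{} \<notin> K" "{} \<notin> L"
    using * assms(2,3) by (auto dest: simplicialD)
  have dec: "\<kappa> = \<kappa>' \<and> \<mu> = \<mu>'" if "\<kappa> \<union> \<mu> = \<kappa>' \<union> \<mu>'" "\<kappa> \<in> insert {} K" "\<kappa>' \<in> insert {} K" "\<mu> \<in> \<Lambda>" "\<mu>' \<in> \<Lambda>"
    for \<kappa> \<kappa>' \<mu> \<mu>'
    using that assms(4) unfolding \<Lambda>_def by blast
  have "elementary_collapse\<^sup>*\<^sup>* (join K L) (join K L - ((\<union>) \<tau> ` \<Lambda> \<union> (\<union>) \<sigma> ` \<Lambda>))"
  proof (rule collapse_family)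
    show "finite \<Lambda>" using assms(3) by (auto simp: \<Lambda>_def dest: simplicialD)
    show "\<tau> \<subset> \<sigma>" using * by blast
    show "l \<inter> \<sigma> = {} \<and> \<tau> \<union> l \<in> join K L \<and> \<sigma> \<union> l \<in> join K L" if "l \<in> \<Lambda>" for l
      using that * assms(4) ne unfolding \<Lambda>_def join_def by blast
    show "\<rho> = \<sigma> \<union> l \<or> (\<exists>l'\<in>\<Lambda>. l \<subset> l' \<and> (\<rho> = \<tau> \<union> l' \<or> \<rho> = \<sigma> \<union> l'))"
      if that': "l \<in> \<Lambda>" "\<rho> \<in> join K L" "\<tau> \<union> l \<subset> \<rho>" for l \<rho>
    proof -
      obtain \<kappa> \<mu> where r: "\<rho> = \<kappa> \<union> \<mu>" "\<kappa> \<in> insert {} K" "\<mu> \<in> \<Lambda>"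
        using that'(2) by (auto simp: join_def \<Lambda>_def)
      have "\<tau> \<inter> \<mu> = {}" "l \<inter> \<kappa> = {}" using *(1) r that'(1) assms(4) unfolding \<Lambda>_def by blast+
      then have sub: "\<tau> \<subseteq> \<kappa>" "l \<subseteq> \<mu>" using that'(3) r(1) by blast+
      then have "\<kappa> = \<tau> \<or> \<kappa> = \<sigma>" using *(3) r(2) ne(1) by blast
      with sub r that'(3) show ?thesis by blast
    qed
  qed
  moreover have "join K L - ((\<union>) \<tau> ` \<Lambda> \<union> (\<union>) \<sigma> ` \<Lambda>) = join K' L" (is "?A = ?B")
  proof
    show "?A \<subseteq> ?B"
    proof
      fix \<rho> assume \<rho>: "\<rho> \<in> ?A"
      then obtain \<kappa> \<mu> where r: "\<rho> = \<kappa> \<union> \<mu>" "\<kappa> \<in> insert {} K" "\<mu> \<in> \<Lambda>" "\<rho> \<noteq> {}"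
        by (auto simp: join_def \<Lambda>_def)
      then have "\<kappa> \<noteq> \<tau>" "\<kappa> \<noteq> \<sigma>" using \<rho> by auto
      then have "\<kappa> \<in> insert {} K'" using r(2) unfolding *(4) by blast
      then show "\<rho> \<in> ?B" using r unfolding join_def \<Lambda>_def by blast
    qed
    show "?B \<subseteq> ?A"
    proof
      fix \<rho> assume "\<rho> \<in> join K' L"
      then obtain \<kappa> \<mu> where r: "\<rho> = \<kappa> \<union> \<mu>" "\<kappa> \<in> insert {} K'" "\<mu> \<in> \<Lambda>" "\<rho> \<noteq> {}"
        by (auto simp: join_def \<Lambda>_def)
      have k: "\<kappa> \<in> insert {} K" "\<kappa> \<noteq> \<tau>" "\<kappa> \<noteq> \<sigma>" using r(2) ne unfolding *(4) by auto
      have "\<rho> \<noteq> \<tau> \<union> l" "\<rho> \<noteq> \<sigma> \<union> l" if "l \<in> \<Lambda>" for l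
        using dec[OF _ k(1) _ r(3) that] r(1) * k by auto
      moreover have "\<rho> \<in> join K L" using r k unfolding join_def \<Lambda>_def by blast
      ultimately show "\<rho> \<in> ?A" by blast
    qed
  qed
  ultimately show ?thesis by simp
qed

text \<open>This is \<open>collapse_family\<close> with \<tau> empty and \<sigma> = {x}: each
  \<open>l\<close> in \<open>L\<close> is matched with \<open>{x} \<union> l\<close>, and only the
  apex is left over.\<close>

lemma collapsible_cone:
  assumes "simplicial L" "x \<notin> \<Union>L"
  shows "collapsible (join {{x}} L)"
proof -
  have ne: "{} \<notin> L" using assms(1) by (auto dest: simplicialD)
  have "elementary_collapse\<^sup>*\<^sup>* (join {{x}} L) (join {{x}} L - ((\<union>) {} ` L \<union> (\<union>) {x} ` L))"
  proof (rule collapse_family)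
    show "finite L" using assms(1) by (rule simplicialD)
    show "\<rho> = {x} \<union> l \<or> (\<exists>l'\<in>L. l \<subset> l' \<and> (\<rho> = {} \<union> l' \<or> \<rho> = {x} \<union> l'))"
      if that': "l \<in> L" "\<rho> \<in> join {{x}} L" "{} \<union> l \<subset> \<rho>" for l \<rho>
    proof -
      obtain \<kappa> \<mu> where r: "\<rho> = \<kappa> \<union> \<mu>" "\<kappa> = {} \<or> \<kappa> = {x}" "\<mu> = {} \<or> \<mu> \<in> L"
        using that'(2) by (auto simp: join_def)
      have "l \<noteq> {}" "x \<notin> l" using that' assms(2) ne by blast+
      then have "l \<subseteq> \<mu>" "\<mu> \<in> L" using that'(3) r by blast+
      with r that'(3) show ?thesis by blast
    qed
  qed (use assms ne in \<open>auto simp: join_def\<close>)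
  moreover have "join {{x}} L - ((\<union>) {} ` L \<union> (\<union>) {x} ` L) = {{x}}"
    using assms(2) ne by (auto simp: join_def subset_singleton_iff)
  ultimately show ?thesis unfolding collapsible_def by auto
qed

lemma collapsible_trans: "elementary_collapse\<^sup>*\<^sup>* K L \<Longrightarrow> collapsible L \<Longrightarrow> collapsible K"
  unfolding collapsible_def by (elim exE) (rule exI, rule rtranclp_trans)

text \<open>Collapsing \<open>K\<close> to a point turns the join into a cone over
  \<open>L\<close>.\<close>

lemma collapsible_join:
  assumes "collapsible K" "simplicial K" "simplicial L" "\<Union>K \<inter> \<Union>L = {}"
  shows "collapsible (join K L)"
proof -
  obtain x where "elementary_collapse\<^sup>*\<^sup>* K {{x}}" using assms(1) by (auto simp: collapsible_def)
  then show ?thesis using assms(2-)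
  proof (induction rule: converse_rtranclp_induct)
    case base
    then show ?case by (intro collapsible_cone) auto
  next
    case (step K K')
    have "simplicial K'" "K' \<subseteq> K" using elementary_collapse_closed step by blast+
    then have "collapsible (join K' L)" using step by blast
    moreover have "elementary_collapse\<^sup>*\<^sup>* (join K L) (join K' L)"
      using collapse_join_step[OF step(1)] step.prems by blast
    ultimately show ?case using collapsible_trans by blast
  qed
qed

section \<open>Deletion of vertices\<close>

definition delete :: "'v \<Rightarrow> 'v complx \<Rightarrow> 'v complx" where
  "delete x X = {\<sigma> \<in> X. x \<notin> \<sigma>}"

text \<open>Adding \<open>x\<close> to both simplices lifts every elementary collapse of the link to
  one of \<open>X\<close>. When the link is down to one vertex \<open>y\<close>, the vertex
  \<open>x\<close> is a free face of the edge \<open>{x,y}\<close>.\<close>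

lemma collapse_vertex:
  assumes "collapsible (link X x)" "simplicial X"
  shows "elementary_collapse\<^sup>*\<^sup>* X (delete x X)"
proof -
  \<comment> \<open>\<open>Y M\<close> is \<open>X\<close> with the link of \<open>x\<close>
    replaced by \<open>M\<close>.\<close>
  define Y where "Y M = delete x X \<union> {{x}} \<union> insert x ` M" for M
  obtain y where y: "elementary_collapse\<^sup>*\<^sup>* (link X x) {{y}}" using assms(1) by (auto simp: collapsible_def)
  have *: "M \<subseteq> link X x \<and> elementary_collapse\<^sup>*\<^sup>* (Y (link X x)) (Y M)"
    if "elementary_collapse\<^sup>*\<^sup>* (link X x) M" for M
    using that
  proof (induction rule: rtranclp_induct)
    case (step M M')
    obtain \<tau> \<sigma> where t: "\<tau> \<in> M" "\<sigma> \<in> M" "{\<rho> \<in> M. \<tau> \<subset> \<rho>} = {\<sigma>}" "M' = M - {\<tau>, \<sigma>}"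
      using step(2) by (auto simp: elementary_collapse_def)
    have M: "\<tau> \<noteq> {}" "x \<notin> \<tau>" if "\<tau> \<in> M" for \<tau> using step.IH that by (auto simp: link_def)
    have inj: "insert x \<rho> = insert x \<rho>' \<longleftrightarrow> \<rho> = \<rho>'" if "\<rho> \<in> M" "\<rho>' \<in> M" for \<rho> \<rho>'
      by (rule insert_ident) (use M that in auto)
    have "elementary_collapse (Y M) (Y M')"
    proof (rule elementary_collapseI)
      show "insert x \<tau> \<in> Y M" "insert x \<sigma> \<in> Y M" using t by (auto simp: Y_def)
      show "{\<rho> \<in> Y M. insert x \<tau> \<subset> \<rho>} = {insert x \<sigma>}"
      proof (intro equalityI subsetI)
        fix \<rho> assume "\<rho> \<in> {\<rho> \<in> Y M. insert x \<tau> \<subset> \<rho>}"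
        then have "\<rho> \<in> Y M" "insert x \<tau> \<subset> \<rho>" by auto
        then obtain \<rho>' where "\<rho> = insert x \<rho>'" "\<rho>' \<in> M"
          using M(1)[OF t(1)] by (auto simp: Y_def delete_def)
        with \<open>insert x \<tau> \<subset> \<rho>\<close> have "\<rho>' = \<sigma>" using M t by blast
        then show "\<rho> \<in> {insert x \<sigma>}" using \<open>\<rho> = insert x \<rho>'\<close> by simp
      next
        fix \<rho> assume "\<rho> \<in> {insert x \<sigma>}"
        moreover have "insert x \<tau> \<subset> insert x \<sigma>"
          using t(1,2,3) inj[OF t(1,2)] by (auto simp: psubset_eq)
        ultimately show "\<rho> \<in> {\<rho> \<in> Y M. insert x \<tau> \<subset> \<rho>}" using t by (auto simp: Y_def)
      qed
      show "Y M' = Y M - {insert x \<tau>, insert x \<sigma>}"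
      proof -
        have "insert x ` M' = insert x ` M - {insert x \<tau>, insert x \<sigma>}"
          unfolding t(4) using inj t(1,2) by auto
        moreover have "insert x \<tau> \<noteq> {x}" "insert x \<sigma> \<noteq> {x}" using M t(1,2) by auto
        ultimately show ?thesis unfolding Y_def delete_def by auto
      qed
    qed
    with step show ?case using t(4) by (auto intro: rtranclp.rtrancl_into_rtrancl)
  qed auto
  have y': "{y} \<in> link X x" using *[OF y] by blast
  then have "insert x {y} \<in> X" by (simp add: link_def)
  then have xX: "{x} \<in> X" by (rule simplicialD(4)[OF assms(2)]) auto
  have "Y (link X x) = X"
  proof (intro equalityI subsetI)
    fix \<rho> assume "\<rho> \<in> X"
    show "\<rho> \<in> Y (link X x)"
    proof (cases "x \<in> \<rho> \<and> \<rho> \<noteq> {x}")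
      case True
      then have "\<rho> = insert x (\<rho> - {x})" "\<rho> - {x} \<in> link X x"
        using \<open>\<rho> \<in> X\<close> by (auto simp: link_def insert_absorb)
      then show ?thesis unfolding Y_def by blast
    qed (use \<open>\<rho> \<in> X\<close> in \<open>auto simp: Y_def delete_def\<close>)
  qed (use xX in \<open>auto simp: Y_def delete_def link_def\<close>)
  moreover have "elementary_collapse (Y {{y}}) (delete x X)"
    using y' by (intro elementary_collapseI[of "{x}" _ "{x,y}"]) (auto simp: Y_def delete_def link_def)
  ultimately show ?thesis using *[OF y] by (auto intro: rtranclp.rtrancl_into_rtrancl)
qed

text \<open>The vertex \<open>x\<close> is dominated by \<open>y\<close>: its link is a cone with apex \<open>y\<close>, so deleting \<open>x\<close> is a
  collapse.\<close>

definition strong_step :: "'v complx \<Rightarrow> 'v complx \<Rightarrow> bool" where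
  "strong_step X Y \<longleftrightarrow> (\<exists>x y. x \<noteq> y \<and> (\<forall>\<sigma>\<in>X. x \<in> \<sigma> \<longrightarrow> insert y \<sigma> \<in> X) \<and> Y = delete x X)"

lemma strong_stepI:
  assumes "x \<noteq> y" "\<And>\<sigma>. \<sigma> \<in> X \<Longrightarrow> x \<in> \<sigma> \<Longrightarrow> insert y \<sigma> \<in> X" "Y = delete x X"
  shows "strong_step X Y"
  using assms unfolding strong_step_def by blast

lemma simplicial_delete: "simplicial X \<Longrightarrow> simplicial (delete x X)"
  unfolding simplicial_def delete_def by (auto dest: finite_subset)

text \<open>The simplices containing \<open>x\<close> split into pairs that differ by
  \<open>y\<close>: for \<open>l\<close> avoiding both vertices, \<open>{x} \<union> l\<close> is
  matched with \<open>{x,y} \<union> l\<close>, which lies in \<open>X\<close> because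
  \<open>y\<close> dominates \<open>x\<close>.\<close>

lemma strong_step_collapse:
  assumes "strong_step X Y" "simplicial X"
  shows "elementary_collapse\<^sup>*\<^sup>* X Y"
proof -
  obtain x y where xy: "x \<noteq> y" "\<And>\<sigma>. \<sigma> \<in> X \<Longrightarrow> x \<in> \<sigma> \<Longrightarrow> insert y \<sigma> \<in> X" "Y = delete x X"
    using assms(1) unfolding strong_step_def by blast
  define \<Lambda> where "\<Lambda> = {l. x \<notin> l \<and> y \<notin> l \<and> insert x l \<in> X}"
  have dec: "\<exists>l\<in>\<Lambda>. \<rho> = {x} \<union> l \<or> \<rho> = {x,y} \<union> l" if "\<rho> \<in> X" "x \<in> \<rho>" for \<rho>
  proof -
    have "insert x (\<rho> - {x,y}) \<in> X"
      by (rule simplicialD(4)[OF assms(2) that(1)]) (use that(2) in auto)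
    then have "\<rho> - {x,y} \<in> \<Lambda>" by (simp add: \<Lambda>_def)
    moreover have "\<rho> = {x} \<union> (\<rho> - {x,y}) \<or> \<rho> = {x,y} \<union> (\<rho> - {x,y})"
      using that(2) by (cases "y \<in> \<rho>") blast+
    ultimately show ?thesis by blast
  qed
  have "elementary_collapse\<^sup>*\<^sup>* X (X - ((\<union>) {x} ` \<Lambda> \<union> (\<union>) {x,y} ` \<Lambda>))"
  proof (rule collapse_family)
    have "\<Lambda> \<subseteq> Pow (\<Union>X)" by (auto simp: \<Lambda>_def)
    moreover have "finite (\<Union>X)" using assms(2) by (auto dest: simplicialD)
    ultimately show "finite \<Lambda>" by (meson finite_Pow_iff finite_subset)
    show "\<rho> = {x,y} \<union> l \<or> (\<exists>l'\<in>\<Lambda>. l \<subset> l' \<and> (\<rho> = {x} \<union> l' \<or> \<rho> = {x,y} \<union> l'))"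
      if l: "l \<in> \<Lambda>" "\<rho> \<in> X" "{x} \<union> l \<subset> \<rho>" for l \<rho>
    proof -
      obtain l' where l': "l' \<in> \<Lambda>" "\<rho> = {x} \<union> l' \<or> \<rho> = {x,y} \<union> l'" using dec l by blast
      then have "l \<subseteq> l'" using l unfolding \<Lambda>_def by blast
      with l' l show ?thesis by blast
    qed
    show "l \<inter> {x,y} = {} \<and> {x} \<union> l \<in> X \<and> {x,y} \<union> l \<in> X" if "l \<in> \<Lambda>" for l
      using that xy(2)[of "insert x l"] by (auto simp: \<Lambda>_def insert_commute)
  qed (use xy in auto)
  moreover have "X - ((\<union>) {x} ` \<Lambda> \<union> (\<union>) {x,y} ` \<Lambda>) = delete x X"
    unfolding delete_def using dec by auto
  ultimately show ?thesis using xy by simp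
qed

lemma strong_steps_collapse:
  assumes "strong_step\<^sup>*\<^sup>* X Y" "simplicial X"
  shows "simplicial Y \<and> elementary_collapse\<^sup>*\<^sup>* X Y"
  using assms
proof (induction rule: rtranclp_induct)
  case (step Y Z)
  then have Y: "simplicial Y" "elementary_collapse\<^sup>*\<^sup>* X Y" by auto
  have "simplicial Z" using step(2) simplicial_delete[OF Y(1)] by (auto simp: strong_step_def)
  moreover have "elementary_collapse\<^sup>*\<^sup>* X Z"
    using Y(2) strong_step_collapse[OF step(2) Y(1)] by (rule rtranclp_trans)
  ultimately show ?case by simp
qed simp

section \<open>Order complexes and monotone retractions\<close>

definition le_chains :: "('b \<Rightarrow> 'b \<Rightarrow> bool) \<Rightarrow> 'b set \<Rightarrow> 'b complx" where
  "le_chains le Q = {S. S \<noteq> {} \<and> finite S \<and> S \<subseteq> Q \<and> (\<forall>a\<in>S. \<forall>b\<in>S. le a b \<or> le b a)}"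

text \<open>The elements not fixed by \<open>r\<close> are removed, minimal ones first. Everything
  strictly below a minimal one, \<open>y\<close>, is fixed, so by monotonicity whatever is
  comparable to \<open>y\<close> is comparable to \<open>r y\<close>, that is, \<open>r y\<close>
  dominates \<open>y\<close>. The order is a parameter so that, by reversing inclusion, the same
  argument covers retractions that enlarge sets.\<close>

lemma le_chains_closure:
  assumes "finite Q" "\<And>a. le a a" "\<And>a b c. le a b \<Longrightarrow> le b c \<Longrightarrow> le a c" "\<And>a b. le a b \<Longrightarrow> le b a \<Longrightarrow> a = b"
    and "\<And>a. a \<in> Q \<Longrightarrow> r a \<in> Q \<and> le (r a) a \<and> r (r a) = r a"
    and "\<And>a b. a \<in> Q \<Longrightarrow> b \<in> Q \<Longrightarrow> le a b \<Longrightarrow> le (r a) (r b)"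
  shows "strong_step\<^sup>*\<^sup>* (le_chains le Q) (le_chains le (r ` Q))"
  using assms(1,5,6)
proof (induction "card {a \<in> Q. r a \<noteq> a}" arbitrary: Q)
  case 0
  then have "r a = a" if "a \<in> Q" for a using that by auto
  then have "r ` Q = Q" by force
  then show ?case by simp
next
  case (Suc n)
  let ?N = "{a \<in> Q. r a \<noteq> a}"
  have "finite ?N" using Suc.prems(1) by simp
  moreover have "?N \<noteq> {}" using Suc(2) by (metis card.empty Zero_not_Suc)
  ultimately have "\<exists>y\<in>?N. \<forall>z\<in>?N. le z y \<longrightarrow> z = y"
  proof (induction rule: finite_ne_induct)
    case (insert x F)
    then obtain y where y: "y \<in> F" "\<And>z. z \<in> F \<Longrightarrow> le z y \<Longrightarrow> z = y" by blast
    show ?case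
    proof (cases "le x y")
      case True
      have "z = x" if "z \<in> F" "le z x" for z
        using y(2)[OF that(1)] assms(3)[OF that(2) True] assms(4)[OF True] that by auto
      then show ?thesis by (intro bexI[of _ x]) auto
    next
      case False
      then show ?thesis using y by (intro bexI[of _ y]) auto
    qed
  qed simp
  then obtain y where y: "y \<in> Q" "r y \<noteq> y" "\<And>z. z \<in> Q \<Longrightarrow> r z \<noteq> z \<Longrightarrow> le z y \<Longrightarrow> z = y"
    by auto
  have fix_below: "r z = z" if "z \<in> Q" "z \<noteq> y" "le z y" for z using y(3) that by blast
  have "strong_step (le_chains le Q) (le_chains le (Q - {y}))"
  proof (rule strong_stepI)
    fix S assume S: "S \<in> le_chains le Q" "y \<in> S"
    have "le z (r y) \<or> le (r y) z" if "z \<in> S" for z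
    proof (cases "le y z")
      case True
      then show ?thesis using Suc.prems(2)[OF y(1)] assms(3)[of "r y" y z] by simp
    next
      case False
      then have "le z y" "z \<noteq> y" "z \<in> Q" using S that assms(2) by (auto simp: le_chains_def)
      then show ?thesis using fix_below[of z] Suc.prems(3)[of z y] y(1) by simp
    qed
    then show "insert (r y) S \<in> le_chains le Q"
      using S Suc.prems(2)[OF y(1)] assms(2) by (auto simp: le_chains_def)
  qed (use y(2) in \<open>auto simp: le_chains_def delete_def\<close>)
  moreover have "strong_step\<^sup>*\<^sup>* (le_chains le (Q - {y})) (le_chains le (r ` (Q - {y})))"
  proof (rule Suc.hyps(1))
    have "{a \<in> Q - {y}. r a \<noteq> a} = ?N - {y}" by blast
    then show "n = card {a \<in> Q - {y}. r a \<noteq> a}" using Suc(2) y(1,2) \<open>finite ?N\<close> by simp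
    show "r a \<in> Q - {y} \<and> le (r a) a \<and> r (r a) = r a" if "a \<in> Q - {y}" for a
      using Suc.prems(2)[of a] that y(2) by auto
    show "finite (Q - {y})" using Suc.prems(1) by simp
    show "le (r a) (r b)" if "a \<in> Q - {y}" "b \<in> Q - {y}" "le a b" for a b
      using Suc.prems(3) that by simp
  qed
  moreover have "r ` (Q - {y}) = r ` Q"
  proof -
    have "r (r y) = r y" "r y \<in> Q - {y}" using Suc.prems(2)[OF y(1)] y(2) by auto
    then have "r y \<in> r ` (Q - {y})" by (metis imageI)
    then show ?thesis by auto
  qed
  ultimately show ?case by (simp add: converse_rtranclp_into_rtranclp)
qed

lemma sd_eq_le_chains: "sd Q = le_chains (\<subseteq>) Q" "sd Q = le_chains (\<lambda>a b. b \<subseteq> a) Q"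
  unfolding sd_def le_chains_def by (rule refl) (intro Collect_cong conj_cong refl ball_cong, rule disj_commute)

lemma link_le_chains:
  assumes "le x x" "x \<in> Q"
  shows "link (le_chains le Q) x = le_chains le {y \<in> Q. y \<noteq> x \<and> (le y x \<or> le x y)}"
proof (intro set_eqI)
  fix S
  have "S \<in> link (le_chains le Q) x \<longleftrightarrow> S \<noteq> {} \<and> x \<notin> S \<and> finite S \<and> S \<subseteq> Q \<and>
      (\<forall>y\<in>S. le y x \<or> le x y) \<and> (\<forall>a\<in>S. \<forall>b\<in>S. le a b \<or> le b a)"
    using assms by (simp add: link_def le_chains_def) blast
  moreover have "S \<in> le_chains le {y \<in> Q. y \<noteq> x \<and> (le y x \<or> le x y)} \<longleftrightarrow> S \<noteq> {} \<and> x \<notin> S \<and> finite S \<and>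
      S \<subseteq> Q \<and> (\<forall>y\<in>S. le y x \<or> le x y) \<and> (\<forall>a\<in>S. \<forall>b\<in>S. le a b \<or> le b a)"
    unfolding le_chains_def by blast
  ultimately show "S \<in> link (le_chains le Q) x \<longleftrightarrow> S \<in> le_chains le {y \<in> Q. y \<noteq> x \<and> (le y x \<or> le x y)}"
    by simp
qed

lemma link_sd:
  "x \<in> Q \<Longrightarrow> link (sd Q) x = sd {y \<in> Q. y \<noteq> x \<and> (y \<subseteq> x \<or> x \<subseteq> y)}"
  unfolding sd_eq_le_chains(1) by (rule link_le_chains) auto

lemma sd_closure:
  assumes "finite Q" "\<And>a. a \<in> Q \<Longrightarrow> r a \<in> Q \<and> r (r a) = r a"
    and "\<And>a b. a \<in> Q \<Longrightarrow> b \<in> Q \<Longrightarrow> a \<subseteq> b \<Longrightarrow> r a \<subseteq> r b"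
    and "(\<forall>a\<in>Q. r a \<subseteq> a) \<or> (\<forall>a\<in>Q. a \<subseteq> r a)"
  shows "strong_step\<^sup>*\<^sup>* (sd Q) (sd (r ` Q))"
proof -
  show ?thesis
  proof (cases "\<forall>a\<in>Q. r a \<subseteq> a")
    case True
    show ?thesis unfolding sd_eq_le_chains(1) by (rule le_chains_closure) (use assms True in auto)
  next
    case False
    then have "\<forall>a\<in>Q. a \<subseteq> r a" using assms(4) by blast
    then show ?thesis unfolding sd_eq_le_chains(2) by (intro le_chains_closure) (use assms in auto)
  qed
qed

lemma sd_retract_collapsible:
  assumes "finite Q" "\<And>a. a \<in> Q \<Longrightarrow> r a \<in> Q \<and> r (r a) = r a"
    and "\<And>a b. a \<in> Q \<Longrightarrow> b \<in> Q \<Longrightarrow> a \<subseteq> b \<Longrightarrow> r a \<subseteq> r b"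
    and "(\<forall>a\<in>Q. r a \<subseteq> a) \<or> (\<forall>a\<in>Q. a \<subseteq> r a)" "collapsible (sd (r ` Q))"
  shows "collapsible (sd Q)"
proof -
  have "strong_step\<^sup>*\<^sup>* (sd Q) (sd (r ` Q))" by (rule sd_closure) (use assms(1-4) in auto)
  then have "elementary_collapse\<^sup>*\<^sup>* (sd Q) (sd (r ` Q))"
    using strong_steps_collapse simplicial_sd[OF assms(1)] by auto
  then show ?thesis using assms(5) by (rule collapsible_trans)
qed

section \<open>Barycentric subdivision and collapses\<close>

lemma collapsible_sd_apex:
  assumes "finite Q" "m \<in> Q" "(\<forall>q\<in>Q. q \<subseteq> m) \<or> (\<forall>q\<in>Q. m \<subseteq> q)"
  shows "collapsible (sd Q)"
proof (rule sd_retract_collapsible[where r="\<lambda>_. m"])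
  have "(\<lambda>_. m) ` Q = {m}" using assms(2) by auto
  moreover have "sd {m} = {{m}}" by (auto simp: sd_def)
  ultimately show "collapsible (sd ((\<lambda>_. m) ` Q))" unfolding collapsible_def by auto
qed (use assms in auto)

text \<open>In the subdivision the vertex \<tau> is dominated by \<sigma>, because \<sigma> is the
  only simplex properly above \<tau>. Once \<tau> is gone, the link of \<sigma> is the subdivided
  boundary of \<sigma> without the facet \<tau>. Adding the vertex opposite to \<tau> contracts this
  link, so \<sigma> can be deleted as well.\<close>

lemma sd_collapse_step:
  assumes "elementary_collapse K L" "simplicial K"
  shows "elementary_collapse\<^sup>*\<^sup>* (sd K) (sd L)"
proof -
  obtain \<tau> \<sigma> where t: "\<tau> \<in> K" "\<sigma> \<in> K" "\<tau> \<subset> \<sigma>" "\<And>\<rho>. \<rho> \<in> K \<Longrightarrow> \<tau> \<subset> \<rho> \<Longrightarrow> \<rho> = \<sigma>" "L = K - {\<tau>, \<sigma>}"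
    by (rule elementary_collapseE[OF assms(1)]) blast
  have fin: "finite K" using assms(2) by (rule simplicialD)
  define Q where "Q = K - {\<tau>}"
  have "strong_step (sd K) (sd Q)"
  proof (rule strong_stepI)
    show "\<tau> \<noteq> \<sigma>" using t(3) by auto
    fix S assume S: "S \<in> sd K" "\<tau> \<in> S"
    have "z \<subseteq> \<sigma>" if "z \<in> S" for z
    proof (cases "\<tau> \<subset> z")
      case True
      then show ?thesis using t(4) S that by (auto simp: sd_def)
    next
      case False
      then have "z \<subseteq> \<tau>" using S that by (auto simp: sd_def)
      then show ?thesis using t(3) by auto
    qed
    then show "insert \<sigma> S \<in> sd K" using S t(2) by (auto simp: sd_def)
  qed (auto simp: sd_def delete_def Q_def)
  then have 1: "elementary_collapse\<^sup>*\<^sup>* (sd K) (sd Q)"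
    by (rule strong_step_collapse) (rule simplicial_sd[OF fin])
  obtain a where a: "a \<in> \<sigma>" "a \<notin> \<tau>" using t(3) by auto
  have "insert a \<tau> \<in> K" by (rule simplicialD(4)[OF assms(2) t(2)]) (use a t(3) in auto)
  then have sig: "\<sigma> = insert a \<tau>" using t(4)[of "insert a \<tau>"] a by auto
  define B where "B = {\<rho>. \<rho> \<subset> \<sigma> \<and> \<rho> \<noteq> {} \<and> \<rho> \<noteq> \<tau>}"
  have tne: "\<tau> \<noteq> {}" using simplicialD(2)[OF assms(2) t(1)] .
  \<comment> \<open>Adding \<open>a\<close> never produces all of \<sigma>, because a proper face
    other than \<tau> misses some vertex of \<tau>.\<close>
  have B: "insert a \<rho> \<in> B" if "\<rho> \<in> B" for \<rho>
  proof -
    have *: "\<rho> \<subseteq> insert a \<tau>" "\<rho> \<noteq> insert a \<tau>" "\<rho> \<noteq> \<tau>" using that by (auto simp: B_def sig)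
    have "insert a \<rho> \<noteq> insert a \<tau>"
    proof
      assume e: "insert a \<rho> = insert a \<tau>"
      show False
      proof (cases "a \<in> \<rho>")
        case True
        then show ?thesis using e *(2) by (simp add: insert_absorb)
      next
        case False
        then show ?thesis using e *(3) a(2) insert_ident by metis
      qed
    qed
    then show ?thesis using *(1) a(2) by (auto simp: B_def sig)
  qed
  have "B \<subseteq> Pow \<sigma>" by (auto simp: B_def)
  then have finB: "finite B" using simplicialD(3)[OF assms(2) t(2)] by (simp add: finite_subset)
  have "collapsible (sd (insert a ` B))"
  proof (rule collapsible_sd_apex)
    have "{a} \<in> B" using a(2) tne by (auto simp: sig B_def)
    then show "{a} \<in> insert a ` B" by (intro image_eqI[of _ _ "{a}"]) auto
  qed (use finB in auto)
  then have "collapsible (sd B)"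
    by (intro sd_retract_collapsible[where r="insert a" and Q=B]) (use B finB in auto)
  moreover have "link (sd Q) \<sigma> = sd B"
  proof -
    have "\<rho> \<in> B \<longleftrightarrow> \<rho> \<in> Q \<and> \<rho> \<noteq> \<sigma> \<and> (\<rho> \<subseteq> \<sigma> \<or> \<sigma> \<subseteq> \<rho>)" for \<rho>
    proof
      assume r: "\<rho> \<in> B"
      then have "\<rho> \<in> K" by (intro simplicialD(4)[OF assms(2) t(2)]) (auto simp: B_def)
      then show "\<rho> \<in> Q \<and> \<rho> \<noteq> \<sigma> \<and> (\<rho> \<subseteq> \<sigma> \<or> \<sigma> \<subseteq> \<rho>)" using r by (auto simp: B_def Q_def)
    next
      assume r: "\<rho> \<in> Q \<and> \<rho> \<noteq> \<sigma> \<and> (\<rho> \<subseteq> \<sigma> \<or> \<sigma> \<subseteq> \<rho>)"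
      have "\<not> \<sigma> \<subseteq> \<rho>"
      proof
        assume "\<sigma> \<subseteq> \<rho>"
        then have "\<tau> \<subset> \<rho>" using t(3) by auto
        then show False using t(4)[of \<rho>] r by (auto simp: Q_def)
      qed
      then show "\<rho> \<in> B" using r simplicialD(2)[OF assms(2), of \<rho>] by (auto simp: B_def Q_def)
    qed
    then have "B = {\<rho> \<in> Q. \<rho> \<noteq> \<sigma> \<and> (\<rho> \<subseteq> \<sigma> \<or> \<sigma> \<subseteq> \<rho>)}" by (intro set_eqI) simp
    moreover have "\<sigma> \<in> Q" using t(2,3) by (auto simp: Q_def)
    ultimately show ?thesis using link_sd[of \<sigma> Q] by simp
  qed
  ultimately have "collapsible (link (sd Q) \<sigma>)" by simp
  then have "elementary_collapse\<^sup>*\<^sup>* (sd Q) (delete \<sigma> (sd Q))"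
    by (rule collapse_vertex) (use fin in \<open>simp add: simplicial_sd Q_def\<close>)
  moreover have "delete \<sigma> (sd Q) = sd L" unfolding delete_def sd_def Q_def t(5) by auto
  ultimately show ?thesis using rtranclp_trans[OF 1] by simp
qed

lemma collapsible_sd:
  assumes "collapsible K" "simplicial K"
  shows "collapsible (sd K)"
proof -
  obtain x where "elementary_collapse\<^sup>*\<^sup>* K {{x}}" using assms(1) by (auto simp: collapsible_def)
  then show ?thesis using assms(2)
  proof (induction rule: converse_rtranclp_induct)
    case base
    show ?case by (rule collapsible_sd_apex[of _ "{x}"]) auto
  next
    case (step K K')
    have "collapsible (sd K')" using step.IH elementary_collapse_closed(1)[OF step(1) step.prems] .
    with sd_collapse_step[OF step(1) step.prems] show ?case by (rule collapsible_trans)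
  qed
qed

lemma collapsible_image:
  assumes "collapsible K" "inj_on f (\<Union>K)" "simplicial K"
  shows "collapsible ((`) f ` K)"
proof -
  obtain x where "elementary_collapse\<^sup>*\<^sup>* K {{x}}" using assms(1) by (auto simp: collapsible_def)
  then show ?thesis using assms(2,3)
  proof (induction rule: converse_rtranclp_induct)
    case base
    have "(`) f ` {{x}} = {{f x}}" by auto
    then show ?case unfolding collapsible_def by auto
  next
    case (step K K')
    have K': "simplicial K'" "K' \<subseteq> K" using elementary_collapse_closed[OF step(1) step.prems(2)] by auto
    then have "inj_on f (\<Union>K')" using step.prems(1) by (meson Union_mono inj_on_subset)
    then have c: "collapsible ((`) f ` K')" using step.IH K'(1) by simp
    have e: "elementary_collapse ((`) f ` K) ((`) f ` K')"
    proof -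
      obtain \<tau> \<sigma> where t: "\<tau> \<in> K" "\<sigma> \<in> K" "\<tau> \<subset> \<sigma>" "\<And>\<rho>. \<rho> \<in> K \<Longrightarrow> \<tau> \<subset> \<rho> \<Longrightarrow> \<rho> = \<sigma>" "K' = K - {\<tau>, \<sigma>}"
        by (rule elementary_collapseE[OF step(1)]) blast
      have sub: "f ` A \<subseteq> f ` B \<longleftrightarrow> A \<subseteq> B" if "A \<in> K" "B \<in> K" for A B
        by (rule inj_on_image_subset_iff[OF step.prems(1)]) (use that in auto)
      then have psub: "f ` A \<subset> f ` B \<longleftrightarrow> A \<subset> B" if "A \<in> K" "B \<in> K" for A B
        using that by (simp add: less_le_not_le)
      have eq: "f ` A = f ` B \<longleftrightarrow> A = B" if "A \<in> K" "B \<in> K" for A B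
        using sub[OF that] sub[OF that(2,1)] by auto
      show ?thesis
      proof (rule elementary_collapseI)
        show "{\<rho> \<in> (`) f ` K. f ` \<tau> \<subset> \<rho>} = {f ` \<sigma>}"
        proof (intro equalityI subsetI)
          fix \<rho> assume "\<rho> \<in> {\<rho> \<in> (`) f ` K. f ` \<tau> \<subset> \<rho>}"
          then obtain \<rho>' where "\<rho> = f ` \<rho>'" "\<rho>' \<in> K" "f ` \<tau> \<subset> f ` \<rho>'"
            by (elim CollectE conjE imageE) simp
          then show "\<rho> \<in> {f ` \<sigma>}" using psub[OF t(1)] t(4) by auto
        next
          fix \<rho> assume "\<rho> \<in> {f ` \<sigma>}"
          then show "\<rho> \<in> {\<rho> \<in> (`) f ` K. f ` \<tau> \<subset> \<rho>}" using psub[OF t(1,2)] t(2,3) by auto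
        qed
        show "(`) f ` K' = (`) f ` K - {f ` \<tau>, f ` \<sigma>}" unfolding t(5) using eq t(1,2) by auto
      qed (use t(1,2) in auto)
    qed
    show ?case by (rule collapsible_trans[OF r_into_rtranclp[of elementary_collapse, OF e] c])
  qed
qed

section \<open>Connectedness of realizations\<close>

abbreviation homo :: "'a::topological_space set \<Rightarrow> 'b::topological_space set \<Rightarrow> ('a \<Rightarrow> 'b) \<Rightarrow> ('a \<Rightarrow> 'b) \<Rightarrow> bool" where
  "homo \<equiv> homotopic_with_canon (\<lambda>_. True)"

text \<open>The unit sphere of \<real>^n, of dimension n - 1, inside the sequences that vanish from
  index \<open>n\<close> on; so \<open>nsphere i\<close> is \<open>sph (Suc i)\<close>.\<close>

definition sph :: "nat \<Rightarrow> (nat \<Rightarrow> real) set" where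
  "sph n = {x. (\<forall>k\<ge>n. x k = 0) \<and> (\<Sum>k<n. (x k)\<^sup>2) = 1}"

lemma nsphere_eq: "nsphere i = top_of_set (sph (Suc i))"
proof -
  have "{x. (\<Sum>k\<le>i. (x k)\<^sup>2) = 1 \<and> (\<forall>k>i. x k = 0)} = sph (Suc i)"
    by (auto simp: sph_def lessThan_Suc_atMost Suc_le_eq)
  then show ?thesis by (simp add: nsphere euclidean_product_topology)
qed

lemma m_connected_iff:
  "m_connected m K \<longleftrightarrow> realization K \<noteq> {} \<and>
     (\<forall>i\<le>m. \<forall>g. continuous_on (sph (Suc i)) g \<and> g ` sph (Suc i) \<subseteq> realization K \<longrightarrow>
        (\<exists>a\<in>realization K. homo (sph (Suc i)) (realization K) g (\<lambda>_. a)))"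
  unfolding m_connected_def m_connected_space_def nsphere_eq by (auto simp: image_subset_iff_funcset)

lemma m_connectedD:
  assumes "m_connected m K" "i \<le> m" "continuous_on (sph (Suc i)) g" "g ` sph (Suc i) \<subseteq> realization K"
  obtains a where "a \<in> realization K" "homo (sph (Suc i)) (realization K) g (\<lambda>_. a)"
  using assms unfolding m_connected_iff by blast

lemma simplex_pts_convex:
  assumes "\<alpha> \<in> simplex_pts \<sigma>" "\<beta> \<in> simplex_pts \<sigma>" "0 \<le> t" "t \<le> 1"
  shows "(\<lambda>x. (1 - t) * \<alpha> x + t * \<beta> x) \<in> simplex_pts \<sigma>"
proof -
  have "(\<Sum>x\<in>\<sigma>. (1 - t) * \<alpha> x + t * \<beta> x) = (1 - t) * sum \<alpha> \<sigma> + t * sum \<beta> \<sigma>"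
    by (simp add: sum.distrib sum_distrib_left)
  then show ?thesis using assms unfolding simplex_pts_def by auto
qed

lemma simplex_pts_mono:
  assumes "\<alpha> \<in> simplex_pts \<sigma>" "\<sigma> \<subseteq> \<tau>" "finite \<tau>"
  shows "\<alpha> \<in> simplex_pts \<tau>"
proof -
  have "sum \<alpha> \<tau> = sum \<alpha> \<sigma>"
    by (rule sum.mono_neutral_right) (use assms in \<open>auto simp: simplex_pts_def\<close>)
  then show ?thesis using assms unfolding simplex_pts_def by auto
qed

text \<open>The segment from \<open>f z\<close> to \<open>g z\<close> stays in a simplex that
  contains both ends. This simplex may vary with \<open>z\<close> in any manner, because continuity
  is checked coordinate by coordinate.\<close>

lemma contiguous_homotopic:
  fixes f g :: "'a::topological_space \<Rightarrow> 'v \<Rightarrow> real"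
  assumes f: "continuous_on S f" and g: "continuous_on S g"
    and fg: "\<And>z. z \<in> S \<Longrightarrow> \<exists>\<sigma>\<in>X. f z \<in> simplex_pts \<sigma> \<and> g z \<in> simplex_pts \<sigma>"
  shows "homo S (realization X) f g"
proof -
  define h where "h = (\<lambda>(t::real, z) x. (1 - t) * f z x + t * g z x)"
  have "continuous_on ({0..1} \<times> S) (\<lambda>p. h p x)" for x
    unfolding h_def case_prod_beta
    by (intro continuous_intros continuous_on_compose2[OF continuous_on_product_then_coordinatewise[OF f]]
        continuous_on_compose2[OF continuous_on_product_then_coordinatewise[OF g]]) auto
  then have "continuous_on ({0..1} \<times> S) h" by (rule continuous_on_coordinatewise_then_product)
  moreover have "h ` ({0..1} \<times> S) \<subseteq> realization X"
  proof clarify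
    fix t :: real and z assume "t \<in> {0..1}" "z \<in> S"
    then show "h (t, z) \<in> realization X"
      using fg[of z] simplex_pts_convex[of "f z" _ "g z" t] unfolding h_def realization_def by auto
  qed
  ultimately show ?thesis
    unfolding homotopic_with_def
    by (intro exI[of _ h]) (auto simp: h_def image_subset_iff_funcset)
qed

text \<open>By \<open>qp\<close>, the straight-line homotopy from \<open>q \<circ> p\<close> to the identity stays in the realization.\<close>

lemma m_connected_dominated:
  assumes Y: "m_connected m Y"
    and p: "continuous_on (realization X) p" "p ` realization X \<subseteq> realization Y"
    and q: "continuous_on (realization Y) q" "q ` realization Y \<subseteq> realization X"
    and qp: "\<And>\<alpha>. \<alpha> \<in> realization X \<Longrightarrow> \<exists>\<sigma>\<in>X. \<alpha> \<in> simplex_pts \<sigma> \<and> q (p \<alpha>) \<in> simplex_pts \<sigma>"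
  shows "m_connected m X"
  unfolding m_connected_iff
proof (intro conjI allI impI)
  show "realization X \<noteq> {}" using Y q unfolding m_connected_iff by auto
  fix i g assume i: "i \<le> m" and g: "continuous_on (sph (Suc i)) g \<and> g ` sph (Suc i) \<subseteq> realization X"
  let ?S = "sph (Suc i)"
  have "continuous_on ?S (p \<circ> g)"
    using g by (intro continuous_on_compose continuous_on_subset[OF p(1)]) auto
  moreover have "(p \<circ> g) ` ?S \<subseteq> realization Y" using g p by auto
  ultimately obtain a where a: "a \<in> realization Y" "homo ?S (realization Y) (p \<circ> g) (\<lambda>_. a)"
    using m_connectedD[OF Y i] by blast
  have "continuous_on (realization X) (q \<circ> p)"
    by (intro continuous_on_compose p(1) continuous_on_subset[OF q(1) p(2)])
  from continuous_on_compose[OF _ continuous_on_subset[OF this]]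
  have qpg: "continuous_on ?S (q \<circ> p \<circ> g)" using g by blast
  have "homo ?S (realization X) g (q \<circ> p \<circ> g)"
    by (rule contiguous_homotopic[OF conjunct1[OF g] qpg]) (use g qp in auto)
  moreover have "homo ?S (realization X) (q \<circ> (p \<circ> g)) (q \<circ> (\<lambda>_. a))"
    by (rule homotopic_with_compose_continuous_map_left[OF a(2)]) (use q in \<open>auto simp: image_subset_iff_funcset\<close>)
  ultimately have "homo ?S (realization X) g (\<lambda>_. q a)"
    unfolding o_def by (rule homotopic_with_trans)
  moreover have "q a \<in> realization X" using q a by auto
  ultimately show "\<exists>a\<in>realization X. homo ?S (realization X) g (\<lambda>_. a)" by blast
qed

text \<open>The retraction moves the weight at \<open>x\<close> to the dominating vertex
  \<open>y\<close>. A point and its image lie in a common simplex, \<open>insert y \<sigma>\<close>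
  if \<open>x\<close> occurs in \<sigma>, so the composite with the inclusion of \<open>Y\<close> is
  homotopic to the identity along straight lines.\<close>

lemma m_connected_strong_step:
  assumes "strong_step X Y" "simplicial X" "m_connected m Y"
  shows "m_connected m X"
proof -
  obtain x y where xy: "x \<noteq> y" "\<forall>\<sigma>\<in>X. x \<in> \<sigma> \<longrightarrow> insert y \<sigma> \<in> X" "Y = delete x X"
    using assms(1) unfolding strong_step_def by auto
  define p where "p = (\<lambda>(\<alpha>::'a \<Rightarrow> real) z. if z = x then 0 else if z = y then \<alpha> x + \<alpha> y else \<alpha> z)"
  have p: "p \<alpha> \<in> realization Y \<and> (\<exists>\<sigma>\<in>X. \<alpha> \<in> simplex_pts \<sigma> \<and> p \<alpha> \<in> simplex_pts \<sigma>)"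
    if a: "\<alpha> \<in> realization X" for \<alpha>
  proof -
    obtain \<sigma> where s: "\<sigma> \<in> X" "\<alpha> \<in> simplex_pts \<sigma>" using a by (auto simp: realization_def)
    have fin: "finite \<sigma>" using simplicialD(3)[OF assms(2) s(1)] .
    show ?thesis
    proof (cases "x \<in> \<sigma>")
      case False
      then have "p \<alpha> = \<alpha>" using s(2) by (auto simp: p_def simplex_pts_def)
      moreover have "\<sigma> \<in> Y" using s(1) False xy(3) by (simp add: delete_def)
      ultimately show ?thesis using s by (auto simp: realization_def)
    next
      case True
      define \<tau> where "\<tau> = insert y (\<sigma> - {x})"
      have t: "insert y \<sigma> \<in> X" using xy(2) True s by auto
      have "\<tau> \<in> X" by (rule simplicialD(4)[OF assms(2) t]) (auto simp: \<tau>_def)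
      then have tY: "\<tau> \<in> Y" using xy by (auto simp: delete_def \<tau>_def)
      have al: "\<alpha> \<in> simplex_pts (insert y \<sigma>)" by (rule simplex_pts_mono[OF s(2)]) (use fin in auto)
      have "sum (p \<alpha>) \<tau> = p \<alpha> y + sum (p \<alpha>) (\<sigma> - {x, y})"
        using fin by (simp add: \<tau>_def sum.insert_remove Diff_insert2[symmetric] insert_commute)
      also have "\<dots> = \<alpha> x + \<alpha> y + sum \<alpha> (\<sigma> - {x, y})"
        using xy(1) by (simp add: p_def)
      also have "\<dots> = sum \<alpha> (insert x (insert y (\<sigma> - {x, y})))"
        using fin xy(1) by simp
      also have "insert x (insert y (\<sigma> - {x, y})) = insert y \<sigma>" using True by auto
      finally have "sum (p \<alpha>) \<tau> = 1" using al by (simp add: simplex_pts_def)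
      then have pt: "p \<alpha> \<in> simplex_pts \<tau>" using al xy(1) by (auto simp: simplex_pts_def p_def \<tau>_def)
      then have "p \<alpha> \<in> simplex_pts (insert y \<sigma>)"
        by (rule simplex_pts_mono) (use fin in \<open>auto simp: \<tau>_def\<close>)
      then show ?thesis using pt tY t al by (auto simp: realization_def)
    qed
  qed
  have "continuous_on UNIV (\<lambda>\<alpha>. p \<alpha> z)" for z
    unfolding p_def by (cases "z = x"; cases "z = y") (auto intro!: continuous_intros)
  then have pc: "continuous_on (realization X) p"
    by (intro continuous_on_coordinatewise_then_product) (blast intro: continuous_on_subset)
  have sub: "realization Y \<subseteq> realization X" unfolding xy(3) realization_def delete_def by auto
  show ?thesis
    by (rule m_connected_dominated[OF assms(3) pc _ continuous_on_id]) (use p sub in auto)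
qed

lemma m_connected_strong_steps:
  assumes "strong_step\<^sup>*\<^sup>* X Y" "simplicial X" "m_connected m Y"
  shows "m_connected m X"
  using assms
proof (induction rule: converse_rtranclp_induct)
  case (step X Z)
  have "simplicial Z" using step(1) simplicial_delete[OF step.prems(1)] by (auto simp: strong_step_def)
  then show ?case using m_connected_strong_step[OF step(1) step.prems(1)] step by simp
qed

text \<open>The map \<open>q\<close> below is a continuous substitute for the canonical homeomorphism: it sends \<open>\<alpha>\<close> to
  a point of the chain of the sets \<open>{x. \<alpha> x > c}\<close>.\<close>

lemma m_connected_sd:
  fixes K :: "'v complx" and \<psi> :: "'v set \<Rightarrow> 'b set"
  assumes K: "simplicial K" and \<psi>: "\<And>S T. S \<in> K \<Longrightarrow> T \<in> K \<Longrightarrow> \<psi> S \<subseteq> \<psi> T \<longleftrightarrow> S \<subseteq> T"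
    and m: "m_connected m K"
  shows "m_connected m (sd (\<psi> ` K))"
proof -
  have fin: "finite K" and finS: "\<And>S. S \<in> K \<Longrightarrow> finite S" and neS: "\<And>S. S \<in> K \<Longrightarrow> S \<noteq> {}"
    using simplicialD[OF K] by auto
  have inj: "inj_on \<psi> K"
  proof (rule inj_onI)
    fix S T assume "S \<in> K" "T \<in> K" "\<psi> S = \<psi> T"
    then have "S \<subseteq> T" "T \<subseteq> S" using \<psi>[of S T] \<psi>[of T S] by auto
    then show "S = T" by simp
  qed
  define V where "V = \<Union>K"
  have finV: "finite V" unfolding V_def using fin finS by auto
  \<comment> \<open>The map, affine on each simplex, that sends the vertex \<open>\<psi> S\<close>
    to the barycentre of \<open>S\<close>.\<close>
  define p where "p \<beta> x = (\<Sum>S\<in>K. if x \<in> S then \<beta> (\<psi> S) / card S else 0)" for \<beta> :: "'b set \<Rightarrow> real" and x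
  \<comment> \<open>Positive exactly when the coordinates on \<open>S\<close> are positive and
    exceed all those outside \<open>S\<close>, that is, when \<open>S\<close> is a superlevel set of
    \<alpha>. Products of truncated differences make continuity evident.\<close>
  define w where "w S \<alpha> = (\<Prod>x\<in>S. \<Prod>y\<in>V - S. max 0 (\<alpha> x - \<alpha> y)) * (\<Prod>x\<in>S. max 0 (\<alpha> x))" for S and \<alpha> :: "'v \<Rightarrow> real"
  define W where "W \<alpha> = (\<Sum>S\<in>K. w S \<alpha>)" for \<alpha>
  define q where "q \<alpha> b = (if b \<in> \<psi> ` K then w (inv_into K \<psi> b) \<alpha> / W \<alpha> else 0)" for \<alpha> b
  have w0: "0 \<le> w S \<alpha>" for S \<alpha> unfolding w_def by (intro mult_nonneg_nonneg prod_nonneg) auto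
  have wpos: "w S \<alpha> > 0 \<longleftrightarrow> (\<forall>x\<in>S. \<alpha> x > 0 \<and> (\<forall>y\<in>V - S. \<alpha> x > \<alpha> y))" if "S \<in> K" for S \<alpha>
  proof -
    have mx: "max 0 r = 0 \<longleftrightarrow> \<not> 0 < r" for r :: real by auto
    have "w S \<alpha> > 0 \<longleftrightarrow> w S \<alpha> \<noteq> 0" using w0[of S \<alpha>] by linarith
    also have "\<dots> \<longleftrightarrow> (\<forall>x\<in>S. \<forall>y\<in>V - S. \<alpha> x > \<alpha> y) \<and> (\<forall>x\<in>S. \<alpha> x > 0)"
      unfolding w_def using finS[OF that] finV by (simp add: mx)
    also have "\<dots> \<longleftrightarrow> (\<forall>x\<in>S. \<alpha> x > 0 \<and> (\<forall>y\<in>V - S. \<alpha> x > \<alpha> y))" by metis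
    finally show ?thesis .
  qed
  have Wpos: "W \<alpha> > 0" if a: "\<alpha> \<in> realization K" for \<alpha>
  proof -
    obtain \<sigma> where s: "\<sigma> \<in> K" "\<alpha> \<in> simplex_pts \<sigma>" using a by (auto simp: realization_def)
    \<comment> \<open>The set where \<alpha> is maximal is a superlevel set, so the denominator
      \<open>W\<close> of \<open>q\<close> is positive.\<close>
    define M where "M = Max (\<alpha> ` \<sigma>)"
    define S where "S = {x \<in> \<sigma>. \<alpha> x = M}"
    have fs: "finite (\<alpha> ` \<sigma>)" "\<alpha> ` \<sigma> \<noteq> {}" using finS neS s by auto
    have "M \<in> \<alpha> ` \<sigma>" unfolding M_def using fs by (rule Max_in)
    then have "S \<noteq> {}" by (auto simp: S_def)
    then have SK: "S \<in> K" by (intro simplicialD(4)[OF K s(1)]) (auto simp: S_def)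
    have le: "\<alpha> x \<le> M" if "x \<in> \<sigma>" for x using that fs by (simp add: M_def)
    have "M > 0"
    proof (rule ccontr)
      assume "\<not> M > 0"
      then have "sum \<alpha> \<sigma> \<le> 0" using le by (intro sum_nonpos) force
      then show False using s(2) by (simp add: simplex_pts_def)
    qed
    have "w S \<alpha> > 0" unfolding wpos[OF SK]
    proof (intro ballI conjI)
      fix x y assume "x \<in> S" "y \<in> V - S"
      then show "\<alpha> x > \<alpha> y"
        using le[of y] s(2) \<open>M > 0\<close> by (cases "y \<in> \<sigma>") (auto simp: S_def simplex_pts_def)
    qed (use \<open>M > 0\<close> in \<open>simp add: S_def\<close>)
    then show ?thesis unfolding W_def using SK fin w0 by (intro sum_pos2[of K S]) auto
  qed
  have psum: "p \<beta> \<in> simplex_pts T" if T: "T \<in> K" "\<beta> \<in> simplex_pts c" "c \<subseteq> \<psi> ` {S \<in> K. S \<subseteq> T}" for \<beta> T c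
  proof -
    have b0: "\<beta> (\<psi> S) = 0" if "S \<in> K" "\<not> S \<subseteq> T" for S
    proof -
      have "\<psi> S \<notin> c"
      proof
        assume "\<psi> S \<in> c"
        then obtain S' where "S' \<in> K" "S' \<subseteq> T" "\<psi> S = \<psi> S'" using T(3) by auto
        then show False using inj_onD[OF inj] that by auto
      qed
      then show ?thesis using T(2) by (simp add: simplex_pts_def)
    qed
    have c: "finite (\<psi> ` K)" using fin by simp
    have "sum (p \<beta>) T = (\<Sum>S\<in>K. \<Sum>x\<in>T. if x \<in> S then \<beta> (\<psi> S) / card S else 0)"
      unfolding p_def by (rule sum.swap)
    also have "\<dots> = (\<Sum>S\<in>K. \<beta> (\<psi> S))"
    proof (rule sum.cong[OF refl])
      fix S assume S: "S \<in> K"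
      show "(\<Sum>x\<in>T. if x \<in> S then \<beta> (\<psi> S) / card S else 0) = \<beta> (\<psi> S)"
      proof (cases "S \<subseteq> T")
        case True
        have "(\<Sum>x\<in>T. if x \<in> S then \<beta> (\<psi> S) / card S else 0) = (\<Sum>x\<in>S. \<beta> (\<psi> S) / card S)"
          using True finS[OF T(1)] by (simp add: sum.If_cases Int_absorb1)
        then show ?thesis using finS[OF S] neS[OF S] by simp
      next
        case False
        then show ?thesis using b0[OF S] by (intro trans[OF sum.neutral]) auto
      qed
    qed
    also have "\<dots> = sum \<beta> (\<psi> ` K)" by (simp add: sum.reindex[OF inj])
    also have "\<dots> = sum \<beta> c"
      by (rule sum.mono_neutral_right[OF c]) (use T in \<open>auto simp: simplex_pts_def\<close>)
    also have "\<dots> = 1" using T(2) by (simp add: simplex_pts_def)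
    finally have 1: "sum (p \<beta>) T = 1" .
    have "p \<beta> x = 0" if "x \<notin> T" for x
      unfolding p_def using b0 that by (intro sum.neutral) auto
    moreover have "0 \<le> p \<beta> x" for x
      unfolding p_def using T(2) by (intro sum_nonneg) (auto simp: simplex_pts_def)
    ultimately show ?thesis using 1 by (simp add: simplex_pts_def)
  qed
  have chain: "\<exists>T\<in>C. \<forall>S\<in>C. S \<subseteq> T" if "finite C" "C \<noteq> {}" "\<forall>S\<in>C. \<forall>T\<in>C. S \<subseteq> T \<or> T \<subseteq> S" for C :: "'v set set"
    using that
  proof (induction rule: finite_ne_induct)
    case (insert S C)
    then obtain T where T: "T \<in> C" "\<forall>S\<in>C. S \<subseteq> T" by auto
    have "S \<subseteq> T \<or> T \<subseteq> S" using insert.prems T(1) by auto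
    then show ?case
    proof
      assume "T \<subseteq> S" then show ?thesis using T by (intro bexI[of _ S]) auto
    qed (use T in auto)
  qed simp
  have chainK: "\<exists>C. c = \<psi> ` C \<and> C \<subseteq> K \<and> finite C \<and> C \<noteq> {} \<and> (\<forall>S\<in>C. \<forall>T\<in>C. S \<subseteq> T \<or> T \<subseteq> S)"
    if "c \<in> sd (\<psi> ` K)" for c
  proof -
    obtain C where C: "C \<subseteq> K" "c = \<psi> ` C" using \<open>c \<in> _\<close> unfolding sd_def by (auto simp: subset_image_iff)
    have "S \<subseteq> T \<or> T \<subseteq> S" if "S \<in> C" "T \<in> C" for S T
    proof -
      have "\<psi> S \<in> c" "\<psi> T \<in> c" "S \<in> K" "T \<in> K" using C that by auto
      then show ?thesis using \<open>c \<in> sd (\<psi> ` K)\<close> \<psi>[of S T] \<psi>[of T S] unfolding sd_def by blast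
    qed
    moreover have "finite C" using C(1) fin by (rule finite_subset)
    moreover have "C \<noteq> {}" using \<open>c \<in> sd (\<psi> ` K)\<close> C by (auto simp: sd_def)
    ultimately show ?thesis using C by (intro exI[of _ C]) auto
  qed
  have qsup: "q \<alpha> \<in> simplex_pts (\<psi> ` {S \<in> K. w S \<alpha> > 0})" if "\<alpha> \<in> realization K" for \<alpha>
  proof -
    have 0: "w S \<alpha> = 0 \<longleftrightarrow> \<not> w S \<alpha> > 0" for S using w0[of S \<alpha>] by linarith
    have "sum (q \<alpha>) (\<psi> ` {S \<in> K. w S \<alpha> > 0}) = (\<Sum>S\<in>{S \<in> K. w S \<alpha> > 0}. w S \<alpha> / W \<alpha>)"
      by (subst sum.reindex) (auto intro: inj_on_subset[OF inj] sum.cong simp: q_def inv_into_f_f[OF inj])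
    also have "\<dots> = (\<Sum>S\<in>K. w S \<alpha> / W \<alpha>)"
      by (rule sum.mono_neutral_left) (use fin 0 in auto)
    also have "\<dots> = 1" using Wpos[OF that] by (simp add: W_def flip: sum_divide_distrib)
    finally have "sum (q \<alpha>) (\<psi> ` {S \<in> K. w S \<alpha> > 0}) = 1" .
    moreover have "q \<alpha> b \<ge> 0" for b using w0 Wpos[OF that] by (simp add: q_def)
    moreover have "q \<alpha> b = 0" if "b \<notin> \<psi> ` {S \<in> K. w S \<alpha> > 0}" for b
      using that 0 by (auto simp: q_def inv_into_f_f[OF inj])
    ultimately show ?thesis by (simp add: simplex_pts_def)
  qed
  \<comment> \<open>Strict separation is asked of \<open>S\<close> only. The members of the chain
    carrying \<beta> separate the coordinates of \<open>p \<beta>\<close> only weakly, since some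
    coefficients of \<beta> may vanish.\<close>
  have wcomp: "S \<subseteq> T \<or> T \<subseteq> S" if "S \<in> K" "T \<in> K" "w S \<alpha> > 0" "\<And>x y. x \<in> T \<Longrightarrow> y \<in> V - T \<Longrightarrow> \<alpha> x \<ge> \<alpha> y" for S T \<alpha>
  proof (rule ccontr)
    assume "\<not> (S \<subseteq> T \<or> T \<subseteq> S)"
    then obtain x y where xy: "x \<in> S" "x \<notin> T" "y \<in> T" "y \<notin> S" by auto
    then have "x \<in> V" "y \<in> V" using that by (auto simp: V_def)
    then have "\<alpha> x > \<alpha> y" "\<alpha> y \<ge> \<alpha> x" using xy that(3,4) unfolding wpos[OF that(1)] by auto
    then show False by simp
  qed
  have qsd: "\<psi> ` {S \<in> K. w S \<alpha> > 0} \<in> sd (\<psi> ` K)" if "\<alpha> \<in> realization K" for \<alpha>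
  proof -
    have "{S \<in> K. w S \<alpha> > 0} \<noteq> {}"
    proof
      assume "{S \<in> K. w S \<alpha> > 0} = {}"
      then show False using qsup[OF that] unfolding simplex_pts_def by (simp only: image_empty) simp
    qed
    moreover have "\<psi> S \<subseteq> \<psi> T \<or> \<psi> T \<subseteq> \<psi> S" if "S \<in> K" "T \<in> K" "w S \<alpha> > 0" "w T \<alpha> > 0" for S T
    proof -
      have "S \<subseteq> T \<or> T \<subseteq> S"
        by (rule wcomp[OF that(1-3)]) (use wpos[OF that(2)] that(4) in \<open>auto simp: less_imp_le\<close>)
      then show ?thesis using \<psi>[OF that(1,2)] \<psi>[OF that(2,1)] by simp
    qed
    ultimately show ?thesis unfolding sd_def using fin by auto
  qed
  show ?thesis
  proof (rule m_connected_dominated[OF m, where p=p and q=q])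
    show "continuous_on (realization (sd (\<psi> ` K))) p"
    proof (rule continuous_on_coordinatewise_then_product)
      fix x
      have "continuous_on UNIV (\<lambda>\<beta>. if x \<in> S then \<beta> (\<psi> S) / real (card S) else 0)" for S
        by (cases "x \<in> S") (auto intro!: continuous_intros simp: divide_inverse)
      then have "continuous_on UNIV (\<lambda>\<beta>. p \<beta> x)" unfolding p_def by (intro continuous_on_sum)
      then show "continuous_on (realization (sd (\<psi> ` K))) (\<lambda>\<beta>. p \<beta> x)" by (rule continuous_on_subset) auto
    qed
    show "p ` realization (sd (\<psi> ` K)) \<subseteq> realization K"
    proof clarify
      fix \<beta> assume "\<beta> \<in> realization (sd (\<psi> ` K))"
      then obtain c where c: "c \<in> sd (\<psi> ` K)" "\<beta> \<in> simplex_pts c" by (auto simp: realization_def)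
      obtain C where C: "c = \<psi> ` C" "C \<subseteq> K" "finite C" "C \<noteq> {}" "\<forall>S\<in>C. \<forall>T\<in>C. S \<subseteq> T \<or> T \<subseteq> S"
        using chainK[OF c(1)] by (elim exE conjE) (rule that)
      obtain T where T: "T \<in> C" "\<forall>S\<in>C. S \<subseteq> T" using chain[OF C(3-5)] by auto
      have "p \<beta> \<in> simplex_pts T" by (rule psum[OF _ c(2)]) (use T C in auto)
      then show "p \<beta> \<in> realization K" using T C by (auto simp: realization_def)
    qed
    have wc: "continuous_on UNIV (w S)" for S
      unfolding w_def by (intro continuous_intros continuous_on_subset[OF continuous_on_product_coordinates]) auto
    show "continuous_on (realization K) q"
    proof (rule continuous_on_coordinatewise_then_product)
      fix b
      have Wc: "continuous_on UNIV W" unfolding W_def using wc by (intro continuous_on_sum)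
      have "continuous_on (realization K) (\<lambda>\<alpha>. w (inv_into K \<psi> b) \<alpha> / W \<alpha>)"
        using Wpos by (intro continuous_on_divide continuous_on_subset[OF wc] continuous_on_subset[OF Wc]) force+
      then show "continuous_on (realization K) (\<lambda>\<alpha>. q \<alpha> b)"
        unfolding q_def by (cases "b \<in> \<psi> ` K") auto
    qed
    show "q ` realization K \<subseteq> realization (sd (\<psi> ` K))"
      using qsup qsd unfolding realization_def[of "sd _"] by blast
    fix \<beta> assume "\<beta> \<in> realization (sd (\<psi> ` K))"
    then obtain c where c: "c \<in> sd (\<psi> ` K)" "\<beta> \<in> simplex_pts c" by (auto simp: realization_def)
    obtain C where C: "c = \<psi> ` C" "C \<subseteq> K" "finite C" "C \<noteq> {}" "\<forall>S\<in>C. \<forall>T\<in>C. S \<subseteq> T \<or> T \<subseteq> S"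
      using chainK[OF c(1)] by (elim exE conjE) (rule that)
    obtain T where T: "T \<in> C" "\<forall>S\<in>C. S \<subseteq> T" using chain[OF C(3-5)] by auto
    have "p \<beta> \<in> simplex_pts T" by (rule psum[OF _ c(2)]) (use T C in auto)
    then have pK: "p \<beta> \<in> realization K" using T C by (auto simp: realization_def)
    define D where "D = {S \<in> K. w S (p \<beta>) > 0}"
    have b0: "\<beta> (\<psi> S) = 0" if "S \<in> K" "S \<notin> C" for S
    proof -
      have "\<psi> S \<notin> c"
        unfolding C(1) inj_on_image_mem_iff[OF inj that(1) C(2)] by (rule that(2))
      then show ?thesis using c(2) by (simp add: simplex_pts_def)
    qed
    \<comment> \<open>A member of the chain that contains \<open>y\<close> is not inside
      \<open>T\<close>, hence contains \<open>T\<close> and with it \<open>x\<close>; so every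
      nonzero summand of \<open>p \<beta> y\<close> also occurs in
      \<open>p \<beta> x\<close>.\<close>
    have mono: "p \<beta> x \<ge> p \<beta> y" if "T \<in> C" "x \<in> T" "y \<notin> T" for x y T
      unfolding p_def
    proof (rule sum_mono)
      fix S assume S: "S \<in> K"
      have "\<beta> (\<psi> S) \<ge> 0" using c(2) by (simp add: simplex_pts_def)
      moreover have "x \<in> S" if "S \<in> C" "y \<in> S"
      proof -
        have "S \<subseteq> T \<or> T \<subseteq> S" using C(5) that(1) \<open>T \<in> C\<close> by simp
        then show ?thesis using \<open>y \<in> S\<close> \<open>y \<notin> T\<close> \<open>x \<in> T\<close> by auto
      qed
      ultimately show "(if y \<in> S then \<beta> (\<psi> S) / real (card S) else 0) \<le> (if x \<in> S then \<beta> (\<psi> S) / real (card S) else 0)"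
        using b0[OF S] by (cases "S \<in> C") auto
    qed
    have DC: "S \<subseteq> T \<or> T \<subseteq> S" if "S \<in> C \<union> D" "T \<in> C \<union> D" for S T
    proof -
      have *: "S \<subseteq> T \<or> T \<subseteq> S" if "S \<in> D" "T \<in> C \<union> D" for S T
        using that
      proof (intro wcomp[of S T "p \<beta>"])
        fix x y assume "x \<in> T" "y \<in> V - T"
        then show "p \<beta> x \<ge> p \<beta> y"
          using mono[of T x y] that(2) wpos[of T "p \<beta>"] by (auto simp: D_def less_imp_le)
      qed (use C in \<open>auto simp: D_def\<close>)
      show ?thesis using *[of S T] *[of T S] C(5) that by auto
    qed
    have u: "\<psi> ` (C \<union> D) \<in> sd (\<psi> ` K)"
    proof -
      have sub: "C \<union> D \<subseteq> K" using C by (auto simp: D_def)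
      have "\<psi> S \<subseteq> \<psi> T \<or> \<psi> T \<subseteq> \<psi> S" if "S \<in> C \<union> D" "T \<in> C \<union> D" for S T
      proof -
        have "S \<in> K" "T \<in> K" using sub that by auto
        then show ?thesis using DC[OF that] \<psi>[of S T] \<psi>[of T S] by simp
      qed
      then show ?thesis unfolding sd_def using sub fin C by (auto simp: finite_subset)
    qed
    moreover have "\<beta> \<in> simplex_pts (\<psi> ` (C \<union> D))"
      by (rule simplex_pts_mono[OF c(2)]) (use C fin in \<open>auto simp: D_def\<close>)
    moreover have "q (p \<beta>) \<in> simplex_pts (\<psi> ` (C \<union> D))"
      by (rule simplex_pts_mono[OF qsup[OF pK]]) (use C fin in \<open>auto simp: D_def\<close>)
    ultimately show "\<exists>\<sigma>\<in>sd (\<psi> ` K). \<beta> \<in> simplex_pts \<sigma> \<and> q (p \<beta>) \<in> simplex_pts \<sigma>"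
      by (intro bexI[of _ "\<psi> ` (C \<union> D)"] conjI)
  qed
qed

section \<open>Extension of maps and joins\<close>

text \<open>A cell of least rank outside \<open>B\<close> has its boundary already covered. It meets
  the covered part only in this boundary: otherwise it would be a face of a cell of
  \<open>B\<close>, and \<open>B\<close> is closed under such faces. So the extension over the cell
  and the old map agree on the overlap of two closed sets.\<close>

lemma cell_extension:
  fixes cell bd :: "'c \<Rightarrow> 'a::topological_space set" and rank :: "'c \<Rightarrow> nat" and X :: "'b::topological_space set"
  assumes fin: "finite E" and clo: "\<And>e. e \<in> E \<Longrightarrow> closed (cell e)"
    and bd: "\<And>e x. e \<in> E \<Longrightarrow> x \<in> bd e \<Longrightarrow> \<exists>e'\<in>E. x \<in> cell e' \<and> rank e' < rank e"
    and inter: "\<And>e e'. e \<in> E \<Longrightarrow> e' \<in> E \<Longrightarrow> e \<noteq> e' \<Longrightarrow>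
        cell e \<inter> cell e' \<subseteq> bd e \<or> rank e < rank e' \<and> cell e \<subseteq> cell e'"
    and ext: "\<And>e h. e \<in> E \<Longrightarrow> continuous_on (bd e) h \<Longrightarrow> h ` bd e \<subseteq> X \<Longrightarrow>
        \<exists>h'. continuous_on (cell e) h' \<and> h' ` cell e \<subseteq> X \<and> (\<forall>x\<in>bd e. h' x = h x)"
    and "B \<subseteq> E" and "\<And>e e'. e \<in> E \<Longrightarrow> e' \<in> B \<Longrightarrow> rank e < rank e' \<Longrightarrow> cell e \<subseteq> cell e' \<Longrightarrow> e \<in> B"
    and "continuous_on (\<Union>(cell ` B)) h" "h ` \<Union>(cell ` B) \<subseteq> X"
  shows "\<exists>h'. continuous_on (\<Union>(cell ` E)) h' \<and> h' ` \<Union>(cell ` E) \<subseteq> X \<and> (\<forall>x\<in>\<Union>(cell ` B). h' x = h x)"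
  using assms(6-9)
proof (induction "card (E - B)" arbitrary: B h)
  case 0
  then have "E = B" using fin by auto
  then show ?case using 0 by (intro exI[of _ h]) simp
next
  case (Suc n)
  have "E - B \<noteq> {}" using Suc(2) by (metis card.empty Zero_not_Suc)
  then have "\<exists>e. e \<in> E - B" by auto
  then obtain e where e: "e \<in> E" "e \<notin> B" and emin: "\<And>e'. e' \<in> E \<Longrightarrow> e' \<notin> B \<Longrightarrow> rank e \<le> rank e'"
    using ex_has_least_nat[of "\<lambda>e. e \<in> E - B" _ rank] by (metis DiffE DiffI)
  define Y where "Y = \<Union>(cell ` B)"
  have "closed Y" unfolding Y_def
    by (rule closed_UN) (use Suc.prems(1) fin clo in \<open>auto intro: finite_subset\<close>)
  have bdY: "bd e \<subseteq> Y"
  proof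
    fix x assume "x \<in> bd e"
    then obtain e' where "e' \<in> E" "x \<in> cell e'" "rank e' < rank e" using bd[OF e(1)] by auto
    then show "x \<in> Y" using emin[of e'] unfolding Y_def by fastforce
  qed
  have capY: "cell e \<inter> Y \<subseteq> bd e"
  proof
    fix x assume x: "x \<in> cell e \<inter> Y"
    then obtain e' where e': "e' \<in> B" "x \<in> cell e'" by (auto simp: Y_def)
    have "\<not> (rank e < rank e' \<and> cell e \<subseteq> cell e')" using Suc.prems(2)[OF e(1) e'(1)] e(2) by auto
    then have "cell e \<inter> cell e' \<subseteq> bd e" using inter[OF e(1), of e'] e' Suc.prems(1) e(2) by auto
    then show "x \<in> bd e" using x e' by auto
  qed
  have "continuous_on (bd e) h" "h ` bd e \<subseteq> X"
    using bdY Suc.prems(3,4) unfolding Y_def by (blast intro: continuous_on_subset)+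
  from ext[OF e(1) this] obtain h1
    where h1: "continuous_on (cell e) h1" "h1 ` cell e \<subseteq> X" "\<And>x. x \<in> bd e \<Longrightarrow> h1 x = h x" by auto
  define h2 where "h2 x = (if x \<in> Y then h x else h1 x)" for x
  have 2: "h2 x = h1 x" if "x \<in> cell e" for x
    using that capY h1(3) by (auto simp: h2_def)
  have "continuous_on Y h2 = continuous_on Y h" by (rule continuous_on_cong) (auto simp: h2_def)
  then have "continuous_on Y h2" using Suc.prems(3) by (simp add: Y_def)
  moreover have "continuous_on (cell e) h2 = continuous_on (cell e) h1" by (rule continuous_on_cong) (use 2 in auto)
  then have "continuous_on (cell e) h2" using h1(1) by simp
  ultimately have c: "continuous_on (Y \<union> cell e) h2"
    by (intro continuous_on_closed_Un \<open>closed Y\<close> clo e)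
  have un: "\<Union>(cell ` insert e B) = Y \<union> cell e" by (auto simp: Y_def)
  have "\<exists>h'. continuous_on (\<Union>(cell ` E)) h' \<and> h' ` \<Union>(cell ` E) \<subseteq> X \<and> (\<forall>x\<in>\<Union>(cell ` insert e B). h' x = h2 x)"
  proof (rule Suc.hyps(1))
    have "E - insert e B = (E - B) - {e}" by auto
    then show "n = card (E - insert e B)" using Suc(2) e fin by simp
    show "insert e B \<subseteq> E" using e Suc.prems by auto
    show "e0 \<in> insert e B" if e0: "e0 \<in> E" "e' \<in> insert e B" "rank e0 < rank e'" "cell e0 \<subseteq> cell e'" for e0 e'
    proof (cases "e' = e")
      case True
      then show ?thesis using emin[OF e0(1)] e0(3) by fastforce
    next
      case False
      then show ?thesis using Suc.prems(2)[OF e0(1) _ e0(3,4)] e0(2) by simp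
    qed
    show "continuous_on (\<Union>(cell ` insert e B)) h2" unfolding un by (rule c)
    show "h2 ` \<Union>(cell ` insert e B) \<subseteq> X"
    proof
      fix v assume "v \<in> h2 ` \<Union>(cell ` insert e B)"
      then obtain x where x: "x \<in> Y \<or> x \<in> cell e" "v = h2 x" unfolding un by auto
      show "v \<in> X"
      proof (cases "x \<in> Y")
        case True
        then show ?thesis using x Suc.prems(4) by (auto simp: h2_def Y_def)
      next
        case False
        then show ?thesis using x h1(2) by (auto simp: h2_def)
      qed
    qed
  qed
  then obtain h' where h': "continuous_on (\<Union>(cell ` E)) h'" "h' ` \<Union>(cell ` E) \<subseteq> X"
    "\<forall>x\<in>Y \<union> cell e. h' x = h2 x" unfolding un by auto
  have "\<forall>x\<in>Y. h' x = h x" using h'(3) by (simp add: h2_def)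
  then show ?case using h'(1,2) unfolding Y_def by (intro exI[of _ h']) auto
qed

section \<open>Cubical grids and the extension of maps over one cell\<close>

lemma continuous_on_Max_lessThan:
  fixes f :: "nat \<Rightarrow> 'a::topological_space \<Rightarrow> real"
  assumes "\<And>i. continuous_on S (f i)" "0 < (n::nat)"
  shows "continuous_on S (\<lambda>y. Max ((\<lambda>i. f i y) ` {..<n}))"
  using assms(2)
proof (induction n)
  case (Suc n)
  show ?case
  proof (cases "n = 0")
    case True
    have "{..<Suc 0} = {0}" by auto
    then show ?thesis using assms(1) True by simp
  next
    case False
    then have "Max ((\<lambda>i. f i y) ` {..<Suc n}) = max (f n y) (Max ((\<lambda>i. f i y) ` {..<n}))" for y
      unfolding lessThan_Suc image_insert by (intro Max_insert) auto
    then show ?thesis using Suc False assms(1) by (simp add: continuous_on_max)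
  qed
qed simp

lemma compact_coordinatewise:
  fixes C :: "'i \<Rightarrow> 'b::topological_space set"
  assumes "\<And>i. compact (C i)"
  shows "compact {x. \<forall>i. x i \<in> C i}"
proof -
  have "{x. \<forall>i. x i \<in> C i} = PiE UNIV C" by (auto simp: PiE_def)
  moreover have "compactin (product_topology (\<lambda>_. euclidean) UNIV) (PiE UNIV C)"
    unfolding compactin_PiE using assms by simp
  ultimately show ?thesis unfolding euclidean_product_topology by simp
qed

lemma closed_coordinate_eq: "closed {x::'i \<Rightarrow> real. x k = c}"
  by (intro closed_Collect_eq continuous_on_const continuous_on_product_coordinates)

lemma compact_sph: "compact (sph n)"
proof -
  have c: "compact {x::nat \<Rightarrow> real. \<forall>i. x i \<in> {-1..1}}" by (rule compact_coordinatewise) simp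
  have cl: "closed (sph n)"
  proof -
    have "sph n = (\<Inter>k\<in>{n..}. {x. x k = 0}) \<inter> {x. (\<Sum>k<n. (x k)\<^sup>2) = 1}" by (auto simp: sph_def)
    moreover have "closed {x::nat \<Rightarrow> real. (\<Sum>k<n. (x k)\<^sup>2) = 1}"
      by (intro closed_Collect_eq continuous_intros continuous_on_product_coordinates)
    moreover have "closed (\<Inter>k\<in>{n..}. {x::nat \<Rightarrow> real. x k = 0})"
      by (intro closed_INT ballI closed_coordinate_eq)
    ultimately show ?thesis by (simp add: closed_Int)
  qed
  have sub: "sph n \<subseteq> {x. \<forall>i. x i \<in> {-1..1}}"
  proof (clarify, unfold atLeastAtMost_iff)
    fix x :: "nat \<Rightarrow> real" and i assume x: "x \<in> sph n"
    have "(x i)\<^sup>2 \<le> 1"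
    proof (cases "i < n")
      case True
      then have "(x i)\<^sup>2 \<le> (\<Sum>k<n. (x k)\<^sup>2)" by (intro member_le_sum) auto
      then show ?thesis using x by (simp add: sph_def)
    qed (use x in \<open>simp add: sph_def\<close>)
    then have "\<bar>x i\<bar> \<le> 1" by (simp add: abs_square_le_1)
    then show "-1 \<le> x i \<and> x i \<le> 1" by linarith
  qed
  show ?thesis using closed_Int_compact[OF cl c] sub by (simp only: inf.absorb1)
qed

text \<open>The cube of side 1 / N with lowest corner a / N, extended in the directions
  \<open>J\<close>; the other coordinates are constant. Multiplying by \<open>N\<close> keeps the
  corners integral, so cells can be compared by integer arithmetic.\<close>

definition grid_cell :: "nat \<Rightarrow> (nat \<Rightarrow> int) \<times> nat set \<Rightarrow> (nat \<Rightarrow> real) set" where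
  "grid_cell N = (\<lambda>(a, J). {x. \<forall>k. if k \<in> J then a k \<le> N * x k \<and> N * x k \<le> a k + 1 else N * x k = a k})"

definition grid_bd :: "nat \<Rightarrow> (nat \<Rightarrow> int) \<times> nat set \<Rightarrow> (nat \<Rightarrow> real) set" where
  "grid_bd N = (\<lambda>(a, J). {x \<in> grid_cell N (a, J). \<exists>k\<in>J. N * x k = a k \<or> N * x k = a k + 1})"

lemma closed_grid_cell: "closed (grid_cell N e)"
proof -
  obtain a J where e: "e = (a, J)" by (cases e)
  have c: "continuous_on UNIV (\<lambda>x::nat \<Rightarrow> real. N * x k)" for k
    by (intro continuous_intros continuous_on_product_coordinates)
  define C where "C k = (if k \<in> J then {x::nat \<Rightarrow> real. a k \<le> N * x k} \<inter> {x::nat \<Rightarrow> real. N * x k \<le> a k + 1} else {x::nat \<Rightarrow> real. N * x k = a k})" for k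
  have "grid_cell N e = (\<Inter>k. C k)"
    unfolding grid_cell_def e C_def by (auto split: if_splits)
  moreover have "closed (C k)" for k
    using c[of k] unfolding C_def by (auto intro!: closed_Int closed_Collect_le closed_Collect_eq continuous_on_const)
  ultimately show ?thesis by auto
qed

text \<open>By polar coordinates around its centre, a cell of dimension j > 0 is a quotient of [0,1]
  times the sphere of dimension j - 1 \<le> m. A null-homotopy of the map on the boundary sphere
  therefore descends to the cell. A cell of dimension 0 has empty \<open>grid_bd\<close>, and any
  constant will do.\<close>

lemma grid_cell_ext:
  fixes h :: "(nat \<Rightarrow> real) \<Rightarrow> 'v \<Rightarrow> real"
  assumes K: "m_connected m K" and N: "N > 0" and J: "finite J" "card J \<le> Suc m"
    and h: "continuous_on (grid_bd N (a, J)) h" "h ` grid_bd N (a, J) \<subseteq> realization K"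
  shows "\<exists>h'. continuous_on (grid_cell N (a, J)) h' \<and> h' ` grid_cell N (a, J) \<subseteq> realization K \<and>
           (\<forall>x\<in>grid_bd N (a, J). h' x = h x)"
proof (cases "J = {}")
  case True
  obtain b where "b \<in> realization K" using K unfolding m_connected_iff by auto
  then show ?thesis using True by (intro exI[of _ "\<lambda>_. b"]) (auto simp: grid_bd_def)
next
  case False
  define j where "j = card J"
  have j0: "j > 0" using False J by (simp add: j_def card_gt_0_iff)
  then obtain i where i: "j = Suc i" by (cases j) auto
  have im: "i \<le> m" using J i by (simp add: j_def)
  obtain e where e: "bij_betw e {..<j} J"
    using ex_bij_betw_nat_finite[OF J(1)] by (auto simp: j_def atLeast0LessThan)
  define e' where "e' = inv_into {..<j} e"
  have e'J: "e' k < j" "e (e' k) = k" if "k \<in> J" for k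
    using that e bij_betw_inv_into[OF e] unfolding e'_def
    by (auto simp: bij_betw_def bij_betw_inv_into_right f_inv_into_f inv_into_into dest: inv_into_into)
  have eJ: "e l \<in> J" "e' (e l) = l" if "l < j" for l
    using that e unfolding e'_def by (auto simp: bij_betw_def)
  define S where "S = sph j"
  \<comment> \<open>The sup norm of the first \<open>j\<close> coordinates; dividing by it projects
    the round sphere radially to the boundary of a cube.\<close>
  define mx where "mx y = Max ((\<lambda>i. \<bar>y i\<bar>) ` {..<j})" for y :: "nat \<Rightarrow> real"
  have mx_ge: "\<bar>y l\<bar> \<le> mx y" if "l < j" for y l unfolding mx_def using that by (intro Max_ge) auto
  have mx_ex: "\<exists>l<j. \<bar>y l\<bar> = mx y" for y
  proof -
    have "mx y \<in> (\<lambda>i. \<bar>y i\<bar>) ` {..<j}" unfolding mx_def using j0 by (intro Max_in) auto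
    then show ?thesis by auto
  qed
  have mx_eq: "mx y = c" if "\<And>l. l < j \<Longrightarrow> \<bar>y l\<bar> \<le> c" "\<exists>l<j. \<bar>y l\<bar> = c" for y c
    using that mx_ge[of _ y] mx_ex[of y] by (metis order_antisym)
  have mx_scale: "mx (\<lambda>l. c * y l) = c * mx y" if "c \<ge> 0" for c y
    using mx_ge[of _ y] mx_ex[of y] that by (intro mx_eq) (auto simp: abs_mult mult_left_mono)
  have mx_cong: "mx y = mx z" if "\<And>l. l < j \<Longrightarrow> y l = z l" for y z
    unfolding mx_def by (rule arg_cong[of _ _ Max]) (use that in auto)
  have mx_pos: "mx y > 0" if "\<exists>l<j. y l \<noteq> 0" for y using that mx_ge[of _ y] by fastforce
  have Snz: "\<exists>l<j. y l \<noteq> 0" if "y \<in> S" for y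
  proof (rule ccontr)
    assume "\<not> ?thesis"
    then have "(\<Sum>l<j. (y l)\<^sup>2) = 0" by simp
    then show False using that by (simp add: S_def sph_def)
  qed
  \<comment> \<open>At t = 0 this is a point of the boundary of the cell, at t = 1 the
    centre.\<close>
  define q where "q = (\<lambda>(t::real, y) k. if k \<in> J then (a k + 1/2 + (1 - t) * (y (e' k) / mx y) / 2) / N else a k / N)"
  have mxc: "continuous_on S mx"
    unfolding mx_def by (rule continuous_on_Max_lessThan[OF _ j0])
      (intro continuous_intros continuous_on_subset[OF continuous_on_product_coordinates] subset_UNIV)
  have qc: "continuous_on ({0..1} \<times> S) q"
  proof (rule continuous_on_coordinatewise_then_product)
    fix k
    have 1: "continuous_on ({0..1::real} \<times> S) (\<lambda>p. mx (snd p))"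
      by (rule continuous_on_compose2[OF mxc]) (auto intro: continuous_intros)
    have 2: "continuous_on ({0..1::real} \<times> S) (\<lambda>p. snd p (e' k))"
      by (rule continuous_on_compose2[OF continuous_on_product_coordinates]) (auto intro: continuous_intros)
    have "mx (snd p) \<noteq> 0" if "p \<in> {0..1::real} \<times> S" for p
    proof -
      have "snd p \<in> S" using that by auto
      then show ?thesis using mx_pos[OF Snz] by force
    qed
    then have "continuous_on ({0..1} \<times> S) (\<lambda>p. (a k + 1/2 + (1 - fst p) * (snd p (e' k) / mx (snd p)) / 2) / N)"
      using N by (intro continuous_intros 1 2) auto
    then show "continuous_on ({0..1} \<times> S) (\<lambda>p. q p k)"
      unfolding q_def case_prod_beta by (cases "k \<in> J") (auto simp: continuous_on_const)
  qed
  have qin: "N * q (t, y) k = (if k \<in> J then a k + 1/2 + (1 - t) * (y (e' k) / mx y) / 2 else a k)" for t y k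
    using N by (simp add: q_def)
  have u1: "\<bar>y l / mx y\<bar> \<le> 1" if "y \<in> S" "l < j" for y l
    using mx_ge[OF that(2), of y] mx_pos[OF Snz[OF that(1)]] by (simp add: abs_divide)
  have qcell: "q (t, y) \<in> grid_cell N (a, J)" if t: "0 \<le> t" "t \<le> 1" and y: "y \<in> S" for t y
  proof -
    have lin: "c \<le> c + 1/2 + r/2 \<and> c + 1/2 + r/2 \<le> c + 1" if "\<bar>r\<bar> \<le> 1" for r c :: real
      using that by linarith
    have b: "\<bar>(1 - t) * (y (e' k) / mx y)\<bar> \<le> 1" if "k \<in> J" for k
      unfolding abs_mult using t u1[OF y e'J(1)[OF that]] by (intro mult_le_one) auto
    have "a k \<le> N * q (t, y) k \<and> N * q (t, y) k \<le> a k + 1" if "k \<in> J" for k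
      unfolding qin using lin[OF b[OF that]] that by simp
    then show ?thesis unfolding grid_cell_def by (simp add: qin)
  qed
  have qbd: "q (0, y) \<in> grid_bd N (a, J)" if y: "y \<in> S" for y
  proof -
    obtain l where l: "l < j" "\<bar>y l\<bar> = mx y" using mx_ex by blast
    have "y l / mx y = 1 \<or> y l / mx y = -1" using l mx_pos[OF Snz[OF y]] by (auto simp: field_simps)
    then have "N * q (0, y) (e l) = a (e l) \<or> N * q (0, y) (e l) = a (e l) + 1"
      using eJ[OF l(1)] by (auto simp: qin)
    then show ?thesis unfolding grid_bd_def using qcell[of 0 y] y eJ[OF l(1)] by auto
  qed
  have surj: "\<exists>t y. 0 \<le> t \<and> t \<le> 1 \<and> y \<in> S \<and> x = q (t, y) \<and> (x \<in> grid_bd N (a, J) \<longrightarrow> t = 0)"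
    if x: "x \<in> grid_cell N (a, J)" for x
  proof -
    \<comment> \<open>Coordinates rescaled to [-1,1] with the centre at 0; their sup norm
      \<open>r\<close> gives the parameter t = 1 - r.\<close>
    define d where "d l = (if l < j then 2 * (N * x (e l) - a (e l)) - 1 else 0)" for l
    define r where "r = mx d"
    have d1: "\<bar>d l\<bar> \<le> 1" for l
    proof (cases "l < j")
      case True
      then have "a (e l) \<le> N * x (e l) \<and> N * x (e l) \<le> a (e l) + 1"
        using x eJ(1)[OF True] unfolding grid_cell_def by (auto split: if_splits)
      then show ?thesis using True by (simp add: d_def abs_le_iff)
    qed (simp add: d_def)
    have r1: "r \<le> 1" "r \<ge> 0" using mx_ex[of d] d1 unfolding r_def by (metis, metis abs_ge_zero)
    have rb: "r = 1" if b: "x \<in> grid_bd N (a, J)"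
    proof -
      obtain k where k: "k \<in> J" "N * x k = a k \<or> N * x k = a k + 1" using b by (auto simp: grid_bd_def)
      then have "\<bar>d (e' k)\<bar> = 1" using e'J[OF k(1)] by (auto simp: d_def)
      then show ?thesis using mx_ge[OF e'J(1)[OF k(1)], of d] r1 by (simp add: r_def)
    qed
    define s where "s = sqrt (\<Sum>l<j. (d l)\<^sup>2)"
    \<comment> \<open>At the centre all directions have the same image, so an arbitrary point of the
      sphere is taken.\<close>
    define y where "y = (if r = 0 then (\<lambda>l. if l = 0 then 1 else 0) else (\<lambda>l. (1/s) * d l))"
    have s: "s > 0" if "r \<noteq> 0"
    proof -
      obtain l where l: "l < j" "\<bar>d l\<bar> = r" using mx_ex[of d] by (auto simp: r_def)
      have "0 < (\<Sum>l<j. (d l)\<^sup>2)"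
        by (rule sum_pos2[of _ l]) (use l that in auto)
      then show ?thesis by (simp add: s_def)
    qed
    have yS: "y \<in> S"
    proof (cases "r = 0")
      case True
      have "(\<Sum>k<j. (if k = 0 then 1 else 0 :: real)\<^sup>2) = (\<Sum>k<j. if k = 0 then 1 else 0)" by (intro sum.cong) auto
      then show ?thesis using True j0 by (auto simp: S_def sph_def y_def)
    next
      case False
      have "(\<Sum>k<j. ((1/s) * d k)\<^sup>2) = (1/s)\<^sup>2 * (\<Sum>k<j. (d k)\<^sup>2)"
        by (simp add: power_mult_distrib sum_distrib_left power_divide)
      also have "\<dots> = (1/s)\<^sup>2 * s\<^sup>2" unfolding s_def by (subst real_sqrt_pow2) (auto intro: sum_nonneg)
      also have "\<dots> = 1" using s[OF False] by (simp add: power_divide)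
      finally show ?thesis using False by (auto simp: S_def sph_def y_def d_def)
    qed
    have key: "(1 - (1 - r)) * (y l / mx y) = d l" if "l < j" for l
    proof (cases "r = 0")
      case True
      then have "d l = 0" using mx_ge[OF that, of d] by (simp add: r_def)
      then show ?thesis using True by simp
    next
      case False
      have "mx y = (1/s) * r" unfolding y_def r_def using False s mx_scale[of "1/s" d] by (simp add: r_def)
      then show ?thesis using False s[OF False] by (simp add: y_def)
    qed
    have "N * x k = N * q (1 - r, y) k" for k
    proof (cases "k \<in> J")
      case True
      then show ?thesis unfolding qin using key[OF e'J(1)[OF True]] e'J[OF True] by (simp add: d_def diff_divide_distrib)
    next
      case False
      then show ?thesis unfolding qin using x by (auto simp: grid_cell_def split: if_splits)
    qed
    then have "x = q (1 - r, y)" using N by (intro ext) simp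
    then show ?thesis using r1 rb yS by (intro exI[of _ "1 - r"] exI[of _ y]) auto
  qed
  \<comment> \<open>The only identifications made by \<open>q\<close> are at the centre, where the
    null-homotopy is constant; this is what lets it descend.\<close>
  have fib: "t = t' \<and> (t = 1 \<or> y = y')"
    if t: "0 \<le> t" "t \<le> 1" "0 \<le> t'" "t' \<le> 1" and y: "y \<in> S" "y' \<in> S" and eq: "q (t, y) = q (t', y')" for t t' y y'
  proof -
    have p: "mx y > 0" "mx y' > 0" using mx_pos Snz y by auto
    have *: "((1 - t) / mx y) * y l = ((1 - t') / mx y') * y' l" if "l < j" for l
    proof -
      have "a (e l) + 1/2 + (1 - t) * (y l / mx y) / 2 = a (e l) + 1/2 + (1 - t') * (y' l / mx y') / 2"
        using qin[of t y "e l"] qin[of t' y' "e l"] eq eJ[OF that] by metis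
      moreover have "A = B" if "c + 1/2 + A/2 = c + 1/2 + B/2" for A B c :: real using that by simp
      ultimately have "(1 - t) * (y l / mx y) = (1 - t') * (y' l / mx y')" by blast
      then show ?thesis by simp
    qed
    have "((1 - t) / mx y) * mx y = mx (\<lambda>l. ((1 - t) / mx y) * y l)"
      using t p by (intro mx_scale[symmetric]) auto
    also have "\<dots> = mx (\<lambda>l. ((1 - t') / mx y') * y' l)" by (rule mx_cong) (rule *)
    also have "\<dots> = ((1 - t') / mx y') * mx y'" using t p by (intro mx_scale) auto
    finally have tt: "t = t'" using p by simp
    moreover have "y = y'" if "t \<noteq> 1"
    proof -
      define c where "c = mx y / mx y'"
      have c: "c > 0" using p by (simp add: c_def)
      have yl: "y l = c * y' l" if "l < j" for l
      proof -
        have "(1 - t) * (y l / mx y) = (1 - t) * (y' l / mx y')" using *[OF that] tt by simp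
        then have "y l / mx y = y' l / mx y'"
          using mult_left_cancel[of "1 - t" "y l / mx y" "y' l / mx y'"] \<open>t \<noteq> 1\<close> by linarith
        then show ?thesis using p by (simp add: c_def field_simps)
      qed
      have "(\<Sum>l<j. (y l)\<^sup>2) = c\<^sup>2 * (\<Sum>l<j. (y' l)\<^sup>2)"
        by (simp add: yl power_mult_distrib sum_distrib_left)
      then have "c\<^sup>2 = 1" using y by (simp add: S_def sph_def)
      then have "c = 1" using c by (simp add: power2_eq_1_iff)
      show "y = y'"
      proof
        fix l show "y l = y' l"
          using yl[of l] \<open>c = 1\<close> y by (cases "l < j") (auto simp: S_def sph_def)
      qed
    qed
    ultimately show ?thesis by auto
  qed
  have "continuous_on S (\<lambda>y. h (q (0, y)))"
  proof (rule continuous_on_compose2[OF h(1)])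
    show "continuous_on S (\<lambda>y. q (0, y))"
      by (rule continuous_on_compose2[OF qc]) (auto intro: continuous_intros)
  qed (use qbd in auto)
  moreover have "(\<lambda>y. h (q (0, y))) ` S \<subseteq> realization K" using qbd h(2) by auto
  ultimately obtain b where b: "b \<in> realization K" "homo S (realization K) (\<lambda>y. h (q (0, y))) (\<lambda>_. b)"
    using m_connectedD[OF K im, of "\<lambda>y. h (q (0, y))"] unfolding S_def i by metis
  then obtain H where Hc: "continuous_map (prod_topology (top_of_set {0..1::real}) (top_of_set S)) (top_of_set (realization K)) H"
    and H0: "\<And>y. H (0, y) = h (q (0, y))" and H1: "\<And>y. H (1, y) = b"
    unfolding homotopic_with_def by blast
  have img: "q ` ({0..1} \<times> S) = grid_cell N (a, J)"
  proof (intro equalityI subsetI)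
    fix x assume "x \<in> grid_cell N (a, J)"
    then obtain t y where "0 \<le> t" "t \<le> 1" "y \<in> S" "x = q (t, y)" using surj[of x] by auto
    then show "x \<in> q ` ({0..1} \<times> S)" by auto
  qed (use qcell in auto)
  \<comment> \<open>A continuous surjection from a compact space to a Hausdorff space is a quotient
    map.\<close>
  have qm: "quotient_map (top_of_set ({0..1} \<times> S)) (top_of_set (grid_cell N (a, J))) q"
  proof (rule continuous_imp_quotient_map)
    show "continuous_map (top_of_set ({0..1} \<times> S)) (top_of_set (grid_cell N (a, J))) q"
      using qc img by auto
    show "compact_space (top_of_set ({0..1::real} \<times> S))"
      using compact_sph[of j] by (simp add: S_def compact_Times compact_space_subtopology)
    show "Hausdorff_space (top_of_set (grid_cell N (a, J)))"
      by (simp add: Hausdorff_space_subtopology Hausdorff_space_euclidean)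
  qed (use img in simp)
  obtain h' where h': "continuous_map (top_of_set (grid_cell N (a, J))) (top_of_set (realization K)) h'"
    "\<And>p. p \<in> {0..1} \<times> S \<Longrightarrow> h' (q p) = H p"
  proof (rule quotient_map_lift_exists[OF qm, of "top_of_set (realization K)" H])
    show "continuous_map (top_of_set ({0..1} \<times> S)) (top_of_set (realization K)) H"
      using Hc by simp
    fix p p' assume pp: "p \<in> topspace (top_of_set ({0..1} \<times> S))" "p' \<in> topspace (top_of_set ({0..1} \<times> S))" "q p = q p'"
    obtain t y t' y' where "p = (t, y)" "p' = (t', y')" by (cases p, cases p')
    then show "H p = H p'" using pp fib[of t t' y y'] H1 by auto
  qed auto
  show ?thesis
  proof (intro exI[of _ h'] conjI ballI)
    show "continuous_on (grid_cell N (a, J)) h'" "h' ` grid_cell N (a, J) \<subseteq> realization K"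
      using h'(1) unfolding continuous_map_subtopology_eu image_subset_iff_funcset by simp_all
    fix x assume x: "x \<in> grid_bd N (a, J)"
    then have "x \<in> grid_cell N (a, J)" by (auto simp: grid_bd_def)
    then obtain y where "y \<in> S" "x = q (0, y)" using surj[of x] x by auto
    then show "h' x = h x" using h'(2)[of "(0, y)"] H0 by auto
  qed
qed

text \<open>[-1,1]^n inside the sequences; it plays the role of a ball containing
  \<open>sph n\<close>, and unlike a round ball it is easily subdivided into cells.\<close>

definition unit_cube :: "nat \<Rightarrow> (nat \<Rightarrow> real) set" where
  "unit_cube n = {x. \<forall>k. x k \<in> (if k < n then {-1..1} else {0})}"

lemma compact_unit_cube: "compact (unit_cube n)"
  unfolding unit_cube_def by (rule compact_coordinatewise) auto

text \<open>The metric on functions is a series with weights (1/2)^n, which sum to 2.\<close>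

lemma dist_fun_le:
  fixes x y :: "nat \<Rightarrow> real"
  assumes "\<And>k. \<bar>x k - y k\<bar> \<le> e"
  shows "dist x y \<le> 2 * e"
proof -
  have s: "summable (\<lambda>n. (1/2::real)^n)" by (simp add: summable_geometric_iff)
  have "dist x y = (\<Sum>n. (1/2)^n * min (dist (x (from_nat n)) (y (from_nat n))) 1)"
    by (rule dist_fun_def)
  also have "\<dots> \<le> (\<Sum>n. (1/2)^n * e)"
  proof (rule suminf_le)
    fix n
    show "(1/2::real)^n * min (dist (x (from_nat n)) (y (from_nat n))) 1 \<le> (1/2)^n * e"
      using assms[of "from_nat n"] by (intro mult_left_mono) (auto simp: dist_real_def)
    show "summable (\<lambda>n. (1/2::real)^n * min (dist (x (from_nat n)) (y (from_nat n))) 1)"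
      by (rule summable_comparison_test'[OF s, of 0]) auto
    show "summable (\<lambda>n. (1/2::real)^n * e)" by (rule summable_mult2[OF s])
  qed
  also have "\<dots> = 2 * e" using suminf_mult2[OF s, of e] suminf_geometric[of "1/2::real"] by simp
  finally show ?thesis .
qed

text \<open>In a free direction the corner must be below \<open>N\<close>, since the cell reaches
  one unit further; this keeps all cells inside [-1,1]^n.\<close>

definition grid_cells :: "nat \<Rightarrow> nat \<Rightarrow> ((nat \<Rightarrow> int) \<times> nat set) set" where
  "grid_cells n N = {(a, J). J \<subseteq> {..<n} \<and>
     (\<forall>k. (k \<in> {..<n} \<longrightarrow> a k \<in> {- int N..int N}) \<and> (k \<notin> {..<n} \<longrightarrow> a k = 0)) \<and> (\<forall>k\<in>J. a k < N)}"

lemma finite_grid_cells: "finite (grid_cells n N)"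
proof -
  have "finite {a. \<forall>k. (k \<in> {..<n} \<longrightarrow> a k \<in> {- int N..int N}) \<and> (k \<notin> {..<n} \<longrightarrow> a k = 0)}"
    by (rule finite_set_of_finite_funs) auto
  moreover have "finite (Pow {..<n})" by simp
  ultimately have "finite ({a. \<forall>k. (k \<in> {..<n} \<longrightarrow> a k \<in> {- int N..int N}) \<and> (k \<notin> {..<n} \<longrightarrow> a k = 0)} \<times> Pow {..<n})"
    by (rule finite_cartesian_product)
  then show ?thesis by (rule finite_subset[rotated]) (auto simp: grid_cells_def)
qed

lemma grid_cells_cover:
  assumes x: "x \<in> unit_cube n"
  shows "\<exists>e\<in>grid_cells n N. x \<in> grid_cell N e"
proof (intro bexI)
  let ?a = "\<lambda>k. if k < n then \<lfloor>N * x k\<rfloor> else 0"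
  \<comment> \<open>Coordinates equal to 1 are not free: there the scaled coordinate is already
    \<open>N\<close>, the largest corner.\<close>
  let ?J = "{k. k < n \<and> N * x k < N}"
  have x1: "-1 \<le> x k" "x k \<le> 1" if "k < n" for k using x that by (auto simp: unit_cube_def dest: spec[of _ k])
  have x0: "x k = 0" if "\<not> k < n" for k using x that by (auto simp: unit_cube_def dest: spec[of _ k])
  show "x \<in> grid_cell N (?a, ?J)"
  proof -
    have "if k \<in> ?J then ?a k \<le> N * x k \<and> N * x k \<le> ?a k + 1 else N * x k = ?a k" for k
    proof (cases "k < n")
      case True
      show ?thesis
      proof (cases "N * x k < N")
        case False
        have "real N * x k \<le> real N * 1" using x1[OF True] by (intro mult_left_mono) auto
        then have "N * x k = N" using False by simp
        then have "N = 0 \<or> x k = 1" by simp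
        then show ?thesis using True False by auto
      next
        case lt: True
        have "real_of_int \<lfloor>N * x k\<rfloor> \<le> N * x k" "N * x k \<le> real_of_int \<lfloor>N * x k\<rfloor> + 1" by linarith+
        then show ?thesis using True lt by simp
      qed
    qed (use x0 in simp)
    then show ?thesis unfolding grid_cell_def by simp
  qed
  have "?a k \<in> {- int N..int N}" if k: "k < n" for k
  proof -
    have "real N * (-1) \<le> real N * x k" "real N * x k \<le> real N * 1" using x1[OF k] by (intro mult_left_mono; simp)+
    then show ?thesis using k by (simp add: le_floor_iff floor_le_iff)
  qed
  moreover have "?a k < N" if "k \<in> ?J" for k using that by (simp add: floor_less_iff)
  ultimately show "(?a, ?J) \<in> grid_cells n N"
    unfolding grid_cells_def by auto
qed

lemma grid_cell_subset_cube:
  assumes N: "N > 0" and e: "e \<in> grid_cells n N"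
  shows "grid_cell N e \<subseteq> unit_cube n"
proof
  fix x assume x: "x \<in> grid_cell N e"
  obtain a J where aJ: "e = (a, J)" by (cases e)
  have 1: "if k \<in> J then a k \<le> N * x k \<and> N * x k \<le> a k + 1 else N * x k = a k" for k
    using x unfolding aJ grid_cell_def by auto
  have "x k \<in> (if k < n then {-1..1} else {0})" for k
  proof (cases "k < n")
    case True
    have "- int N \<le> a k" "a k \<le> N" "k \<in> J \<Longrightarrow> a k + 1 \<le> N" using e True by (auto simp: aJ grid_cells_def)
    then have "- real N \<le> a k" "a k \<le> real N" "k \<in> J \<Longrightarrow> real_of_int (a k) + 1 \<le> real N"
      by linarith+
    moreover have "c * (-1) \<le> g \<and> g \<le> c * 1"
      if "- c \<le> b" "b \<le> c" "k \<in> J \<Longrightarrow> b + 1 \<le> c" "if k \<in> J then b \<le> g \<and> g \<le> b + 1 else g = b" for b c g :: real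
      using that by (auto split: if_splits)
    moreover have "if k \<in> J then real_of_int (a k) \<le> N * x k \<and> N * x k \<le> real_of_int (a k) + 1 else N * x k = real_of_int (a k)"
      using 1[of k] by (auto split: if_splits)
    ultimately have "real N * (-1) \<le> real N * x k" "real N * x k \<le> real N * 1" by blast+
    then have "-1 \<le> x k" "x k \<le> 1" using N by (blast intro: mult_left_le_imp_le[of "real N"] of_nat_0_less_iff[THEN iffD2])+
    then show ?thesis using True by simp
  next
    case False
    then have "k \<notin> J" "a k = 0" using e by (auto simp: aJ grid_cells_def)
    then show ?thesis using 1[of k] N False by simp
  qed
  then show "x \<in> unit_cube n" by (simp add: unit_cube_def)
qed

lemma grid_cell_small:
  assumes N: "N > 0" and x: "x \<in> grid_cell N e" "y \<in> grid_cell N e"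
  shows "dist x y \<le> 2 / N"
proof -
  obtain a J where aJ: "e = (a, J)" by (cases e)
  have "\<bar>x k - y k\<bar> \<le> 1 / N" for k
  proof -
    have "if k \<in> J then a k \<le> N * x k \<and> N * x k \<le> a k + 1 else N * x k = a k"
      "if k \<in> J then a k \<le> N * y k \<and> N * y k \<le> a k + 1 else N * y k = a k"
      using x unfolding aJ grid_cell_def by auto
    then have "\<bar>N * x k - N * y k\<bar> \<le> 1" by (auto split: if_splits)
    then have "N * \<bar>x k - y k\<bar> \<le> 1" by (simp add: abs_mult flip: right_diff_distrib)
    then show ?thesis using N by (simp add: field_simps)
  qed
  from dist_fun_le[OF this] show ?thesis by simp
qed

text \<open>A direction in which \<open>x\<close> is at an end of the cell is dropped, and the
  corner moves to that end.\<close>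

lemma grid_bd_face:
  assumes e: "e \<in> grid_cells n N" and x: "x \<in> grid_bd N e"
  shows "\<exists>e'\<in>grid_cells n N. x \<in> grid_cell N e' \<and> card (snd e') < card (snd e)"
proof -
  obtain a J where aJ: "e = (a, J)" by (cases e)
  obtain k where k: "k \<in> J" "N * x k = a k \<or> N * x k = a k + 1"
    using x unfolding aJ grid_bd_def by auto
  have xe: "x \<in> grid_cell N (a, J)" using x unfolding aJ grid_bd_def by auto
  have "finite J" "J \<subseteq> {..<n}" using e by (auto simp: aJ grid_cells_def finite_subset)
  then have card: "card (J - {k}) < card J" using k(1)
    by (intro psubset_card_mono) auto
  define a' where "a' = (if N * x k = a k then a else a(k := a k + 1))"
  have "(a', J - {k}) \<in> grid_cells n N"
    using e k(1) \<open>J \<subseteq> {..<n}\<close> unfolding aJ grid_cells_def a'_def by auto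
  moreover have "x \<in> grid_cell N (a', J - {k})"
    using xe k unfolding grid_cell_def a'_def by auto
  ultimately show ?thesis using card by (auto simp: aJ)
qed

text \<open>If a common point is in the relative interior of \<open>e\<close>, its scaled
  coordinates in the directions of \<open>e\<close> are strictly between consecutive integers. This
  forces \<open>e'\<close> to be free there with the same corner, so \<open>e\<close> is a proper
  face of \<open>e'\<close>.\<close>

lemma grid_cell_inter:
  assumes e: "e \<in> grid_cells n N" "e' \<in> grid_cells n N" "e \<noteq> e'"
  shows "grid_cell N e \<inter> grid_cell N e' \<subseteq> grid_bd N e \<or> card (snd e) < card (snd e') \<and> grid_cell N e \<subseteq> grid_cell N e'"
proof (cases "grid_cell N e \<inter> grid_cell N e' \<subseteq> grid_bd N e")
  case False
  obtain a J a' J' where aJ: "e = (a, J)" "e' = (a', J')" by (cases e; cases e')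
  obtain x where x: "x \<in> grid_cell N (a, J)" "x \<in> grid_cell N (a', J')" "x \<notin> grid_bd N (a, J)"
    using False unfolding aJ by auto
  have 1: "if k \<in> J then a k \<le> N * x k \<and> N * x k \<le> a k + 1 else N * x k = a k"
    and 2: "if k \<in> J' then a' k \<le> N * x k \<and> N * x k \<le> a' k + 1 else N * x k = a' k" for k
    using x(1,2) unfolding grid_cell_def by auto
  have in': "k \<in> J' \<and> a' k = a k" if "k \<in> J" for k
  proof -
    have s: "a k < N * x k" "N * x k < a k + 1"
      using x(1,3) that 1[of k] unfolding grid_bd_def by force+
    have "k \<in> J'"
    proof (rule ccontr)
      assume "k \<notin> J'"
      then have "N * x k = a' k" using 2[of k] by simp
      then have "real_of_int (a k) < real_of_int (a' k)" "real_of_int (a' k) < real_of_int (a k) + 1" using s by auto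
      then show False by (simp add: int_less_real_le)
    qed
    moreover from this have "real_of_int (a' k) < real_of_int (a k) + 1" "real_of_int (a k) < real_of_int (a' k) + 1"
      using 2[of k] s by auto
    then have "\<not> a k < a' k" "\<not> a' k < a k" by (simp_all add: int_less_real_le)
    then have "a' k = a k" by simp
    ultimately show ?thesis by simp
  qed
  have out: "if k \<in> J' then a' k \<le> a k \<and> a k \<le> a' k + 1 else a' k = a k" if "k \<notin> J" for k
  proof -
    have "N * x k = a k" using 1[of k] that by simp
    then have "if k \<in> J' then real_of_int (a' k) \<le> a k \<and> a k \<le> real_of_int (a' k) + 1 else real_of_int (a k) = a' k"
      using 2[of k] by auto
    then show ?thesis by (auto split: if_splits)
  qed
  have "J \<subseteq> J'" using in' by auto
  have "J \<noteq> J'"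
  proof
    assume "J = J'"
    then have "a k = a' k" for k using in'[of k] out[of k] by (cases "k \<in> J") auto
    then show False using e(3) \<open>J = J'\<close> unfolding aJ by auto
  qed
  moreover have "finite J'" using e(2) by (auto simp: aJ grid_cells_def finite_subset)
  ultimately have "card J < card J'" using \<open>J \<subseteq> J'\<close> by (simp add: psubset_card_mono psubset_eq)
  moreover have "grid_cell N e \<subseteq> grid_cell N e'"
  proof
    fix y assume y: "y \<in> grid_cell N e"
    have "if k \<in> J' then a' k \<le> N * y k \<and> N * y k \<le> a' k + 1 else N * y k = a' k" for k
    proof -
      have y1: "if k \<in> J then a k \<le> N * y k \<and> N * y k \<le> a k + 1 else N * y k = a k"
        using y unfolding aJ grid_cell_def by auto
      show ?thesis
      proof (cases "k \<in> J")
        case True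
        then show ?thesis using y1 in' by auto
      next
        case False
        then have "N * y k = a k" using y1 by simp
        moreover have "if k \<in> J' then real_of_int (a' k) \<le> a k \<and> a k \<le> real_of_int (a' k) + 1 else real_of_int (a' k) = a k"
          using out[OF False] by (auto split: if_splits)
        ultimately show ?thesis by auto
      qed
    qed
    then have "\<forall>k. if k \<in> J' then a' k \<le> N * y k \<and> N * y k \<le> a' k + 1 else N * y k = a' k" by blast
    then show "y \<in> grid_cell N e'" by (auto simp: aJ grid_cell_def split: if_splits)
  qed
  ultimately show ?thesis by (simp add: aJ)
qed simp

text \<open>The cells of a fine cubical grid that miss \<open>F\<close> cover \<open>A\<close>; from their union, \<open>k\<close> extends over the
  remaining cells one at a time.\<close>

lemma m_connected_extension:
  fixes k :: "(nat \<Rightarrow> real) \<Rightarrow> 'v \<Rightarrow> real"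
  assumes K: "m_connected m K" and n: "n \<le> Suc m"
    and A: "A \<subseteq> unit_cube n" "compact A" and F: "closed F" "A \<inter> F = {}"
    and k: "continuous_on (unit_cube n - F) k" "k ` (unit_cube n - F) \<subseteq> realization K"
  shows "\<exists>k'. continuous_on (unit_cube n) k' \<and> k' ` unit_cube n \<subseteq> realization K \<and> (\<forall>x\<in>A. k' x = k x)"
proof -
  have "\<exists>d>0. \<forall>x\<in>A. \<forall>y\<in>F. d \<le> dist x y"
  proof (cases "A = {} \<or> F = {}")
    case False
    have "continuous_on A (\<lambda>x. infdist x F)" by (intro continuous_intros)
    then obtain x0 where x0: "x0 \<in> A" "\<forall>x\<in>A. infdist x0 F \<le> infdist x F"
      using continuous_attains_inf[OF A(2)] False by blast
    have "x0 \<notin> F" using x0(1) F(2) by auto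
    then have "infdist x0 F > 0" using infdist_pos_not_in_closed[OF F(1)] False by auto
    moreover have "infdist x0 F \<le> dist x y" if "x \<in> A" "y \<in> F" for x y
      using x0(2) that(1) infdist_le[OF that(2), of x] by fastforce
    ultimately show ?thesis by blast
  qed (auto intro: exI[of _ 1])
  then obtain d where d: "d > 0" "\<And>x y. x \<in> A \<Longrightarrow> y \<in> F \<Longrightarrow> d \<le> dist x y" by blast
  \<comment> \<open>Points of one cell have distance at most 2 / N, so with 2 / N < d no cell meets
    both \<open>A\<close> and \<open>F\<close>.\<close>
  obtain N0 :: nat where N0: "2 / d < N0" using reals_Archimedean2 by auto
  define N where "N = Suc N0"
  have "2 / d < N" using N0 by (simp add: N_def)
  then have N: "N > 0" "2 / N < d" using d by (auto simp: N_def field_simps)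
  define B where "B = {e \<in> grid_cells n N. grid_cell N e \<inter> F = {}}"
  have cover: "\<Union>(grid_cell N ` grid_cells n N) = unit_cube n"
    using grid_cells_cover[of _ n N] grid_cell_subset_cube[OF N(1)] by fastforce
  have AB: "A \<subseteq> \<Union>(grid_cell N ` B)"
  proof
    fix x assume x: "x \<in> A"
    then obtain e where e: "e \<in> grid_cells n N" "x \<in> grid_cell N e" using grid_cells_cover A(1) by blast
    have "y \<notin> F" if "y \<in> grid_cell N e" for y
      using d(2)[OF x, of y] grid_cell_small[OF N(1) e(2) that] N(2) by fastforce
    then have "e \<in> B" using e by (auto simp: B_def)
    then show "x \<in> \<Union>(grid_cell N ` B)" using e by auto
  qed
  have Bsub: "\<Union>(grid_cell N ` B) \<subseteq> unit_cube n - F"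
    using grid_cell_subset_cube[OF N(1)] unfolding B_def by fastforce
  have "\<exists>h'. continuous_on (\<Union>(grid_cell N ` grid_cells n N)) h' \<and>
      h' ` \<Union>(grid_cell N ` grid_cells n N) \<subseteq> realization K \<and> (\<forall>x\<in>\<Union>(grid_cell N ` B). h' x = k x)"
  proof (rule cell_extension[where bd = "grid_bd N" and rank = "\<lambda>e. card (snd e)"])
    show "finite (grid_cells n N)" by (rule finite_grid_cells)
    show "closed (grid_cell N e)" for e by (rule closed_grid_cell)
    show "\<exists>e'\<in>grid_cells n N. x \<in> grid_cell N e' \<and> card (snd e') < card (snd e)"
      if "e \<in> grid_cells n N" "x \<in> grid_bd N e" for e x
      using grid_bd_face that .
    show "grid_cell N e \<inter> grid_cell N e' \<subseteq> grid_bd N e \<or>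
        card (snd e) < card (snd e') \<and> grid_cell N e \<subseteq> grid_cell N e'"
      if "e \<in> grid_cells n N" "e' \<in> grid_cells n N" "e \<noteq> e'" for e e'
      using grid_cell_inter that .
    show "\<exists>h'. continuous_on (grid_cell N e) h' \<and> h' ` grid_cell N e \<subseteq> realization K \<and> (\<forall>x\<in>grid_bd N e. h' x = h x)"
      if e: "e \<in> grid_cells n N" "continuous_on (grid_bd N e) h" "h ` grid_bd N e \<subseteq> realization K"
      for e and h :: "(nat \<Rightarrow> real) \<Rightarrow> 'v \<Rightarrow> real"
    proof -
      obtain a J where aJ: "e = (a, J)" by (cases e)
      have "J \<subseteq> {..<n}" using e(1) by (auto simp: aJ grid_cells_def)
      then have "finite J" "card J \<le> Suc m" using n card_mono[of "{..<n}" J] by (auto intro: finite_subset)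
      then show ?thesis using grid_cell_ext[OF K N(1), of J a h] e(2,3) unfolding aJ by simp
    qed
    show "B \<subseteq> grid_cells n N" by (auto simp: B_def)
    show "e \<in> B" if "e \<in> grid_cells n N" "e' \<in> B" "grid_cell N e \<subseteq> grid_cell N e'" for e e'
      using that by (auto simp: B_def)
    show "continuous_on (\<Union>(grid_cell N ` B)) k" by (rule continuous_on_subset[OF k(1) Bsub])
    show "k ` \<Union>(grid_cell N ` B) \<subseteq> realization K" using k(2) Bsub by blast
  qed
  then show ?thesis unfolding cover using AB by (meson subsetD)
qed

text \<open>A map \<open>g\<close> from a sphere to the join has a \<open>K\<close>-coordinate except where its \<open>L\<close>-weight \<open>t \<circ> g\<close> is 1.
  Extended radially and restricted to the points with \<open>t \<circ> g \<le> 1 / 2\<close>, this coordinate extends to a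
  map \<open>k\<close> from the whole ball to \<open>K\<close>. Replacing the \<open>K\<close>-coordinate of \<open>g\<close> by \<open>k\<close>, and increasing its
  \<open>L\<close>-weight to 1 where the two differ, one can slide \<open>g\<close> to \<open>k\<close>, which is null-homotopic.\<close>

lemma m_connected_join:
  fixes K L :: "'v complx"
  assumes K: "simplicial K" and L: "simplicial L" and disj: "\<Union>K \<inter> \<Union>L = {}" and m: "m_connected m K"
  shows "m_connected m (join K L)"
proof -
  let ?X = "join K L"
  define VK VL where "VK = \<Union>K" and "VL = \<Union>L"
  have fin: "finite VL" using simplicialD[OF L] by (auto simp: VL_def)
  define t where "t \<alpha> = sum \<alpha> VL" for \<alpha> :: "'v \<Rightarrow> real"
  have tc: "continuous_on UNIV t" unfolding t_def by (intro continuous_on_sum continuous_on_product_coordinates)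
  have pts: "\<exists>\<kappa> \<mu>. \<kappa> \<in> insert {} K \<and> \<mu> \<in> insert {} L \<and> \<kappa> \<union> \<mu> \<in> ?X \<and> \<alpha> \<in> simplex_pts (\<kappa> \<union> \<mu>)
      \<and> finite \<kappa> \<and> finite \<mu> \<and> \<kappa> \<subseteq> VK \<and> \<mu> \<subseteq> VL \<and> \<kappa> \<inter> \<mu> = {} \<and> sum \<alpha> \<mu> = t \<alpha> \<and> sum \<alpha> \<kappa> = 1 - t \<alpha>"
    if \<alpha>: "\<alpha> \<in> realization ?X" for \<alpha>
  proof -
    obtain \<sigma> where s: "\<sigma> \<in> ?X" "\<alpha> \<in> simplex_pts \<sigma>" using \<alpha> by (auto simp: realization_def)
    then obtain \<kappa> \<mu> where km: "\<kappa> \<in> insert {} K" "\<mu> \<in> insert {} L" "\<sigma> = \<kappa> \<union> \<mu>" by (auto simp: join_def)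
    have f: "finite \<kappa>" "finite \<mu>" using km simplicialD(3)[OF K] simplicialD(3)[OF L] by auto
    have sub: "\<kappa> \<subseteq> VK" "\<mu> \<subseteq> VL" using km by (auto simp: VK_def VL_def)
    then have d: "\<kappa> \<inter> \<mu> = {}" "\<kappa> \<inter> VL = {}" using disj by (auto simp: VK_def VL_def)
    have "sum \<alpha> VL = sum \<alpha> \<mu>"
      by (rule sum.mono_neutral_right[OF fin sub(2)]) (use s(2) d(2) km(3) in \<open>auto simp: simplex_pts_def\<close>)
    moreover have "sum \<alpha> (\<kappa> \<union> \<mu>) = sum \<alpha> \<kappa> + sum \<alpha> \<mu>" using f d(1) by (rule sum.union_disjoint)
    ultimately have "sum \<alpha> \<mu> = t \<alpha>" "sum \<alpha> \<kappa> = 1 - t \<alpha>" using s(2) km(3) by (auto simp: t_def simplex_pts_def)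
    then show ?thesis using s km f sub d by (intro exI[of _ \<kappa>] exI[of _ \<mu>]) auto
  qed
  have t01: "0 \<le> t \<alpha>" "t \<alpha> \<le> 1" if a: "\<alpha> \<in> realization ?X" for \<alpha>
  proof -
    obtain \<kappa> \<mu> where "\<alpha> \<in> simplex_pts (\<kappa> \<union> \<mu>)" "sum \<alpha> \<mu> = t \<alpha>" "sum \<alpha> \<kappa> = 1 - t \<alpha>" using pts[OF a] by auto
    moreover have "sum \<alpha> \<mu> \<ge> 0" "sum \<alpha> \<kappa> \<ge> 0" using calculation(1) by (auto intro!: sum_nonneg simp: simplex_pts_def)
    ultimately show "0 \<le> t \<alpha>" "t \<alpha> \<le> 1" by auto
  qed
  \<comment> \<open>The \<open>K\<close>-coordinate, normalised to total weight 1; it is meaningful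
    only where the \<open>L\<close>-weight is below 1.\<close>
  define ka where "ka \<alpha> x = (if x \<in> VK then \<alpha> x / (1 - t \<alpha>) else 0)" for \<alpha> x
  have ka: "\<kappa> \<in> K \<and> ka \<alpha> \<in> simplex_pts \<kappa>"
    if "\<kappa> \<in> insert {} K" "\<alpha> \<in> simplex_pts (\<kappa> \<union> \<mu>)" "\<kappa> \<subseteq> VK" "\<mu> \<subseteq> VL" "sum \<alpha> \<kappa> = 1 - t \<alpha>" "t \<alpha> < 1" for \<alpha> \<kappa> \<mu>
  proof -
    have "\<kappa> \<noteq> {}" using that(5,6) by auto
    moreover have "sum (ka \<alpha>) \<kappa> = (\<Sum>x\<in>\<kappa>. \<alpha> x / (1 - t \<alpha>))"
      unfolding ka_def by (rule sum.cong) (use that(3) in auto)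
    then have "sum (ka \<alpha>) \<kappa> = 1" using that(5,6) by (simp flip: sum_divide_distrib)
    moreover have "ka \<alpha> x = 0" if "x \<notin> \<kappa>" for x
    proof (cases "x \<in> VK")
      case True
      then have "x \<notin> \<mu>" using \<open>\<mu> \<subseteq> VL\<close> disj by (auto simp: VK_def VL_def)
      then show ?thesis using that \<open>\<alpha> \<in> simplex_pts _\<close> by (simp add: ka_def simplex_pts_def)
    qed (simp add: ka_def)
    moreover have "ka \<alpha> x \<ge> 0" for x using that(2,6) by (simp add: ka_def simplex_pts_def)
    ultimately show ?thesis using that(1) by (simp add: simplex_pts_def)
  qed
  have ka': "ka \<alpha> \<in> realization K" if a: "\<alpha> \<in> realization ?X" "t \<alpha> < 1" for \<alpha>
  proof -
    obtain \<kappa> \<mu> where "\<kappa> \<in> insert {} K" "\<alpha> \<in> simplex_pts (\<kappa> \<union> \<mu>)" "\<kappa> \<subseteq> VK" "\<mu> \<subseteq> VL" "sum \<alpha> \<kappa> = 1 - t \<alpha>"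
      using pts[OF a(1)] by auto
    from ka[OF this a(2)] show ?thesis by (auto simp: realization_def)
  qed
  have kac: "continuous_on {\<alpha>. t \<alpha> < 1} ka"
  proof (rule continuous_on_coordinatewise_then_product)
    fix x
    have "continuous_on {\<alpha>. t \<alpha> < 1} (\<lambda>\<alpha>. \<alpha> x / (1 - t \<alpha>))"
      by (intro continuous_intros continuous_on_subset[OF continuous_on_product_coordinates] continuous_on_subset[OF tc]) auto
    then show "continuous_on {\<alpha>. t \<alpha> < 1} (\<lambda>\<alpha>. ka \<alpha> x)" unfolding ka_def by (cases "x \<in> VK") auto
  qed
  have KX: "realization K \<subseteq> realization ?X"
  proof
    fix \<alpha> assume "\<alpha> \<in> realization K"
    then obtain \<kappa> where k: "\<kappa> \<in> K" "\<alpha> \<in> simplex_pts \<kappa>" by (auto simp: realization_def)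
    have "\<kappa> \<in> ?X" using k(1) simplicialD(2)[OF K k(1)] by (force simp: join_def)
    then show "\<alpha> \<in> realization ?X" using k(2) by (auto simp: realization_def)
  qed
  show ?thesis
    unfolding m_connected_iff
  proof (intro conjI allI impI)
    show "realization ?X \<noteq> {}" using m KX unfolding m_connected_iff by auto
    fix i g assume i: "i \<le> m" and g: "continuous_on (sph (Suc i)) g \<and> g ` sph (Suc i) \<subseteq> realization ?X"
    let ?S = "sph (Suc i)" and ?C = "unit_cube (Suc i)"
    define \<rho> where "\<rho> z = sqrt (\<Sum>k<Suc i. (z k)\<^sup>2)" for z :: "nat \<Rightarrow> real"
    define nz where "nz z k = z k / \<rho> z" for z and k :: nat
    have \<rho>c: "continuous_on UNIV \<rho>"
      unfolding \<rho>_def by (intro continuous_intros continuous_on_product_coordinates)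
    have S1: "\<rho> z = 1" "nz z = z" if "z \<in> ?S" for z
    proof -
      show "\<rho> z = 1" using that by (simp add: sph_def \<rho>_def)
      then show "nz z = z" by (intro ext) (simp add: nz_def)
    qed
    have SC: "?S \<subseteq> ?C"
    proof
      fix z assume z: "z \<in> ?S"
      have "(z k)\<^sup>2 \<le> 1" if "k < Suc i" for k
        using member_le_sum[of k "{..<Suc i}" "\<lambda>k. (z k)\<^sup>2"] that z by (simp add: sph_def del: sum.lessThan_Suc)
      then have "\<bar>z k\<bar> \<le> 1" if "k < Suc i" for k using that by (simp add: abs_square_le_1)
      then have "-1 \<le> z k \<and> z k \<le> 1" if "k < Suc i" for k using that abs_le_iff[of "z k" 1] by fastforce
      then show "z \<in> ?C" using z by (auto simp: unit_cube_def sph_def)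
    qed
    \<comment> \<open>Away from the origin the radial projection to the sphere is continuous; 1/2 is
      an arbitrary radius between 0 and 1.\<close>
    define D where "D = {z \<in> ?C. \<rho> z \<ge> 1/2}"
    have Ccl: "closed ?C" by (rule compact_imp_closed[OF compact_unit_cube])
    have \<rho>cl: "closed {z. \<rho> z \<ge> 1/2}" "closed {z. \<rho> z \<le> 1/2}"
      by (intro closed_Collect_le continuous_on_const \<rho>c)+
    have Dcl: "closed D" using closed_Int[OF Ccl \<rho>cl(1)] by (simp add: D_def Int_def)
    have nzS: "nz z \<in> ?S" if "z \<in> D" for z
    proof -
      have r: "\<rho> z > 0" "\<rho> z \<noteq> 0" using that by (auto simp: D_def)
      have "(\<Sum>k<Suc i. (nz z k)\<^sup>2) = (\<Sum>k<Suc i. (z k)\<^sup>2) / (\<rho> z)\<^sup>2"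
        unfolding nz_def power_divide sum_divide_distrib ..
      also have "(\<rho> z)\<^sup>2 = (\<Sum>k<Suc i. (z k)\<^sup>2)" unfolding \<rho>_def by (rule real_sqrt_pow2) (intro sum_nonneg, simp)
      finally have "(\<Sum>k<Suc i. (nz z k)\<^sup>2) = 1" using r by (simp add: \<rho>_def del: sum.lessThan_Suc)
      moreover have "nz z k = 0" if "k \<ge> Suc i" for k
        using that \<open>z \<in> D\<close> by (auto simp: D_def unit_cube_def nz_def dest!: spec[of _ k])
      ultimately show ?thesis by (simp add: sph_def del: sum.lessThan_Suc)
    qed
    have nzc: "continuous_on D nz"
      by (rule continuous_on_coordinatewise_then_product, unfold nz_def)
        (intro continuous_intros continuous_on_subset[OF continuous_on_product_coordinates] continuous_on_subset[OF \<rho>c]; auto simp: D_def)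
    have gnz: "continuous_on D (\<lambda>z. g (nz z))"
      by (rule continuous_on_compose2[OF conjunct1[OF g] nzc]) (use nzS in auto)
    have tgnz: "continuous_on D (\<lambda>z. t (g (nz z)))"
      by (rule continuous_on_compose2[OF tc gnz]) auto
    define F where "F = (?C \<inter> {z. \<rho> z \<le> 1/2}) \<union> (D \<inter> (\<lambda>z. t (g (nz z))) -` {1..})"
    have Fcl: "closed F"
      unfolding F_def by (intro closed_Un closed_Int Ccl \<rho>cl continuous_closed_preimage tgnz Dcl closed_atLeast)
    have CF: "?C - F = {z \<in> D. \<rho> z > 1/2 \<and> t (g (nz z)) < 1}" by (auto simp: F_def D_def)
    define A where "A = {z \<in> ?S. t (g z) \<le> 1/2}"
    have tg: "continuous_on ?S (\<lambda>z. t (g z))" by (rule continuous_on_compose2[OF tc conjunct1[OF g]]) auto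
    have "closed (?S \<inter> (\<lambda>z. t (g z)) -` {..1/2})"
      by (intro continuous_closed_preimage tg compact_imp_closed[OF compact_sph] closed_atMost)
    then have "compact (?S \<inter> (?S \<inter> (\<lambda>z. t (g z)) -` {..1/2}))" by (rule compact_Int_closed[OF compact_sph])
    moreover have "?S \<inter> (?S \<inter> (\<lambda>z. t (g z)) -` {..1/2}) = A" by (auto simp: A_def)
    ultimately have Acp: "compact A" by simp
    have AF: "A \<inter> F = {}"
    proof -
      have "z \<notin> F" if "z \<in> A" for z using that S1 by (auto simp: A_def F_def)
      then show ?thesis by auto
    qed
    have kc: "continuous_on (?C - F) (\<lambda>z. ka (g (nz z)))"
      by (rule continuous_on_compose2[OF kac continuous_on_subset[OF gnz]]) (auto simp: CF)
    have kr: "(\<lambda>z. ka (g (nz z))) ` (?C - F) \<subseteq> realization K"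
    proof clarify
      fix z assume "z \<in> ?C" "z \<notin> F"
      then have z: "z \<in> D" "t (g (nz z)) < 1" using CF by auto
      then have "g (nz z) \<in> realization ?X" using nzS[OF z(1)] g by auto
      then show "ka (g (nz z)) \<in> realization K" using ka' z(2) by simp
    qed
    have "A \<subseteq> ?C" using SC by (auto simp: A_def)
    from m_connected_extension[OF m _ this Acp Fcl AF kc kr] i
    obtain k where k: "continuous_on ?C k" "k ` ?C \<subseteq> realization K" "\<And>z. z \<in> A \<Longrightarrow> k z = ka (g (nz z))" by auto
    have kS: "continuous_on ?S k" "k ` ?S \<subseteq> realization K"
      using k(1,2) SC by (blast intro: continuous_on_subset)+
    have kA: "k z = ka (g z)" if "z \<in> ?S" "t (g z) \<le> 1/2" for z
      using k(3)[of z] that S1(2)[OF that(1)] by (simp add: A_def)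
    \<comment> \<open>With this factor the \<open>L\<close>-weight t becomes min (2 t) 1: it is 0
      where t is 0, and it reaches 1 at t = 1/2, beyond which \<open>k\<close> is no longer tied to
      \<open>g\<close>.\<close>
    define \<phi> where "\<phi> z = 1 / max (t (g z)) (1/2)" for z
    define G where "G z x = (if x \<in> VK then (1 - \<phi> z * t (g z)) * k z x else if x \<in> VL then \<phi> z * g z x else 0)" for z x
    have \<phi>c: "continuous_on ?S \<phi>" unfolding \<phi>_def by (intro continuous_intros tg) auto
    have Gc: "continuous_on ?S G"
    proof (rule continuous_on_coordinatewise_then_product)
      fix x
      have ck: "continuous_on ?S (\<lambda>z. k z x)" and cg: "continuous_on ?S (\<lambda>z. g z x)"
        using continuous_on_product_then_coordinatewise[OF kS(1)]
          continuous_on_product_then_coordinatewise[OF conjunct1[OF g]] by auto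
      have "continuous_on ?S (\<lambda>z. (1 - \<phi> z * t (g z)) * k z x)"
        by (rule continuous_on_mult[OF continuous_on_diff[OF continuous_on_const continuous_on_mult[OF \<phi>c tg]] ck])
      moreover have "continuous_on ?S (\<lambda>z. \<phi> z * g z x)" by (rule continuous_on_mult[OF \<phi>c cg])
      ultimately show "continuous_on ?S (\<lambda>z. G z x)"
        unfolding G_def by (cases "x \<in> VK"; cases "x \<in> VL") auto
    qed
    have \<phi>: "0 < \<phi> z" "\<phi> z * t (g z) \<le> 1" "t (g z) > 1/2 \<Longrightarrow> \<phi> z * t (g z) = 1" for z
      unfolding \<phi>_def by (auto simp: max_def field_simps)
    \<comment> \<open>The alternative with empty \<kappa>' covers the points where
      \<open>G z\<close> has \<open>L\<close>-weight 1, so that its \<open>K\<close>-part vanishes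
      whatever \<open>k z\<close> is.\<close>
    have Gin: "G z \<in> simplex_pts (\<kappa>' \<union> \<mu>)"
      if z: "z \<in> ?S" and k': "\<kappa>' = {} \<and> \<phi> z * t (g z) = 1 \<or> \<kappa>' \<in> K \<and> k z \<in> simplex_pts \<kappa>'"
        and gz: "g z \<in> simplex_pts (\<kappa> \<union> \<mu>)" "\<kappa> \<subseteq> VK" "\<mu> \<subseteq> VL" "finite \<mu>" "sum (g z) \<mu> = t (g z)" for z \<kappa>' \<kappa> \<mu>
    proof -
      have k'V: "\<kappa>' \<subseteq> VK" "finite \<kappa>'" using k' simplicialD(3)[OF K] by (auto simp: VK_def)
      have VV: "VK \<inter> VL = {}" using disj by (simp add: VK_def VL_def)
      have "sum (G z) \<kappa>' = (\<Sum>x\<in>\<kappa>'. (1 - \<phi> z * t (g z)) * k z x)"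
        unfolding G_def by (rule sum.cong) (use k'V in auto)
      also have "\<dots> = 1 - \<phi> z * t (g z)"
        using k' by (auto simp: simplex_pts_def simp flip: sum_distrib_left)
      finally have 1: "sum (G z) \<kappa>' = 1 - \<phi> z * t (g z)" .
      have "sum (G z) \<mu> = (\<Sum>x\<in>\<mu>. \<phi> z * g z x)"
        unfolding G_def by (rule sum.cong) (use gz VV in auto)
      also have "\<dots> = \<phi> z * t (g z)" using gz(5) by (simp flip: sum_distrib_left)
      finally have 2: "sum (G z) \<mu> = \<phi> z * t (g z)" .
      have "sum (G z) (\<kappa>' \<union> \<mu>) = sum (G z) \<kappa>' + sum (G z) \<mu>"
        by (rule sum.union_disjoint) (use k'V gz VV in auto)
      then have "sum (G z) (\<kappa>' \<union> \<mu>) = 1" using 1 2 by simp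
      moreover have "G z x \<ge> 0" for x
      proof -
        have "k z \<in> realization K" using kS(2) z by auto
        then have "k z x \<ge> 0" by (auto simp: realization_def simplex_pts_def)
        moreover have "g z x \<ge> 0" using gz(1) by (simp add: simplex_pts_def)
        ultimately show ?thesis using \<phi>(1,2)[of z] by (simp add: G_def)
      qed
      moreover have "G z x = 0" if "x \<notin> \<kappa>' \<union> \<mu>" for x
      proof (cases "x \<in> VK")
        case True
        then show ?thesis using k' that by (auto simp: G_def simplex_pts_def)
      next
        case False
        then have "x \<in> VL \<Longrightarrow> g z x = 0" using gz(1,2) that by (auto simp: simplex_pts_def)
        then show ?thesis using False by (simp add: G_def)
      qed
      ultimately show ?thesis by (simp add: simplex_pts_def)
    qed
    \<comment> \<open>Where t \<le> 1/2 the \<open>K\<close>-part of \<open>G z\<close> is a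
      multiple of that of \<open>g z\<close>; elsewhere \<open>G z\<close> lies in \<mu> alone. In
      both cases \<open>G z\<close> stays in the simplex of \<open>g z\<close>.\<close>
    have "homo ?S (realization ?X) g G"
    proof (rule contiguous_homotopic[OF conjunct1[OF g] Gc])
      fix z assume z: "z \<in> ?S"
      then have gX: "g z \<in> realization ?X" using g by auto
      obtain \<kappa> \<mu> where km: "\<kappa> \<in> insert {} K" "\<mu> \<in> insert {} L" "\<kappa> \<union> \<mu> \<in> ?X" "g z \<in> simplex_pts (\<kappa> \<union> \<mu>)"
        "finite \<kappa>" "finite \<mu>" "\<kappa> \<subseteq> VK" "\<mu> \<subseteq> VL" "\<kappa> \<inter> \<mu> = {}" "sum (g z) \<mu> = t (g z)" "sum (g z) \<kappa> = 1 - t (g z)"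
        using pts[OF gX] by auto
      have "G z \<in> simplex_pts (\<kappa> \<union> \<mu>)"
      proof (cases "t (g z) \<le> 1/2")
        case True
        then have "\<kappa> \<in> K \<and> k z \<in> simplex_pts \<kappa>"
          using ka[OF km(1,4,7,8,11)] kA[OF z] by auto
        then show ?thesis using Gin[OF z _ km(4,7,8,6,10)] by auto
      next
        case False
        then have "G z \<in> simplex_pts ({} \<union> \<mu>)" using Gin[OF z _ km(4,7,8,6,10), of "{}"] \<phi>(3)[of z] by auto
        then show ?thesis by (rule simplex_pts_mono) (use km in auto)
      qed
      then show "\<exists>\<sigma>\<in>?X. g z \<in> simplex_pts \<sigma> \<and> G z \<in> simplex_pts \<sigma>" using km(3,4) by auto
    qed
    \<comment> \<open>In a join, any simplex of \<open>K\<close> around \<open>k z\<close> spans a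
      simplex with the \<open>L\<close>-part \<mu> of \<open>g z\<close>, and this one contains both
      \<open>G z\<close> and \<open>k z\<close>.\<close>
    moreover have "homo ?S (realization ?X) G k"
    proof (rule contiguous_homotopic[OF Gc kS(1)])
      fix z assume z: "z \<in> ?S"
      then have gX: "g z \<in> realization ?X" using g by auto
      obtain \<kappa> \<mu> where km: "\<kappa> \<in> insert {} K" "\<mu> \<in> insert {} L" "\<kappa> \<union> \<mu> \<in> ?X" "g z \<in> simplex_pts (\<kappa> \<union> \<mu>)"
        "finite \<kappa>" "finite \<mu>" "\<kappa> \<subseteq> VK" "\<mu> \<subseteq> VL" "\<kappa> \<inter> \<mu> = {}" "sum (g z) \<mu> = t (g z)" "sum (g z) \<kappa> = 1 - t (g z)"
        using pts[OF gX] by auto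
      have "k z \<in> realization K" using kS(2) z by auto
      then obtain \<kappa>' where k': "\<kappa>' \<in> K" "k z \<in> simplex_pts \<kappa>'" by (auto simp: realization_def)
      have f: "finite \<kappa>'" "\<kappa>' \<noteq> {}" using simplicialD[OF K] k'(1) by auto
      have "k z \<in> simplex_pts (\<kappa>' \<union> \<mu>)" by (rule simplex_pts_mono[OF k'(2)]) (use f km in auto)
      moreover have "G z \<in> simplex_pts (\<kappa>' \<union> \<mu>)" using Gin[OF z _ km(4,7,8,6,10), of \<kappa>'] k' by auto
      moreover have "\<kappa>' \<union> \<mu> \<in> ?X" using k'(1) km(2) f(2) by (auto simp: join_def)
      ultimately show "\<exists>\<sigma>\<in>?X. G z \<in> simplex_pts \<sigma> \<and> k z \<in> simplex_pts \<sigma>" by auto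
    qed
    ultimately have gk: "homo ?S (realization ?X) g k" by (rule homotopic_with_trans)
    obtain a where a: "a \<in> realization K" "homo ?S (realization K) k (\<lambda>_. a)"
      using m_connectedD[OF m i kS] .
    have "homo ?S (realization ?X) k (\<lambda>_. a)" by (rule homotopic_with_subset_right[OF a(2) KX])
    with gk have "homo ?S (realization ?X) g (\<lambda>_. a)" by (rule homotopic_with_trans)
    then show "\<exists>a\<in>realization ?X. homo ?S (realization ?X) g (\<lambda>_. a)" using a(1) KX by auto
  qed
qed

section \<open>Faces of right-angled polytopes\<close>

lemma lor_simps:
  "lor (x + y) z = lor x z + lor y z" "lor x (y + z) = lor x y + lor x z"
  "lor (x - y) z = lor x z - lor y z" "lor x (y - z) = lor x y - lor x z"
  "lor (c *\<^sub>R x) z = c * lor x z" "lor x (c *\<^sub>R z) = c * lor x z"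
  by (auto simp: lor_def algebra_simps inner_simps)

lemma lor_commute: "lor x y = lor y x"
  by (simp add: lor_def inner_commute mult.commute)

lemma lor_0: "lor 0 x = 0" "lor x 0 = 0"
  by (simp_all add: lor_def)

lemma lor_sum: "lor (sum f A) z = (\<Sum>x\<in>A. lor (f x) z)" "lor z (sum f A) = (\<Sum>x\<in>A. lor z (f x))"
proof -
  show "lor (sum f A) z = (\<Sum>x\<in>A. lor (f x) z)"
    by (induction A rule: infinite_finite_induct) (auto simp: lor_simps lor_0)
  show "lor z (sum f A) = (\<Sum>x\<in>A. lor z (f x))"
    by (induction A rule: infinite_finite_induct) (auto simp: lor_simps lor_0)
qed

text \<open>Reversing time in one argument turns the Lorentz form into the inner product, so
  Euclidean results on orthogonal complements apply.\<close>

definition flip_time :: "'a::euclidean_space mink \<Rightarrow> 'a mink" where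
  "flip_time u = (fst u, - snd u)"

lemma lor_inner: "lor x u = x \<bullet> flip_time u"
  by (simp add: lor_def flip_time_def inner_prod_def)

lemma linear_flip_time: "linear flip_time"
  by (auto simp: linear_iff flip_time_def)

lemma inj_flip_time: "inj flip_time"
  by (auto simp: inj_def flip_time_def prod_eq_iff)

lemma continuous_lor: "continuous_on UNIV (\<lambda>t. lor (p + t *\<^sub>R x) v)"
  unfolding lor_simps by (intro continuous_intros)

text \<open>The open future cone, each ray of which meets \<open>hyp_space\<close>. Faces are cut
  out by homogeneous conditions, so points may be added and perturbed in this convex cone and
  rescaled by \<open>normalize_timecone\<close> afterwards.\<close>

definition timecone :: "'a::euclidean_space mink set" where
  "timecone = {p. norm (fst p) < snd p}"

lemma timecone_iff: "p \<in> timecone \<longleftrightarrow> lor p p < 0 \<and> snd p > 0"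
proof -
  have "lor p p = (norm (fst p))\<^sup>2 - (snd p)\<^sup>2" by (simp add: lor_def dot_square_norm power2_eq_square)
  then have "lor p p < 0 \<and> snd p > 0 \<longleftrightarrow> (norm (fst p))\<^sup>2 < (snd p)\<^sup>2 \<and> snd p > 0" by simp
  also have "\<dots> \<longleftrightarrow> norm (fst p) < snd p"
  proof
    assume "(norm (fst p))\<^sup>2 < (snd p)\<^sup>2 \<and> snd p > 0"
    then show "norm (fst p) < snd p" using power2_less_imp_less[of "norm (fst p)" "snd p"] by simp
  next
    assume *: "norm (fst p) < snd p"
    then have "0 < snd p" using norm_ge_zero[of "fst p"] by linarith
    then show "(norm (fst p))\<^sup>2 < (snd p)\<^sup>2 \<and> snd p > 0" using * by (simp add: power_strict_mono)
  qed
  finally show ?thesis by (simp add: timecone_def)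
qed

lemma hyp_space_timecone: "p \<in> hyp_space \<Longrightarrow> p \<in> timecone"
  by (simp add: hyp_space_def timecone_iff)

lemma timecone_scale: "p \<in> timecone \<Longrightarrow> c > 0 \<Longrightarrow> c *\<^sub>R p \<in> timecone"
  by (simp add: timecone_def)

lemma timecone_add: "p \<in> timecone \<Longrightarrow> q \<in> timecone \<Longrightarrow> p + q \<in> timecone"
  unfolding timecone_def using norm_triangle_ineq[of "fst p" "fst q"] by simp

lemma timecone_sum: "finite A \<Longrightarrow> A \<noteq> {} \<Longrightarrow> (\<And>x. x \<in> A \<Longrightarrow> f x \<in> timecone) \<Longrightarrow> sum f A \<in> timecone"
  by (induction A rule: finite_ne_induct) (auto intro: timecone_add)

lemma normalize_timecone:
  assumes "p \<in> timecone"
  obtains c where "c > 0" "c *\<^sub>R p \<in> hyp_space"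
proof
  have l: "lor p p < 0" "snd p > 0" using assms by (auto simp: timecone_iff)
  define s where "s = sqrt (- lor p p)"
  have s: "s > 0" "s\<^sup>2 = - lor p p" using l by (auto simp: s_def)
  show "1 / s > 0" using s by simp
  have "lor ((1/s) *\<^sub>R p) ((1/s) *\<^sub>R p) = lor p p / s\<^sup>2" by (simp add: lor_simps power2_eq_square)
  also have "\<dots> = -1" using s l by simp
  finally show "(1 / s) *\<^sub>R p \<in> hyp_space" using l s by (simp add: hyp_space_def)
qed

text \<open>By Cauchy-Schwarz, orthogonality to a timelike vector makes the time component of
  \<open>x\<close> smaller than its space component.\<close>

lemma spacelike_complement:
  assumes p: "p \<in> timecone" and "lor p x = 0" "x \<noteq> 0"
  shows "lor x x > 0"
proof -
  have eq: "fst p \<bullet> fst x = snd p * snd x" using assms(2) by (simp add: lor_def)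
  have pp: "norm (fst p) < snd p" "snd p > 0" using p timecone_iff[of p] by (auto simp: timecone_def)
  have fx: "fst x \<noteq> 0"
  proof
    assume "fst x = 0"
    then have "snd x = 0" using eq pp by simp
    then show False using \<open>fst x = 0\<close> assms(3) by (simp add: prod_eq_iff)
  qed
  have "snd p * \<bar>snd x\<bar> = \<bar>fst p \<bullet> fst x\<bar>" using eq pp by (simp add: abs_mult)
  also have "\<dots> \<le> norm (fst p) * norm (fst x)" by (rule Cauchy_Schwarz_ineq2)
  also have "\<dots> < snd p * norm (fst x)" using pp fx by (intro mult_strict_right_mono) auto
  finally have "\<bar>snd x\<bar> < norm (fst x)" using pp by simp
  then have "\<bar>snd x\<bar>\<^sup>2 < (norm (fst x))\<^sup>2" by (intro power_strict_mono) auto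
  then show ?thesis by (simp add: lor_def dot_square_norm power2_eq_square)
qed

text \<open>The form is nonnegative on the complement of \<open>p\<close>, in particular at
  \<open>u + v\<close> and \<open>u - v\<close>. This keeps the argument of the arccos in
  \<open>dihedral_angle\<close> between -1 and 1.\<close>

lemma lor_unit_bound:
  assumes p: "p \<in> timecone" "lor p u = 0" "lor p v = 0" and "lor u u = 1" "lor v v = 1"
  shows "\<bar>lor u v\<bar> \<le> 1"
proof -
  have nn: "lor x x \<ge> 0" if "lor p x = 0" for x
    using spacelike_complement[OF p(1) that] by (cases "x = 0") (auto simp: lor_0)
  have "0 \<le> lor (u + v) (u + v)" "0 \<le> lor (u - v) (u - v)"
    by (rule nn, use p in \<open>simp add: lor_simps\<close>)+
  then show ?thesis using assms(4,5) lor_commute[of v u] by (simp add: lor_simps abs_le_iff)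
qed

text \<open>The cone is open, and finitely many strict inequalities survive a small
  displacement.\<close>

lemma small_perturbation:
  assumes V: "finite V" and p: "p \<in> timecone"
  obtains e where "e > 0" "p + e *\<^sub>R x \<in> timecone" "\<And>v. v \<in> V \<Longrightarrow> lor p v < 0 \<Longrightarrow> lor (p + e *\<^sub>R x) v < 0"
proof -
  have "((\<lambda>t. lor (p + t *\<^sub>R x) v) \<longlongrightarrow> lor (p + 0 *\<^sub>R x) v) (at_right 0)" for v
    using continuous_lor[of p x v] by (metis UNIV_I continuous_on_def filterlim_at_split tendsto_within_subset subset_UNIV)
  then have "\<forall>\<^sub>F t in at_right 0. lor (p + t *\<^sub>R x) v < 0" if "lor p v < 0" for v
    using that by (intro order_tendstoD(2)[of _ "lor p v"]) auto
  then have 1: "\<forall>\<^sub>F t in at_right 0. \<forall>v\<in>{v \<in> V. lor p v < 0}. lor (p + t *\<^sub>R x) v < 0"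
    using V by (intro eventually_ball_finite) auto
  have "((\<lambda>t. snd (p + t *\<^sub>R x) - norm (fst (p + t *\<^sub>R x))) \<longlongrightarrow> snd (p + 0 *\<^sub>R x) - norm (fst (p + 0 *\<^sub>R x))) (at_right 0)"
    by (intro tendsto_intros)
  then have 2: "\<forall>\<^sub>F t in at_right 0. 0 < snd (p + t *\<^sub>R x) - norm (fst (p + t *\<^sub>R x))"
    by (rule order_tendstoD(1)) (use p in \<open>simp add: timecone_def\<close>)
  have 3: "\<forall>\<^sub>F t::real in at_right 0. t > 0" by (simp add: eventually_at_right_less)
  have "\<exists>t. (\<forall>v\<in>{v \<in> V. lor p v < 0}. lor (p + t *\<^sub>R x) v < 0) \<and> 0 < snd (p + t *\<^sub>R x) - norm (fst (p + t *\<^sub>R x)) \<and> t > 0"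
    using eventually_happens[OF eventually_conj[OF 1 eventually_conj[OF 2 3]]] by auto
  then show ?thesis using that by (auto simp: timecone_def)
qed

lemma sum_nonpos_eq_0_iff:
  fixes f :: "'a \<Rightarrow> real"
  assumes "finite A" "\<And>x. x \<in> A \<Longrightarrow> f x \<le> 0"
  shows "sum f A = 0 \<longleftrightarrow> (\<forall>x\<in>A. f x = 0)"
  using sum_nonneg_eq_0_iff[of A "\<lambda>x. - f x"] assms by (simp add: sum_negf)

text \<open>A substitute for a relative interior point: the normalised sum of a basis of the span of
  \<open>Q\<close> chosen in \<open>Q\<close>. If a functional that is nonpositive on
  \<open>Q\<close> vanishes at this sum, it vanishes at each basis vector and hence on
  \<open>Q\<close>.\<close>

lemma generic_point:
  assumes Q: "Q \<subseteq> hyp_space" "Q \<noteq> {}"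
  shows "\<exists>z\<in>hyp_space. z \<in> span Q \<and> (\<forall>v. (\<forall>q\<in>Q. lor q v \<le> 0) \<longrightarrow>
     lor z v \<le> 0 \<and> (lor z v = 0 \<longrightarrow> (\<forall>q\<in>Q. lor q v = 0)))"
proof -
  obtain B where B: "B \<subseteq> Q" "independent B" "Q \<subseteq> span B" "card B = dim Q" using basis_exists by blast
  have fin: "finite B" using B(2) by (rule independent_imp_finite)
  have ne: "B \<noteq> {}"
  proof
    assume "B = {}"
    then have "Q \<subseteq> {0}" using B(3) by simp
    moreover have "0 \<notin> Q" using Q(1) by (auto simp: hyp_space_def lor_0)
    ultimately show False using Q(2) by auto
  qed
  have "(\<Sum>b\<in>B. b) \<in> timecone" by (rule timecone_sum[OF fin ne], rule hyp_space_timecone) (use B(1) Q(1) in blast)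
  then obtain c where c: "c > 0" "c *\<^sub>R (\<Sum>b\<in>B. b) \<in> hyp_space" by (rule normalize_timecone)
  have sp: "c *\<^sub>R (\<Sum>b\<in>B. b) \<in> span Q"
    by (intro span_scale span_sum span_base) (use B in auto)
  have z: "lor (c *\<^sub>R (\<Sum>b\<in>B. b)) v = c * (\<Sum>b\<in>B. lor b v)" for v by (simp add: lor_simps lor_sum)
  show ?thesis
  proof (intro bexI[OF _ c(2)] conjI sp allI impI)
    fix v assume v: "\<forall>q\<in>Q. lor q v \<le> 0"
    have le: "lor b v \<le> 0" if "b \<in> B" for b using v that B(1) by (meson subsetD)
    show "lor (c *\<^sub>R (\<Sum>b\<in>B. b)) v \<le> 0"
      unfolding z using c(1) le by (intro mult_nonneg_nonpos sum_nonpos) auto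
    assume "lor (c *\<^sub>R (\<Sum>b\<in>B. b)) v = 0"
    then have "(\<Sum>b\<in>B. lor b v) = 0" using c(1) unfolding z by simp
    then have "\<forall>b\<in>B. lor b v = 0" using sum_nonpos_eq_0_iff[of B "\<lambda>b. lor b v"] fin le by simp
    then have "B \<subseteq> {x. lor x v = 0}" by auto
    moreover have "subspace {x. lor x v = 0}" by (auto simp: subspace_def lor_simps lor_0)
    ultimately have "span B \<subseteq> {x. lor x v = 0}" by (rule span_minimal)
    then show "\<forall>q\<in>Q. lor q v = 0" using B(3) by auto
  qed
qed

text \<open>Orthonormality makes \<open>T\<close> independent, and its Lorentz complement is the
  Euclidean complement of its image under \<open>flip_time\<close>.\<close>

lemma dim_lor_complement:
  fixes T :: "'a::euclidean_space mink set"
  assumes T: "finite T" "\<And>u. u \<in> T \<Longrightarrow> lor u u = 1" "\<And>u v. u \<in> T \<Longrightarrow> v \<in> T \<Longrightarrow> u \<noteq> v \<Longrightarrow> lor u v = 0"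
  shows "dim {x. \<forall>u\<in>T. lor x u = 0} + card T = DIM('a) + 1"
proof -
  have "independent T"
  proof (rule independent_if_scalars_zero[OF T(1)])
    fix f v assume s: "(\<Sum>x\<in>T. f x *\<^sub>R x) = 0" and v: "v \<in> T"
    have "0 = lor (\<Sum>x\<in>T. f x *\<^sub>R x) v" by (simp add: s lor_0)
    also have "\<dots> = (\<Sum>x\<in>T. f x * lor x v)" by (simp add: lor_sum lor_simps)
    also have "\<dots> = (\<Sum>x\<in>T. if x = v then f v else 0)"
      by (rule sum.cong) (use T v in auto)
    also have "\<dots> = f v" using T(1) v by simp
    finally show "f v = 0" by simp
  qed
  then have ind: "independent (flip_time ` T)"
    by (intro linear_independent_injective_image[OF linear_flip_time] inj_on_subset[OF inj_flip_time subset_UNIV])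
  let ?A = "span (flip_time ` T)"
  have "dim {y \<in> UNIV. \<forall>x \<in> ?A. orthogonal x y} + dim ?A = dim (UNIV :: 'a mink set)"
    by (rule dim_subspace_orthogonal_to_vectors) auto
  moreover have "{y \<in> UNIV. \<forall>x \<in> ?A. orthogonal x y} = {x. \<forall>u\<in>T. lor x u = 0}"
  proof (intro equalityI subsetI)
    fix y assume "y \<in> {y \<in> UNIV. \<forall>x \<in> ?A. orthogonal x y}"
    then have "orthogonal (flip_time u) y" if "u \<in> T" for u using that by (auto intro: span_base)
    then show "y \<in> {x. \<forall>u\<in>T. lor x u = 0}" by (auto simp: lor_inner orthogonal_def inner_commute)
  next
    fix y assume "y \<in> {x. \<forall>u\<in>T. lor x u = 0}"
    then have "orthogonal y (flip_time u)" if "u \<in> T" for u using that by (auto simp: lor_inner orthogonal_def)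
    then have "orthogonal y x" if "x \<in> ?A" for x
      by (intro orthogonal_to_span[OF that]) blast
    then have "orthogonal x y" if "x \<in> ?A" for x using that by (simp add: orthogonal_commute)
    then show "y \<in> {y \<in> UNIV. \<forall>x \<in> ?A. orthogonal x y}" by auto
  qed
  moreover have "dim ?A = card T"
    using ind card_image[OF inj_on_subset[OF inj_flip_time]] by (simp add: dim_eq_card_independent)
  ultimately show ?thesis by simp
qed

text \<open>The point \<open>p\<close> is strictly inside the walls of \<open>W\<close> outside
  \<open>T\<close>, so it can be moved a little in any direction orthogonal to \<open>T\<close>
  without leaving the face, up to rescaling; the differences fill the complement.\<close>

lemma span_cut:
  assumes W: "finite W" and p: "p \<in> hyp_space" "\<And>u. u \<in> T \<Longrightarrow> lor p u = 0" "\<And>u. u \<in> W - T \<Longrightarrow> lor p u < 0"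
  shows "span {q \<in> hyp_space. (\<forall>u\<in>W. lor q u \<le> 0) \<and> (\<forall>u\<in>T. lor q u = 0)} = {x. \<forall>u\<in>T. lor x u = 0}"
    (is "span ?Q = ?N")
proof
  have "subspace ?N" by (auto simp: subspace_def lor_simps lor_0)
  then show "span ?Q \<subseteq> ?N" by (intro span_minimal) auto
  show "?N \<subseteq> span ?Q"
  proof
    fix x assume x: "x \<in> ?N"
    obtain e where e: "e > 0" "p + e *\<^sub>R x \<in> timecone" "\<And>v. v \<in> W \<Longrightarrow> lor p v < 0 \<Longrightarrow> lor (p + e *\<^sub>R x) v < 0"
      using small_perturbation[OF W hyp_space_timecone[OF p(1)]] by blast
    obtain c where c: "c > 0" "c *\<^sub>R (p + e *\<^sub>R x) \<in> hyp_space" using normalize_timecone[OF e(2)] .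
    have T0: "lor (p + e *\<^sub>R x) u = 0" if "u \<in> T" for u using x p(2) that by (simp add: lor_simps)
    have "lor (p + e *\<^sub>R x) u \<le> 0" if "u \<in> W" for u
      using T0[of u] e(3)[OF that] p(3)[of u] that by (cases "u \<in> T") auto
    then have "c *\<^sub>R (p + e *\<^sub>R x) \<in> ?Q" using c T0 by (auto simp: lor_simps(5) mult_nonneg_nonpos)
    moreover have "p \<in> ?Q" using p by force
    ultimately have "(1 / e) *\<^sub>R ((1 / c) *\<^sub>R (c *\<^sub>R (p + e *\<^sub>R x)) - p) \<in> span ?Q"
      by (intro span_scale span_diff span_base)
    moreover have "(1 / e) *\<^sub>R ((1 / c) *\<^sub>R (c *\<^sub>R (p + e *\<^sub>R x)) - p) = x" using c e by simp
    ultimately show "x \<in> span ?Q" by simp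
  qed
qed

text \<open>\<open>W\<close> is a defining set of unit normals of least cardinality. As
  \<open>P\<close> spans the whole space, its generic point \<open>z\<close> is strictly inside
  every wall. Dropping \<open>w\<close> admits a point that violates only \<open>w\<close>, and
  between \<open>z\<close> and this point the wall of \<open>w\<close> is crossed strictly inside
  all others.\<close>

lemma irredundant_normals:
  fixes P :: "'a::euclidean_space mink set"
  assumes "hyp_polytope P"
  obtains W z where "finite W" "\<And>w. w \<in> W \<Longrightarrow> lor w w = 1" "P = {p \<in> hyp_space. \<forall>w\<in>W. lor p w \<le> 0}"
    "z \<in> hyp_space" "\<And>w. w \<in> W \<Longrightarrow> lor z w < 0"
    "\<And>w. w \<in> W \<Longrightarrow> \<exists>y\<in>hyp_space. lor y w = 0 \<and> (\<forall>w'\<in>W - {w}. lor y w' < 0)"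
proof -
  define H where "H W = {p \<in> hyp_space. \<forall>w\<in>W. lor p w \<le> 0}" for W :: "'a mink set"
  obtain U where U: "finite U" "\<forall>u\<in>U. spacelike u" "P = hyp_space \<inter> (\<Inter>u\<in>U. half_space u)"
    and dimP: "dim P = DIM('a) + 1" using assms by (auto simp: hyp_polytope_def)
  define nrm where "nrm u = (1 / sqrt (lor u u)) *\<^sub>R u" for u :: "'a mink"
  have nrm1: "lor (nrm u) (nrm u) = 1" if "u \<in> U" for u
    using U(2) that by (auto simp: nrm_def lor_simps spacelike_def)
  have nrm2: "lor p (nrm u) \<le> 0 \<longleftrightarrow> lor p u \<le> 0" if "u \<in> U" for u p
    using U(2) that by (auto simp: nrm_def lor_simps spacelike_def divide_le_0_iff)
  have HU: "H (nrm ` U) = P" using nrm2 unfolding H_def U(3) half_space_def by auto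
  \<comment> \<open>A local name, unrelated to good faces: the sets of normals that still define
    \<open>P\<close>.\<close>
  define good where "good W \<longleftrightarrow> W \<subseteq> nrm ` U \<and> H W = P" for W
  have "good (nrm ` U)" using HU by (simp add: good_def)
  then obtain W where W: "good W" and Wmin: "\<And>W'. good W' \<Longrightarrow> card W \<le> card W'"
    using ex_has_least_nat[of good _ card] by blast
  have fin: "finite W" using W U(1) by (auto simp: good_def intro: finite_subset)
  have W1: "lor w w = 1" if "w \<in> W" for w using W nrm1 that by (auto simp: good_def)
  have PH: "P = H W" using W by (simp add: good_def)
  have Psub: "P \<subseteq> hyp_space" unfolding PH by (auto simp: H_def)
  have "P \<noteq> {}" using dimP by (auto simp: dim_eq_0[of "{}::'a mink set"])
  obtain z where z: "z \<in> hyp_space" "z \<in> span P" "\<forall>v. (\<forall>q\<in>P. lor q v \<le> 0) \<longrightarrow>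
     lor z v \<le> 0 \<and> (lor z v = 0 \<longrightarrow> (\<forall>q\<in>P. lor q v = 0))"
    using generic_point[OF Psub \<open>P \<noteq> {}\<close>] by (elim bexE conjE) (rule that)
  have z3: "lor z v \<le> 0" and z4: "lor z v = 0 \<Longrightarrow> \<forall>q\<in>P. lor q v = 0"
    if "\<And>q. q \<in> P \<Longrightarrow> lor q v \<le> 0" for v
  proof -
    have "\<forall>q\<in>P. lor q v \<le> 0" using that by (rule ballI)
    from mp[OF spec[OF z(3), of v] this] show "lor z v \<le> 0" "lor z v = 0 \<Longrightarrow> \<forall>q\<in>P. lor q v = 0" by simp_all
  qed
  have zneg: "lor z w < 0" if w: "w \<in> W" for w
  proof -
    have le: "lor q w \<le> 0" if "q \<in> P" for q using that w by (auto simp: PH H_def)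
    have "lor z w \<noteq> 0"
    proof
      assume "lor z w = 0"
      then have "P \<subseteq> {x. lor x w = 0}" using z4[OF le] by auto
      moreover have "subspace {x. lor x w = 0}" by (auto simp: subspace_def lor_simps lor_0)
      ultimately have "span P \<subseteq> {x. lor x w = 0}" by (rule span_minimal)
      moreover have "span P = UNIV" using dimP by (simp add: dim_eq_full[symmetric])
      ultimately have "w \<in> {x. lor x w = 0}" by auto
      then show False using W1[OF w] by simp
    qed
    then show ?thesis using z3[OF le] by auto
  qed
  have y: "\<exists>y\<in>hyp_space. lor y w = 0 \<and> (\<forall>w'\<in>W - {w}. lor y w' < 0)" if w: "w \<in> W" for w
  proof -
    have "card (W - {w}) < card W" using fin w by (intro psubset_card_mono) auto
    then have "\<not> good (W - {w})" using Wmin by (meson not_le)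
    then have "H (W - {w}) \<noteq> H W" using W by (auto simp: good_def)
    moreover have "H W \<subseteq> H (W - {w})" by (auto simp: H_def)
    ultimately obtain x where x: "x \<in> H (W - {w})" "x \<notin> H W" by auto
    have xw: "lor x w > 0" "\<And>w'. w' \<in> W - {w} \<Longrightarrow> lor x w' \<le> 0" "x \<in> hyp_space"
      using x by (auto simp: H_def)
    \<comment> \<open>The coefficients are positive and chosen so that the two products with
      \<open>w\<close> cancel.\<close>
    define y where "y = lor x w *\<^sub>R z + (- lor z w) *\<^sub>R x"
    have "y \<in> timecone"
      unfolding y_def using xw z(1) zneg[OF w] by (intro timecone_add timecone_scale hyp_space_timecone) auto
    then obtain c where c: "c > 0" "c *\<^sub>R y \<in> hyp_space" by (rule normalize_timecone)
    have "lor y w = 0" by (simp add: y_def lor_simps)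
    moreover have "lor y w' < 0" if "w' \<in> W - {w}" for w'
    proof -
      have "lor x w * lor z w' < 0" using xw(1) zneg[of w'] that by (simp add: mult_pos_neg)
      moreover have "(- lor z w) * lor x w' \<le> 0" using zneg[OF w] xw(2)[OF that] by (intro mult_nonneg_nonpos) auto
      ultimately show ?thesis unfolding y_def lor_simps by linarith
    qed
    ultimately show ?thesis using c by (intro bexI[of _ "c *\<^sub>R y"]) (auto simp: lor_simps(5) mult_pos_neg)
  qed
  show ?thesis by (rule that[OF fin W1 _ z(1) zneg y]) (auto simp: PH H_def)
qed

text \<open>The facet spans the complement of \<open>w\<close>, so another candidate
  \<open>u\<close> vanishes there too. The part of \<open>u\<close> orthogonal to \<open>w\<close>
  is then isotropic and orthogonal to the timelike \<open>y\<close>, hence zero. Unit length and the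
  interior point \<open>z\<close> fix the remaining factor to 1.\<close>

lemma outward_normal_unique:
  fixes W :: "'a::euclidean_space mink set"
  assumes W: "finite W" "w \<in> W" "\<And>w. w \<in> W \<Longrightarrow> lor w w = 1"
    and P: "P = {p \<in> hyp_space. \<forall>w\<in>W. lor p w \<le> 0}"
    and z: "z \<in> hyp_space" "\<And>w. w \<in> W \<Longrightarrow> lor z w < 0"
    and y: "y \<in> hyp_space" "lor y w = 0" "\<And>w'. w' \<in> W - {w} \<Longrightarrow> lor y w' < 0"
  shows "outward_normal P (P \<inter> wall w) = w"
  unfolding outward_normal_def
proof (rule the_equality)
  show "lor w w = 1 \<and> P \<subseteq> half_space w \<and> P \<inter> wall w = P \<inter> wall w"
    using W P by (auto simp: half_space_def)
  fix u assume u: "lor u u = 1 \<and> P \<subseteq> half_space u \<and> P \<inter> wall w = P \<inter> wall u"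
  have "P \<inter> wall w = {q \<in> hyp_space. (\<forall>u\<in>W. lor q u \<le> 0) \<and> (\<forall>u\<in>{w}. lor q u = 0)}"
    by (auto simp: P wall_def)
  then have sp: "span (P \<inter> wall w) = {x. \<forall>u\<in>{w}. lor x u = 0}"
    using span_cut[OF W(1) y(1), of "{w}"] y by simp
  have "P \<inter> wall w \<subseteq> {x. lor x u = 0}" using u by (auto simp: wall_def)
  moreover have "subspace {x. lor x u = 0}" by (auto simp: subspace_def lor_simps lor_0)
  ultimately have "span (P \<inter> wall w) \<subseteq> {x. lor x u = 0}" by (rule span_minimal)
  then have wu: "lor x u = 0" if "lor x w = 0" for x using sp that by auto
  define c where "c = lor u w"
  define r where "r = u - c *\<^sub>R w"
  have rw: "lor r w = 0" using W(2,3) by (simp add: r_def lor_simps c_def)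
  then have "lor r u = 0" by (rule wu)
  then have rr: "lor r r = 0" using rw by (metis (no_types) r_def lor_simps(4,6) mult_zero_right diff_zero)
  have "lor y r = 0" using wu[OF y(2)] y(2) by (simp add: r_def lor_simps)
  then have "r = 0" using spacelike_complement[OF hyp_space_timecone[OF y(1)]] rr by (metis less_irrefl)
  then have uc: "u = c *\<^sub>R w" by (simp add: r_def)
  then have "c\<^sup>2 = 1" using u W(2,3) by (simp add: lor_simps power2_eq_square)
  moreover have "c > 0"
  proof -
    have "z \<in> P" using z P by (auto simp: less_imp_le)
    then have "lor z u \<le> 0" using u by (auto simp: half_space_def)
    then have "c * lor z w \<le> 0" by (simp add: uc lor_simps)
    then have "c \<ge> 0" using z(2)[OF W(2)] by (simp add: mult_le_0_iff)
    moreover have "c \<noteq> 0" using \<open>c\<^sup>2 = 1\<close> by auto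
    ultimately show ?thesis by simp
  qed
  ultimately have "c = 1" by (simp add: power2_eq_1_iff)
  then show "u = w" using uc by simp
qed

lemma hface_wallI:
  assumes "spacelike u" "R \<subseteq> half_space u" "R \<inter> wall u \<noteq> {}"
  shows "hface (R \<inter> wall u) R"
  unfolding hface_def using assms by blast

text \<open>Right angles in terms of an irredundant system of unit normals: two walls through a
  common point of \<open>P\<close> have orthogonal normals, and by \<open>facet_pt\<close> every
  wall carries a facet. In this form the faces can be read off from the subsets of
  \<open>W\<close>.\<close>

locale right_angled_cone =
  fixes P :: "'a::euclidean_space mink set" and W :: "'a mink set"
  assumes finW: "finite W" and W1: "\<And>w. w \<in> W \<Longrightarrow> lor w w = 1"
    and mem_P: "\<And>p. p \<in> P \<longleftrightarrow> p \<in> hyp_space \<and> (\<forall>w\<in>W. lor p w \<le> 0)"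
    and P_ne: "P \<noteq> {}"
    and facet_pt: "\<And>w. w \<in> W \<Longrightarrow> \<exists>y\<in>hyp_space. lor y w = 0 \<and> (\<forall>w'\<in>W - {w}. lor y w' < 0)"
    and orth: "\<And>p w w'. p \<in> P \<Longrightarrow> w \<in> W \<Longrightarrow> w' \<in> W \<Longrightarrow> w \<noteq> w' \<Longrightarrow> lor p w = 0 \<Longrightarrow> lor p w' = 0 \<Longrightarrow> lor w w' = 0"
begin

definition cut :: "'a mink set \<Rightarrow> 'a mink set" where
  "cut T = {p \<in> P. \<forall>w\<in>T. lor p w = 0}"

lemma cut_hyp: "cut T \<subseteq> hyp_space" by (auto simp: cut_def mem_P)

lemma cut_le: "p \<in> cut T \<Longrightarrow> w \<in> W \<Longrightarrow> lor p w \<le> 0" by (auto simp: cut_def mem_P)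

text \<open>Orthogonality enters here: subtracting the normals of the extra walls through
  \<open>p\<close> moves strictly off these walls while staying on those of \<open>T\<close>. So a
  nonempty intersection of walls is contained in no further wall, as in a simple polytope.\<close>

lemma cut_generic:
  assumes T: "T \<subseteq> W" "cut T \<noteq> {}"
  obtains q where "q \<in> cut T" "\<And>w. w \<in> W - T \<Longrightarrow> lor q w < 0"
proof -
  obtain p where p: "p \<in> cut T" using T by auto
  then have pP: "p \<in> P" "p \<in> hyp_space" by (auto simp: cut_def mem_P)
  define T' where "T' = {w \<in> W. lor p w = 0}"
  define x where "x = - (\<Sum>w\<in>T' - T. w)"
  have TT: "T \<subseteq> T'" using p T by (auto simp: T'_def cut_def)
  have finT': "finite T'" using finW by (simp add: T'_def)
  have lx: "lor x v = (if v \<in> T then 0 else -1)" if v: "v \<in> T'" for v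
  proof -
    have "lor x v = - (\<Sum>w\<in>T' - T. lor w v)"
      using lor_sum(1)[of "\<lambda>w. w" "T' - T" v] lor_simps(3)[of 0 _ v] by (simp add: x_def lor_0)
    also have "(\<Sum>w\<in>T' - T. lor w v) = (\<Sum>w\<in>T' - T. if w = v then 1 else 0)"
    proof (rule sum.cong[OF refl])
      fix w assume "w \<in> T' - T"
      then show "lor w v = (if w = v then 1 else 0)"
        using orth[OF pP(1), of w v] W1[of v] v by (auto simp: T'_def)
    qed
    also have "\<dots> = (if v \<in> T then 0 else 1)" using finT' v by simp
    finally show ?thesis by simp
  qed
  obtain e where e: "e > 0" "p + e *\<^sub>R x \<in> timecone" "\<And>v. v \<in> W \<Longrightarrow> lor p v < 0 \<Longrightarrow> lor (p + e *\<^sub>R x) v < 0"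
    using small_perturbation[OF finW hyp_space_timecone[OF pP(2)]] by blast
  have neg: "lor (p + e *\<^sub>R x) w < 0" if "w \<in> W - T" for w
  proof (cases "w \<in> T'")
    case True
    then show ?thesis using lx[OF True] e(1) that by (simp add: lor_simps T'_def)
  next
    case False
    then have "lor p w < 0" using cut_le[OF p, of w] that by (auto simp: T'_def)
    then show ?thesis using e(3) that by auto
  qed
  have zero: "lor (p + e *\<^sub>R x) w = 0" if "w \<in> T" for w
    using lx[of w] TT that by (auto simp: lor_simps T'_def)
  obtain c where c: "c > 0" "c *\<^sub>R (p + e *\<^sub>R x) \<in> hyp_space" using normalize_timecone[OF e(2)] .
  show ?thesis
  proof (rule that)
    have "lor (p + e *\<^sub>R x) w \<le> 0" if "w \<in> W" for w using neg[of w] zero[of w] that by (cases "w \<in> T") auto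
    then show "c *\<^sub>R (p + e *\<^sub>R x) \<in> cut T"
      using c zero by (auto simp: cut_def mem_P lor_simps(5) mult_nonneg_nonpos)
    show "lor (c *\<^sub>R (p + e *\<^sub>R x)) w < 0" if "w \<in> W - T" for w
      using neg[OF that] c(1) by (simp add: lor_simps(5) mult_pos_neg)
  qed
qed

lemma span_cut_eq:
  assumes T: "T \<subseteq> W" "cut T \<noteq> {}"
  shows "span (cut T) = {x. \<forall>u\<in>T. lor x u = 0}"
proof -
  obtain q where q: "q \<in> cut T" "\<And>w. w \<in> W - T \<Longrightarrow> lor q w < 0" by (rule cut_generic[OF T]) blast
  have "cut T = {q \<in> hyp_space. (\<forall>u\<in>W. lor q u \<le> 0) \<and> (\<forall>u\<in>T. lor q u = 0)}"
    by (auto simp: cut_def mem_P)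
  then show ?thesis using span_cut[OF finW, of q T] q by (auto simp: cut_def mem_P)
qed

lemma dim_cut:
  assumes T: "T \<subseteq> W" "cut T \<noteq> {}"
  shows "dim (cut T) + card T = DIM('a) + 1"
proof -
  obtain q where q: "q \<in> cut T" using T by auto
  have "dim (cut T) = dim {x. \<forall>u\<in>T. lor x u = 0}"
    using span_cut_eq[OF T] dim_span[of "cut T"] by simp
  moreover have "dim {x. \<forall>u\<in>T. lor x u = 0} + card T = DIM('a) + 1"
  proof (rule dim_lor_complement)
    show "finite T" using T(1) finW by (rule finite_subset)
    show "lor u v = 0" if "u \<in> T" "v \<in> T" "u \<noteq> v" for u v
      using q that T(1) by (intro orth[of q u v]) (auto simp: cut_def)
  qed (use T W1 in auto)
  ultimately show ?thesis by simp
qed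

lemma cut_subset_wall:
  assumes T: "T \<subseteq> W" "cut T \<noteq> {}" and w: "w \<in> W"
  shows "cut T \<subseteq> wall w \<longleftrightarrow> w \<in> T"
proof
  assume sub: "cut T \<subseteq> wall w"
  obtain q where "q \<in> cut T" "\<And>w. w \<in> W - T \<Longrightarrow> lor q w < 0" using cut_generic[OF T] by blast
  then show "w \<in> T" using sub w by (fastforce simp: wall_def)
qed (auto simp: cut_def wall_def mem_P)

lemma cut_insert: "cut T \<inter> wall w = cut (insert w T)"
  by (auto simp: cut_def wall_def mem_P)

text \<open>Here \<open>z\<close> acts as a relative interior point: moving slightly from
  \<open>z\<close> away from \<open>x\<close> stays in the cut, up to rescaling. A functional that
  is nonpositive on the cut and vanishes at \<open>z\<close> therefore cannot be negative at
  \<open>x\<close>.\<close>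

lemma cut_perturb:
  assumes z: "z \<in> hyp_space" "\<And>w. w \<in> T \<Longrightarrow> lor z w = 0" "\<And>w. w \<in> W - T \<Longrightarrow> lor z w < 0"
    and u: "cut T \<subseteq> half_space u" "lor z u = 0"
  shows "cut T \<subseteq> wall u"
proof
  fix x assume x: "x \<in> cut T"
  obtain e where e: "e > 0" "z + e *\<^sub>R (- x) \<in> timecone" "\<And>v. v \<in> W \<Longrightarrow> lor z v < 0 \<Longrightarrow> lor (z + e *\<^sub>R (- x)) v < 0"
    using small_perturbation[OF finW hyp_space_timecone[OF z(1)]] by blast
  have mx: "lor (- x) v = - lor x v" for v using lor_simps(3)[of 0 x v] by (simp add: lor_0)
  obtain c where c: "c > 0" "c *\<^sub>R (z + e *\<^sub>R (- x)) \<in> hyp_space" using normalize_timecone[OF e(2)] .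
  have zero: "lor (z + e *\<^sub>R (- x)) w = 0" if "w \<in> T" for w
    using x z(2) that by (simp add: lor_simps mx cut_def)
  have "lor (z + e *\<^sub>R (- x)) w \<le> 0" if "w \<in> W" for w
    using e(3)[OF that] z(3)[of w] zero[of w] that by (cases "w \<in> T") auto
  then have "c *\<^sub>R (z + e *\<^sub>R (- x)) \<in> cut T"
    using c zero by (auto simp: cut_def mem_P lor_simps(5) mult_nonneg_nonpos)
  then have "lor (c *\<^sub>R (z + e *\<^sub>R (- x))) u \<le> 0" using u(1) by (auto simp: half_space_def)
  then have "c * (e * lor x u) \<ge> 0" using u(2) by (simp add: lor_simps mx)
  then have "lor x u \<ge> 0" using c(1) e(1) by (simp add: zero_le_mult_iff)
  moreover have "lor x u \<le> 0" "x \<in> hyp_space" using x u(1) cut_hyp by (auto simp: half_space_def)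
  ultimately show "x \<in> wall u" by (simp add: wall_def)
qed

text \<open>The sum of the normals in \<open>T\<close> supports exactly this face; it is spacelike
  because orthonormality gives it square \<open>card T\<close>. The empty \<open>T\<close> stands
  for \<open>P\<close> itself.\<close>

lemma hface_cut:
  assumes T: "T \<subseteq> W" "cut T \<noteq> {}"
  shows "hface (cut T) P"
proof (cases "T = {}")
  case True
  then show ?thesis by (simp add: hface_def cut_def)
next
  case False
  obtain q where q: "q \<in> cut T" using T by auto
  have fin: "finite T" using T(1) finW by (rule finite_subset)
  define u where "u = (\<Sum>w\<in>T. w)"
  have lu: "lor p u = (\<Sum>w\<in>T. lor p w)" for p by (simp add: u_def lor_sum)
  have "lor w u = 1" if w: "w \<in> T" for w
  proof -
    have "lor w v = (if v = w then 1 else 0)" if v: "v \<in> T" for v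
      using orth[of q w v] W1[of w] q w v T(1) by (auto simp: cut_def)
    then have "lor w u = (\<Sum>v\<in>T. if v = w then 1 else 0)" unfolding lu by (rule sum.cong[OF refl])
    then show ?thesis using fin w by simp
  qed
  then have "lor u u = card T" using lor_sum(1)[of "\<lambda>w. w" T u] by (simp add: u_def[symmetric])
  then have sp: "spacelike u" using False fin by (simp add: spacelike_def card_gt_0_iff)
  have le: "lor p w \<le> 0" if "p \<in> P" "w \<in> T" for p w using that T(1) by (auto simp: mem_P)
  have "P \<subseteq> half_space u" using le unfolding half_space_def lu by (auto simp: mem_P intro!: sum_nonpos)
  moreover have "cut T = P \<inter> wall u"
  proof -
    have "lor p u = 0 \<longleftrightarrow> (\<forall>w\<in>T. lor p w = 0)" if "p \<in> P" for p
      unfolding lu by (rule sum_nonpos_eq_0_iff[OF fin]) (rule le[OF that])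
    then show ?thesis by (auto simp: cut_def wall_def mem_P)
  qed
  ultimately show ?thesis using hface_wallI[OF sp, of P] T(2) by simp
qed

text \<open>Take for \<open>T\<close> all walls that contain \<open>Q\<close>. A generic point of
  \<open>Q\<close> is strictly inside the other walls, so \<open>cut_perturb\<close> puts the whole
  of \<open>cut T\<close> on the supporting wall of \<open>Q\<close>.\<close>

lemma hface_is_cut:
  assumes "hface Q P"
  obtains T where "T \<subseteq> W" "Q = cut T" "cut T \<noteq> {}"
proof (cases "Q = P")
  case True
  then show ?thesis using that[of "{}"] P_ne by (auto simp: cut_def)
next
  case False
  then obtain u where u: "spacelike u" "P \<subseteq> half_space u" "Q = P \<inter> wall u" "Q \<noteq> {}" using assms by (auto simp: hface_def)
  have Qh: "Q \<subseteq> hyp_space" using u(3) by (auto simp: mem_P)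
  obtain z where z: "z \<in> hyp_space" "z \<in> span Q" "\<forall>v. (\<forall>q\<in>Q. lor q v \<le> 0) \<longrightarrow>
     lor z v \<le> 0 \<and> (lor z v = 0 \<longrightarrow> (\<forall>q\<in>Q. lor q v = 0))"
    using generic_point[OF Qh u(4)] by (elim bexE conjE) (rule that)
  have z3: "lor z v \<le> 0" and z4: "lor z v = 0 \<Longrightarrow> \<forall>q\<in>Q. lor q v = 0"
    if "\<And>q. q \<in> Q \<Longrightarrow> lor q v \<le> 0" for v
  proof -
    have "\<forall>q\<in>Q. lor q v \<le> 0" using that by (rule ballI)
    from mp[OF spec[OF z(3), of v] this] show "lor z v \<le> 0" "lor z v = 0 \<Longrightarrow> \<forall>q\<in>Q. lor q v = 0" by simp_all
  qed
  define T where "T = {w \<in> W. Q \<subseteq> wall w}"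
  have QT: "Q \<subseteq> cut T" using u(3) by (auto simp: cut_def T_def wall_def)
  have z0: "lor z v = 0" if "\<And>q. q \<in> Q \<Longrightarrow> lor q v = 0" for v
  proof -
    have "Q \<subseteq> {x. lor x v = 0}" using that by auto
    moreover have "subspace {x. lor x v = 0}" by (auto simp: subspace_def lor_simps lor_0)
    ultimately show ?thesis using span_minimal[of _ "{x. lor x v = 0}"] z(2) by auto
  qed
  have "cut T \<subseteq> wall u"
  proof (rule cut_perturb[OF z(1)])
    show "lor z w = 0" if "w \<in> T" for w using that by (intro z0) (auto simp: T_def wall_def)
    show "lor z w < 0" if w: "w \<in> W - T" for w
    proof -
      have le: "lor q w \<le> 0" if "q \<in> Q" for q using that w u(3) by (auto simp: mem_P)
      have "lor z w \<noteq> 0"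
      proof
        assume "lor z w = 0"
        then have "Q \<subseteq> wall w" using z4[OF le] Qh by (auto simp: wall_def)
        then show False using w by (auto simp: T_def)
      qed
      then show ?thesis using z3[OF le] by auto
    qed
    show "cut T \<subseteq> half_space u" using u(2) by (auto simp: cut_def)
    show "lor z u = 0" using u(3) by (intro z0) (auto simp: wall_def)
  qed
  then have "Q = cut T" using QT u(3) by (auto simp: cut_def)
  then show ?thesis by (intro that[of T]) (use u(4) in \<open>auto simp: T_def\<close>)
qed

text \<open>A generic point of a facet lies on some wall outside \<open>T\<close>, since otherwise
  \<open>cut_perturb\<close> would make the facet all of \<open>cut T\<close>. Cutting with that
  wall also lowers the dimension by one, so the facet and the cut have the same span and
  agree.\<close>

lemma hfacets_cut:
  assumes T: "T \<subseteq> W" "cut T \<noteq> {}"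
  shows "hfacets (cut T) = {cut (insert w T) |w. w \<in> W - T \<and> cut (insert w T) \<noteq> {}}"
proof (intro equalityI subsetI)
  fix G assume "G \<in> {cut (insert w T) |w. w \<in> W - T \<and> cut (insert w T) \<noteq> {}}"
  then obtain w where w: "w \<in> W - T" "G = cut (insert w T)" "G \<noteq> {}" by auto
  have fin: "finite T" using T(1) finW by (rule finite_subset)
  have "dim (cut (insert w T)) + card (insert w T) = DIM('a) + 1" by (rule dim_cut) (use w T in auto)
  then have "dim G + 1 = dim (cut T)" using dim_cut[OF T] w fin by simp
  moreover have "hface G (cut T)"
  proof -
    have "spacelike w" using W1 w by (auto simp: spacelike_def)
    moreover have "cut T \<subseteq> half_space w" using w by (auto simp: half_space_def cut_def mem_P)
    ultimately show ?thesis using hface_wallI[of w "cut T"] w(2,3) cut_insert[of T w] by simp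
  qed
  ultimately show "G \<in> hfacets (cut T)" by (simp add: hfacets_def)
next
  fix G assume "G \<in> hfacets (cut T)"
  then have G: "hface G (cut T)" "dim G + 1 = dim (cut T)" by (auto simp: hfacets_def)
  then have "G \<noteq> cut T" by auto
  then obtain u where u: "cut T \<subseteq> half_space u" "G = cut T \<inter> wall u" "G \<noteq> {}" using G(1) by (auto simp: hface_def)
  have Gh: "G \<subseteq> hyp_space" using u(2) cut_hyp by auto
  obtain z where z: "z \<in> hyp_space" "z \<in> span G" "\<forall>v. (\<forall>q\<in>G. lor q v \<le> 0) \<longrightarrow>
     lor z v \<le> 0 \<and> (lor z v = 0 \<longrightarrow> (\<forall>q\<in>G. lor q v = 0))"
    using generic_point[OF Gh u(3)] by (elim bexE conjE) (rule that)
  have z3: "lor z v \<le> 0" and z4: "lor z v = 0 \<Longrightarrow> \<forall>q\<in>G. lor q v = 0"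
    if "\<And>q. q \<in> G \<Longrightarrow> lor q v \<le> 0" for v
  proof -
    have "\<forall>q\<in>G. lor q v \<le> 0" using that by (rule ballI)
    from mp[OF spec[OF z(3), of v] this] show "lor z v \<le> 0" "lor z v = 0 \<Longrightarrow> \<forall>q\<in>G. lor q v = 0" by simp_all
  qed
  have z0: "lor z v = 0" if "\<And>q. q \<in> G \<Longrightarrow> lor q v = 0" for v
  proof -
    have "G \<subseteq> {x. lor x v = 0}" using that by auto
    moreover have "subspace {x. lor x v = 0}" by (auto simp: subspace_def lor_simps lor_0)
    ultimately show ?thesis using span_minimal[of _ "{x. lor x v = 0}"] z(2) by auto
  qed
  have "\<exists>w\<in>W - T. lor z w = 0"
  proof (rule ccontr)
    assume no: "\<not> ?thesis"
    have "cut T \<subseteq> wall u"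
    proof (rule cut_perturb[OF z(1) _ _ u(1)])
      show "lor z w = 0" if "w \<in> T" for w using that u(2) by (intro z0) (auto simp: cut_def)
      show "lor z w < 0" if w: "w \<in> W - T" for w
      proof -
        have "lor q w \<le> 0" if "q \<in> G" for q using that u(2) cut_le[of q T w] w by simp
        then have "lor z w \<le> 0" by (rule z3)
        then show ?thesis using no w by (simp add: less_le)
      qed
      show "lor z u = 0" using u(2) by (intro z0) (auto simp: wall_def)
    qed
    then show False using u(2) \<open>G \<noteq> cut T\<close> by auto
  qed
  then obtain w where w: "w \<in> W - T" "lor z w = 0" by auto
  have "lor q w \<le> 0" if "q \<in> G" for q using that u(2) cut_le[of q T w] w by simp
  then have "\<forall>q\<in>G. lor q w = 0" by (rule z4[OF _ w(2)])
  then have Gsub: "G \<subseteq> cut (insert w T)" using u(2) by (auto simp: cut_def)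
  then have ne: "cut (insert w T) \<noteq> {}" using u(3) by auto
  have fin: "finite T" using T(1) finW by (rule finite_subset)
  have "dim (cut (insert w T)) + card (insert w T) = DIM('a) + 1" by (rule dim_cut) (use w T ne in auto)
  then have "dim G = dim (cut (insert w T))" using dim_cut[OF T] w fin G(2) by simp
  then have "span G = span (cut (insert w T))"
    using dim_eq_span[OF Gsub] by simp
  moreover have "span G \<subseteq> {x. lor x u = 0}"
    by (rule span_minimal) (use u(2) in \<open>auto simp: wall_def subspace_def lor_simps lor_0\<close>)
  ultimately have "cut (insert w T) \<subseteq> {x. lor x u = 0}" using span_superset by blast
  then have "cut (insert w T) \<subseteq> G" using u(2) cut_hyp[of "insert w T"] by (auto simp: wall_def cut_def)
  then have "G = cut (insert w T)" using Gsub by auto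
  then show "G \<in> {cut (insert w T) |w. w \<in> W - T \<and> cut (insert w T) \<noteq> {}}" using w(1) ne by blast
qed

lemma cut_empty: "cut {} = P"
  by (simp add: cut_def)

lemma cut_singleton_ne: "w \<in> W \<Longrightarrow> cut {w} \<noteq> {}"
proof -
  assume w: "w \<in> W"
  obtain y where y: "y \<in> hyp_space" "lor y w = 0" "\<forall>w'\<in>W - {w}. lor y w' < 0" using facet_pt[OF w] by auto
  have "lor y w' \<le> 0" if "w' \<in> W" for w' using y that by (cases "w' = w") (auto simp: less_imp_le)
  then have "y \<in> cut {w}" using y by (simp add: cut_def mem_P)
  then show ?thesis by auto
qed

lemma hfacets_P: "hfacets P = (\<lambda>w. cut {w}) ` W"
  using hfacets_cut[of "{}"] P_ne cut_singleton_ne by (auto simp: cut_empty)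

lemma cut_subset_facet:
  assumes "T \<subseteq> W" "cut T \<noteq> {}" "w \<in> W"
  shows "cut T \<subseteq> cut {w} \<longleftrightarrow> w \<in> T"
proof -
  have "cut T \<subseteq> cut {w} \<longleftrightarrow> cut T \<subseteq> wall w" using cut_insert[of "{}" w] by (auto simp: cut_empty cut_def)
  then show ?thesis using cut_subset_wall[OF assms] by simp
qed

lemma defining_facets_cut:
  assumes "T \<subseteq> W" "cut T \<noteq> {}"
  shows "defining_facets P (cut T) = (\<lambda>w. cut {w}) ` T"
  unfolding defining_facets_def hfacets_P using cut_subset_facet[OF assms] assms(1) by auto

lemma Inter_facets: "P \<inter> \<Inter>((\<lambda>w. cut {w}) ` T) = cut T"
  by (auto simp: cut_def)

lemma inj_facets: "inj_on (\<lambda>w. cut {w}) W"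
proof (rule inj_onI)
  fix w w' assume "w \<in> W" "w' \<in> W" "cut {w} = cut {w'}"
  then show "w = w'" using cut_subset_facet[of "{w}" w'] cut_singleton_ne by auto
qed

end

text \<open>The angle is read back through arccos: the outward normals are the elements of
  \<open>W\<close>, and by \<open>lor_unit_bound\<close> the argument lies in [-1,1], so the angle
  pi / 2 means that the product of the normals is 0.\<close>

lemma right_angled_cone_exists:
  fixes P :: "'a::euclidean_space mink set"
  assumes "hyp_polytope P" "right_angled P"
  obtains W where "right_angled_cone P W"
proof -
  obtain W z where W: "finite W" "\<And>w. w \<in> W \<Longrightarrow> lor w w = 1" "P = {p \<in> hyp_space. \<forall>w\<in>W. lor p w \<le> 0}"
    "z \<in> hyp_space" "\<And>w. w \<in> W \<Longrightarrow> lor z w < 0"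
    "\<And>w. w \<in> W \<Longrightarrow> \<exists>y\<in>hyp_space. lor y w = 0 \<and> (\<forall>w'\<in>W - {w}. lor y w' < 0)"
    by (rule irredundant_normals[OF assms(1)]) blast
  have zP: "z \<in> P" using W(4,5) unfolding W(3) by (auto simp: less_imp_le)
  have normal: "outward_normal P (P \<inter> wall w) = w" if w: "w \<in> W" for w
  proof -
    obtain y where y: "y \<in> hyp_space" "lor y w = 0" "\<forall>w'\<in>W - {w}. lor y w' < 0" using W(6)[OF w] by auto
    show ?thesis by (rule outward_normal_unique[OF W(1) w W(2) W(3-5) y(1,2)]) (use y(3) in auto)
  qed
  have sp: "span P = UNIV"
  proof -
    have "P = {q \<in> hyp_space. (\<forall>u\<in>W. lor q u \<le> 0) \<and> (\<forall>u\<in>{}. lor q u = 0)}" unfolding W(3) by simp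
    then show ?thesis using span_cut[OF W(1,4), of "{}"] W(5) by simp
  qed
  have facet: "P \<inter> wall w \<in> hfacets P" if w: "w \<in> W" for w
  proof -
    obtain y where y: "y \<in> hyp_space" "lor y w = 0" "\<forall>w'\<in>W - {w}. lor y w' < 0" using W(6)[OF w] by auto
    have eq: "P \<inter> wall w = {q \<in> hyp_space. (\<forall>u\<in>W. lor q u \<le> 0) \<and> (\<forall>u\<in>{w}. lor q u = 0)}"
      unfolding W(3) by (auto simp: wall_def)
    have "span (P \<inter> wall w) = {x. \<forall>u\<in>{w}. lor x u = 0}" unfolding eq by (rule span_cut[OF W(1) y(1)]) (use y in auto)
    moreover have "dim {x. \<forall>u\<in>{w}. lor x u = 0} + card {w} = DIM('a) + 1" by (rule dim_lor_complement) (use W(2) w in auto)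
    ultimately have "dim (P \<inter> wall w) + 1 = DIM('a) + 1" using dim_span[of "P \<inter> wall w"] by simp
    moreover have "dim P = DIM('a) + 1" using sp dim_span[of P] by simp
    moreover have "hface (P \<inter> wall w) P"
    proof (rule hface_wallI)
      show "spacelike w" using W(2)[OF w] by (simp add: spacelike_def)
      show "P \<subseteq> half_space w" using w unfolding W(3) by (auto simp: half_space_def)
      have "lor y w' \<le> 0" if "w' \<in> W" for w' using y that by (cases "w' = w") (auto simp: less_imp_le)
      then have "y \<in> P \<inter> wall w" using y unfolding W(3) by (auto simp: wall_def)
      then show "P \<inter> wall w \<noteq> {}" by auto
    qed
    ultimately show ?thesis by (simp add: hfacets_def)
  qed
  have orth: "lor w w' = 0"
    if h: "p \<in> P" "w \<in> W" "w' \<in> W" "w \<noteq> w'" "lor p w = 0" "lor p w' = 0" for p w w'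
  proof -
    have ph: "p \<in> hyp_space" using h(1) unfolding W(3) by auto
    then have "p \<in> (P \<inter> wall w) \<inter> (P \<inter> wall w')" using h by (auto simp: wall_def)
    moreover have "P \<inter> wall w \<noteq> P \<inter> wall w'" using normal[OF h(2)] normal[OF h(3)] h(4) by auto
    ultimately have "adjacent (P \<inter> wall w) (P \<inter> wall w')" by (auto simp: adjacent_def)
    then have "arccos (- lor w w') = pi / 2"
      using assms(2) facet[OF h(2)] facet[OF h(3)] normal[OF h(2)] normal[OF h(3)]
      unfolding right_angled_def dihedral_angle_def by metis
    moreover have b: "\<bar>lor w w'\<bar> \<le> 1"
      by (rule lor_unit_bound[OF hyp_space_timecone[OF ph] h(5,6)]) (use W(2) h in auto)
    moreover have "cos (arccos (- lor w w')) = - lor w w'" by (rule cos_arccos_abs) (use b in simp)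
    ultimately have "cos (pi / 2) = - lor w w'" by metis
    then show ?thesis by simp
  qed
  have "right_angled_cone P W"
  proof
    show "p \<in> P \<longleftrightarrow> p \<in> hyp_space \<and> (\<forall>w\<in>W. lor p w \<le> 0)" for p unfolding W(3) by simp
    show "P \<noteq> {}" using zP by auto
  qed (fact W(1) W(2) W(6) orth)+
  then show ?thesis by (rule that)
qed

text \<open>What the later sections take from the geometry; normals and the Lorentz form do not
  occur after this.\<close>

lemma right_angled_faces:
  fixes P :: "'a::euclidean_space mink set"
  assumes "hyp_polytope P" "right_angled P"
  shows "finite (hfacets P)"
    and "hface Q P \<Longrightarrow> Q \<noteq> {}"
    and "hface Q P \<Longrightarrow> Q = P \<inter> \<Inter>(defining_facets P Q)"
    and "S \<subseteq> hfacets P \<Longrightarrow> P \<inter> \<Inter>S \<noteq> {} \<Longrightarrow> hface (P \<inter> \<Inter>S) P \<and> defining_facets P (P \<inter> \<Inter>S) = S"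
    and "hface Q P \<Longrightarrow> hfacets Q = {F \<inter> Q |F. F \<in> hfacets P - defining_facets P Q \<and> F \<inter> Q \<noteq> {}}"
proof -
  obtain W where "right_angled_cone P W" using right_angled_cone_exists[OF assms] .
  then interpret right_angled_cone P W .
  show "finite (hfacets P)" unfolding hfacets_P using finW by simp
  show "Q \<noteq> {}" "Q = P \<inter> \<Inter>(defining_facets P Q)"
    "hfacets Q = {F \<inter> Q |F. F \<in> hfacets P - defining_facets P Q \<and> F \<inter> Q \<noteq> {}}" if Q: "hface Q P"
  proof -
    obtain T where T: "T \<subseteq> W" "Q = cut T" "cut T \<noteq> {}" by (rule hface_is_cut[OF Q])
    show "Q \<noteq> {}" using T by simp
    have D: "defining_facets P Q = (\<lambda>w. cut {w}) ` T" using defining_facets_cut T by simp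
    show "Q = P \<inter> \<Inter>(defining_facets P Q)" unfolding D Inter_facets by (rule T)
    have i: "cut {w} \<inter> Q = cut (insert w T)" for w unfolding T(2) by (auto simp: cut_def)
    have "hfacets P - defining_facets P Q = (\<lambda>w. cut {w}) ` (W - T)"
      unfolding D hfacets_P by (rule inj_on_image_set_diff[OF inj_facets, symmetric]) (use T in auto)
    moreover have "{F \<inter> Q |F. F \<in> f ` V \<and> F \<inter> Q \<noteq> {}} = {f w \<inter> Q |w. w \<in> V \<and> f w \<inter> Q \<noteq> {}}"
      for f :: "'a mink \<Rightarrow> 'a mink set" and V by blast
    ultimately show "hfacets Q = {F \<inter> Q |F. F \<in> hfacets P - defining_facets P Q \<and> F \<inter> Q \<noteq> {}}"
      using hfacets_cut[OF T(1,3)] unfolding T(2)[symmetric] by (simp add: i)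
  qed
  show "hface (P \<inter> \<Inter>S) P \<and> defining_facets P (P \<inter> \<Inter>S) = S" if S: "S \<subseteq> hfacets P" "P \<inter> \<Inter>S \<noteq> {}"
  proof -
    obtain T where T: "T \<subseteq> W" "S = (\<lambda>w. cut {w}) ` T" using S(1) unfolding hfacets_P by (auto simp: subset_image_iff)
    have "P \<inter> \<Inter>S = cut T" unfolding T(2) by (rule Inter_facets)
    then show ?thesis using hface_cut[OF T(1)] defining_facets_cut[OF T(1)] S(2) T(2) by simp
  qed
qed

section \<open>Morse functions on barycentric subdivisions\<close>

lemma to_circle_eq_iff: "to_circle s = to_circle t \<longleftrightarrow> s - t \<in> \<int>"
proof
  assume "to_circle s = to_circle t"
  moreover have "s \<in> to_circle s" by (simp add: to_circle_def)
  ultimately show "s - t \<in> \<int>" by (simp add: to_circle_def)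
next
  assume st: "s - t \<in> \<int>"
  have "r - s \<in> \<int> \<longleftrightarrow> r - t \<in> \<int>" for r
  proof
    assume "r - s \<in> \<int>"
    then have "(r - s) + (s - t) \<in> \<int>" using st by (rule Ints_add)
    then show "r - t \<in> \<int>" by simp
  next
    assume "r - t \<in> \<int>"
    then have "(r - t) - (s - t) \<in> \<int>" using st by (rule Ints_diff)
    then show "r - s \<in> \<int>" by simp
  qed
  then show "to_circle s = to_circle t" by (simp add: to_circle_def)
qed

text \<open>An affine function with integer values is constant, so lifts differ by constants.\<close>

lemma affine_lift_unique:
  assumes g: "affine_lift f \<sigma> g" and g': "affine_lift f \<sigma> g'"
    and \<alpha>: "\<alpha> \<in> simplex_pts \<sigma>" and \<beta>: "\<beta> \<in> simplex_pts \<sigma>"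
  shows "g' \<alpha> - g' \<beta> = g \<alpha> - g \<beta>"
proof (rule ccontr)
  assume neq: "\<not> ?thesis"
  define e where "e \<gamma> = g' \<gamma> - g \<gamma>" for \<gamma>
  have int: "e \<gamma> \<in> \<int>" if "\<gamma> \<in> simplex_pts \<sigma>" for \<gamma>
    using g g' that to_circle_eq_iff[of "g' \<gamma>" "g \<gamma>"] unfolding affine_lift_def e_def by simp
  define D where "D = e \<alpha> - e \<beta>"
  have D: "D \<noteq> 0" using neq by (simp add: D_def e_def)
  define t where "t = 1 / (2 * (\<bar>D\<bar> + 1))"
  have t: "0 < t" "t \<le> 1" by (auto simp: t_def divide_simps)
  define \<gamma> where "\<gamma> = (\<lambda>x. (1 - t) * \<beta> x + t * \<alpha> x)"
  have \<gamma>: "\<gamma> \<in> simplex_pts \<sigma>" unfolding \<gamma>_def using simplex_pts_convex[OF \<beta> \<alpha>] t by simp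
  have "g \<gamma> = (1 - t) * g \<beta> + t * g \<alpha>" "g' \<gamma> = (1 - t) * g' \<beta> + t * g' \<alpha>"
    using g g' \<alpha> \<beta> t unfolding affine_lift_def affine_on_simplex_def \<gamma>_def by auto
  then have "e \<gamma> - e \<beta> = t * D" by (simp add: e_def D_def algebra_simps)
  moreover have "e \<gamma> - e \<beta> \<in> \<int>" using int[OF \<gamma>] int[OF \<beta>] by (rule Ints_diff)
  ultimately have i: "t * D \<in> \<int>" by simp
  have "\<bar>t * D\<bar> = \<bar>D\<bar> / (2 * (\<bar>D\<bar> + 1))" by (simp add: t_def abs_mult)
  also have "\<dots> < 1" by (simp add: divide_simps)
  finally have "t * D = 0" using i Ints_nonzero_abs_less1 by blast
  then show False using D t by simp
qed

lemma vertex_pt_in: "x \<in> \<sigma> \<Longrightarrow> finite \<sigma> \<Longrightarrow> vertex_pt x \<in> simplex_pts \<sigma>"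
  by (auto simp: vertex_pt_def simplex_pts_def)

lemma chain_Inter_mem:
  assumes "finite S" "S \<noteq> {}" "\<And>a b. a \<in> S \<Longrightarrow> b \<in> S \<Longrightarrow> a \<subseteq> b \<or> b \<subseteq> a"
  shows "\<Inter>S \<in> S"
  using assms
proof (induction rule: finite_ne_induct)
  case (insert x F)
  then have F: "\<Inter>F \<in> F" by blast
  then have "x \<subseteq> \<Inter>F \<or> \<Inter>F \<subseteq> x" using insert.prems[of x "\<Inter>F"] by simp
  then have "\<Inter>(insert x F) = x \<or> \<Inter>(insert x F) = \<Inter>F" by (auto simp: Inf_insert)
  then show ?case using F by (metis insertI1 insertI2)
qed simp

text \<open>The function \<open>h\<close> gives the values at the vertices mod 1, and \<open>d x y\<close> is the difference between the
  values at \<open>y\<close> and \<open>x\<close> of a lift.\<close>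

locale circle_cocycle =
  fixes C :: "'b set set" and h :: "'b set \<Rightarrow> real" and d :: "'b set \<Rightarrow> 'b set \<Rightarrow> real"
  assumes finC: "finite C"
    and add: "\<And>x y z. x \<in> C \<Longrightarrow> y \<in> C \<Longrightarrow> z \<in> C \<Longrightarrow> x \<subseteq> y \<Longrightarrow> y \<subseteq> z \<Longrightarrow> d x z = d x y + d y z"
    and int: "\<And>x y. x \<in> C \<Longrightarrow> y \<in> C \<Longrightarrow> x \<subseteq> y \<Longrightarrow> d x y - (h y - h x) \<in> \<int>"
    and nz: "\<And>x y. x \<in> C \<Longrightarrow> y \<in> C \<Longrightarrow> x \<subset> y \<Longrightarrow> d x y \<noteq> 0"
begin

lemma d_self: "x \<in> C \<Longrightarrow> d x x = 0"
  using add[of x x x] by simp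

text \<open>The base \<open>b\<close> is the smallest vertex of the carrier of \<alpha>, so the
  value depends on the point alone and not on a simplex containing it.\<close>

definition circle_map :: "('b set \<Rightarrow> real) \<Rightarrow> real set" where
  "circle_map \<alpha> = (let b = \<Inter>{y \<in> C. \<alpha> y \<noteq> 0} in to_circle (h b + (\<Sum>y\<in>C. \<alpha> y * d b y)))"

definition lift :: "'b set set \<Rightarrow> ('b set \<Rightarrow> real) \<Rightarrow> real" where
  "lift \<sigma> \<alpha> = h (\<Inter>\<sigma>) + (\<Sum>y\<in>\<sigma>. \<alpha> y * d (\<Inter>\<sigma>) y)"

lemma sdD:
  assumes "\<sigma> \<in> sd C"
  shows "\<sigma> \<noteq> {}" "finite \<sigma>" "\<sigma> \<subseteq> C" "\<And>a b. a \<in> \<sigma> \<Longrightarrow> b \<in> \<sigma> \<Longrightarrow> a \<subseteq> b \<or> b \<subseteq> a" "\<Inter>\<sigma> \<in> \<sigma>"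
proof -
  show "\<sigma> \<noteq> {}" "finite \<sigma>" "\<sigma> \<subseteq> C" and c: "\<And>a b. a \<in> \<sigma> \<Longrightarrow> b \<in> \<sigma> \<Longrightarrow> a \<subseteq> b \<or> b \<subseteq> a"
    using assms by (auto simp: sd_def)
  then show "\<Inter>\<sigma> \<in> \<sigma>" by (intro chain_Inter_mem)
qed

lemma affine_lift_lift:
  assumes \<sigma>: "\<sigma> \<in> sd C"
  shows "affine_lift circle_map \<sigma> (lift \<sigma>)"
  unfolding affine_lift_def
proof (intro conjI ballI)
  let ?m = "\<Inter>\<sigma>"
  note s = sdD[OF \<sigma>]
  show "affine_on_simplex \<sigma> (lift \<sigma>)"
    unfolding affine_on_simplex_def
  proof (intro ballI)
    fix \<alpha> \<beta> and t :: real
    have "(\<Sum>y\<in>\<sigma>. ((1 - t) * \<alpha> y + t * \<beta> y) * d ?m y) =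
        (1 - t) * (\<Sum>y\<in>\<sigma>. \<alpha> y * d ?m y) + t * (\<Sum>y\<in>\<sigma>. \<beta> y * d ?m y)"
      unfolding sum_distrib_left sum.distrib[symmetric] by (rule sum.cong) (auto simp: algebra_simps)
    then show "lift \<sigma> (\<lambda>x. (1 - t) * \<alpha> x + t * \<beta> x) = (1 - t) * lift \<sigma> \<alpha> + t * lift \<sigma> \<beta>"
      by (simp add: lift_def algebra_simps)
  qed
  fix \<alpha> assume \<alpha>: "\<alpha> \<in> simplex_pts \<sigma>"
  define A where "A = {y \<in> C. \<alpha> y \<noteq> 0}"
  define b where "b = \<Inter>A"
  have A\<sigma>: "A \<subseteq> \<sigma>" using \<alpha> by (auto simp: A_def simplex_pts_def)
  have Ane: "A \<noteq> {}"
  proof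
    assume "A = {}"
    then have "\<forall>y\<in>\<sigma>. \<alpha> y = 0" using s(3) by (auto simp: A_def)
    then show False using \<alpha> by (simp add: simplex_pts_def)
  qed
  have bA: "b \<in> A" unfolding b_def
  proof (rule chain_Inter_mem[OF _ Ane])
    show "finite A" using A\<sigma> s(2) by (rule finite_subset)
    show "a \<subseteq> c \<or> c \<subseteq> a" if "a \<in> A" "c \<in> A" for a c using that A\<sigma> s(4) by blast
  qed
  then have b: "b \<in> \<sigma>" "b \<in> C" using A\<sigma> s(3) by auto
  have mC: "?m \<in> C" "?m \<subseteq> b" using s(3,5) b by auto
  have "(\<Sum>y\<in>\<sigma>. \<alpha> y * d ?m y) = (\<Sum>y\<in>\<sigma>. \<alpha> y * d ?m b + \<alpha> y * d b y)"
  proof (rule sum.cong[OF refl])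
    fix y assume y: "y \<in> \<sigma>"
    show "\<alpha> y * d ?m y = \<alpha> y * d ?m b + \<alpha> y * d b y"
    proof (cases "\<alpha> y = 0")
      case False
      then have "y \<in> A" using y s(3) by (auto simp: A_def)
      then have "b \<subseteq> y" by (auto simp: b_def)
      then show ?thesis using add[OF mC(1) b(2) _ mC(2)] y s(3) by (auto simp: algebra_simps)
    qed simp
  qed
  also have "\<dots> = d ?m b + (\<Sum>y\<in>\<sigma>. \<alpha> y * d b y)"
    using \<alpha> by (simp add: sum.distrib simplex_pts_def flip: sum_distrib_right)
  also have "(\<Sum>y\<in>\<sigma>. \<alpha> y * d b y) = (\<Sum>y\<in>C. \<alpha> y * d b y)"
    by (rule sum.mono_neutral_left) (use finC s(3) \<alpha> in \<open>auto simp: simplex_pts_def\<close>)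
  \<comment> \<open>Changing the base vertex from the smallest vertex of \<sigma> to that of the
    carrier costs an integer, by the assumption \<open>int\<close>.\<close>
  finally have eq: "lift \<sigma> \<alpha> - (h b + (\<Sum>y\<in>C. \<alpha> y * d b y)) = d ?m b - (h b - h ?m)"
    by (simp add: lift_def)
  have "to_circle (lift \<sigma> \<alpha>) = to_circle (h b + (\<Sum>y\<in>C. \<alpha> y * d b y))"
    unfolding to_circle_eq_iff eq using int[OF mC(1) b(2) mC(2)] .
  then show "circle_map \<alpha> = to_circle (lift \<sigma> \<alpha>)" by (simp add: circle_map_def Let_def A_def b_def)
qed

lemma lift_vertex:
  assumes "\<sigma> \<in> sd C" "x \<in> \<sigma>"
  shows "lift \<sigma> (vertex_pt x) = h (\<Inter>\<sigma>) + d (\<Inter>\<sigma>) x"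
proof -
  have "(\<Sum>y\<in>\<sigma>. vertex_pt x y * d (\<Inter>\<sigma>) y) = (\<Sum>y\<in>\<sigma>. if y = x then d (\<Inter>\<sigma>) x else 0)"
    by (rule sum.cong) (auto simp: vertex_pt_def)
  then show ?thesis using sdD(2)[OF assms(1)] assms(2) by (simp add: lift_def)
qed

lemma morse_circle_map: "morse_function (sd C) circle_map"
  unfolding morse_function_def
proof (intro conjI ballI impI)
  show "circle_map ` realization (sd C) \<subseteq> range to_circle" by (auto simp: circle_map_def Let_def)
  fix \<sigma> :: "'b set set" assume \<sigma>: "\<sigma> \<in> sd C" "card \<sigma> \<ge> 2"
  note s = sdD[OF \<sigma>(1)]
  have "\<sigma> \<noteq> {\<Inter>\<sigma>}"
  proof
    assume "\<sigma> = {\<Inter>\<sigma>}"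
    then have "card \<sigma> = 1" by (metis is_singletonI is_singleton_altdef)
    then show False using \<sigma>(2) by simp
  qed
  then obtain y where y: "y \<in> \<sigma>" "y \<noteq> \<Inter>\<sigma>" using s(5) by blast
  have "\<Inter>\<sigma> \<subset> y" using y by auto
  then have "d (\<Inter>\<sigma>) y \<noteq> 0" using nz s(3,5) y(1) by blast
  then have "lift \<sigma> (vertex_pt y) \<noteq> lift \<sigma> (vertex_pt (\<Inter>\<sigma>))"
    unfolding lift_vertex[OF \<sigma>(1) y(1)] lift_vertex[OF \<sigma>(1) s(5)] using d_self[of "\<Inter>\<sigma>"] s(3,5) by auto
  then show "\<exists>g. affine_lift circle_map \<sigma> g \<and> (\<exists>\<alpha>\<in>simplex_pts \<sigma>. \<exists>\<beta>\<in>simplex_pts \<sigma>. g \<alpha> \<noteq> g \<beta>)"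
    using affine_lift_lift[OF \<sigma>(1)] vertex_pt_in[OF y(1) s(2)] vertex_pt_in[OF s(5,2)] by blast
qed

definition rise :: "'b set \<Rightarrow> 'b set \<Rightarrow> real" where
  "rise x y = (if x \<subseteq> y then d x y else - d y x)"

lemma rise_lift:
  assumes \<sigma>: "\<sigma> \<in> sd C" "x \<in> \<sigma>" "y \<in> \<sigma>"
  shows "rise x y = d (\<Inter>\<sigma>) y - d (\<Inter>\<sigma>) x"
proof -
  note s = sdD[OF \<sigma>(1)]
  have C: "\<Inter>\<sigma> \<in> C" "x \<in> C" "y \<in> C" using s(3,5) \<sigma> by auto
  show ?thesis
  proof (cases "x \<subseteq> y")
    case True
    then show ?thesis using add[OF C(1,2,3) _ True] \<sigma>(2) by (simp add: rise_def Inter_lower)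
  next
    case False
    then have "y \<subseteq> x" using s(4)[OF \<sigma>(2,3)] by simp
    then show ?thesis using add[OF C(1,3,2)] \<sigma>(3) False by (simp add: rise_def Inter_lower)
  qed
qed

lemma lift_diff:
  assumes \<sigma>: "\<sigma> \<in> sd C" "x \<in> \<sigma>" and \<alpha>: "\<alpha> \<in> simplex_pts \<sigma>"
  shows "lift \<sigma> \<alpha> - lift \<sigma> (vertex_pt x) = (\<Sum>y\<in>\<sigma>. \<alpha> y * rise x y)"
proof -
  have "(\<Sum>y\<in>\<sigma>. \<alpha> y * rise x y) = (\<Sum>y\<in>\<sigma>. \<alpha> y * d (\<Inter>\<sigma>) y - \<alpha> y * d (\<Inter>\<sigma>) x)"
    by (intro sum.cong) (simp_all add: rise_lift[OF \<sigma>] right_diff_distrib)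
  also have "\<dots> = (\<Sum>y\<in>\<sigma>. \<alpha> y * d (\<Inter>\<sigma>) y) - d (\<Inter>\<sigma>) x"
    using \<alpha> by (simp add: sum_subtractf simplex_pts_def flip: sum_distrib_right)
  finally show ?thesis unfolding lift_vertex[OF \<sigma>] by (simp add: lift_def)
qed

lemma rise_zero: "x \<in> C \<Longrightarrow> rise x x = 0"
  by (simp add: rise_def d_self)

lemma rise_nz: "x \<in> C \<Longrightarrow> y \<in> C \<Longrightarrow> x \<noteq> y \<Longrightarrow> x \<subseteq> y \<or> y \<subseteq> x \<Longrightarrow> rise x y \<noteq> 0"
  using nz[of x y] nz[of y x] by (auto simp: rise_def psubset_eq)

text \<open>Lifts differ by constants, so the choice of \<open>g\<close> is immaterial; and an
  affine function on a simplex is extremal at a vertex exactly if it is so among the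
  vertices.\<close>

lemma lift_min_iff:
  assumes \<sigma>: "\<sigma> \<in> sd C" "x \<in> \<sigma>"
  shows "(\<exists>g. affine_lift circle_map \<sigma> g \<and> (\<forall>\<alpha>\<in>simplex_pts \<sigma>. g (vertex_pt x) \<le> g \<alpha>)) \<longleftrightarrow> (\<forall>y\<in>\<sigma>. 0 \<le> rise x y)"
    and "(\<exists>g. affine_lift circle_map \<sigma> g \<and> (\<forall>\<alpha>\<in>simplex_pts \<sigma>. g \<alpha> \<le> g (vertex_pt x))) \<longleftrightarrow> (\<forall>y\<in>\<sigma>. rise x y \<le> 0)"
proof -
  note s = sdD[OF \<sigma>(1)]
  note l = affine_lift_lift[OF \<sigma>(1)]
  have v: "vertex_pt y \<in> simplex_pts \<sigma>" if "y \<in> \<sigma>" for y using vertex_pt_in[OF that s(2)] .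
  have g: "g \<alpha> - g (vertex_pt x) = (\<Sum>y\<in>\<sigma>. \<alpha> y * rise x y)"
    if "affine_lift circle_map \<sigma> g" "\<alpha> \<in> simplex_pts \<sigma>" for g \<alpha>
    using affine_lift_unique[OF l that(1,2) v[OF \<sigma>(2)]] lift_diff[OF \<sigma> that(2)] by simp
  have gv: "g (vertex_pt y) - g (vertex_pt x) = rise x y"
    if "affine_lift circle_map \<sigma> g" "y \<in> \<sigma>" for g y
  proof -
    have "(\<Sum>z\<in>\<sigma>. vertex_pt y z * rise x z) = (\<Sum>z\<in>\<sigma>. if z = y then rise x y else 0)"
      by (rule sum.cong) (auto simp: vertex_pt_def)
    then show ?thesis using g[OF that(1) v[OF that(2)]] that(2) s(2) by simp
  qed
  show "(\<exists>g. affine_lift circle_map \<sigma> g \<and> (\<forall>\<alpha>\<in>simplex_pts \<sigma>. g (vertex_pt x) \<le> g \<alpha>)) \<longleftrightarrow> (\<forall>y\<in>\<sigma>. 0 \<le> rise x y)"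
  proof
    assume "\<exists>g. affine_lift circle_map \<sigma> g \<and> (\<forall>\<alpha>\<in>simplex_pts \<sigma>. g (vertex_pt x) \<le> g \<alpha>)"
    then obtain g where *: "affine_lift circle_map \<sigma> g" "\<forall>\<alpha>\<in>simplex_pts \<sigma>. g (vertex_pt x) \<le> g \<alpha>" by blast
    show "\<forall>y\<in>\<sigma>. 0 \<le> rise x y"
    proof
      fix y assume y: "y \<in> \<sigma>"
      show "0 \<le> rise x y" using gv[OF *(1) y] *(2) v[OF y] by fastforce
    qed
  next
    assume r: "\<forall>y\<in>\<sigma>. 0 \<le> rise x y"
    have "lift \<sigma> (vertex_pt x) \<le> lift \<sigma> \<alpha>" if "\<alpha> \<in> simplex_pts \<sigma>" for \<alpha>
    proof -
      have "0 \<le> (\<Sum>y\<in>\<sigma>. \<alpha> y * rise x y)" using that r by (intro sum_nonneg) (auto simp: simplex_pts_def)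
      then show ?thesis using g[OF l that] by simp
    qed
    then show "\<exists>g. affine_lift circle_map \<sigma> g \<and> (\<forall>\<alpha>\<in>simplex_pts \<sigma>. g (vertex_pt x) \<le> g \<alpha>)" using l by blast
  qed
  show "(\<exists>g. affine_lift circle_map \<sigma> g \<and> (\<forall>\<alpha>\<in>simplex_pts \<sigma>. g \<alpha> \<le> g (vertex_pt x))) \<longleftrightarrow> (\<forall>y\<in>\<sigma>. rise x y \<le> 0)"
  proof
    assume "\<exists>g. affine_lift circle_map \<sigma> g \<and> (\<forall>\<alpha>\<in>simplex_pts \<sigma>. g \<alpha> \<le> g (vertex_pt x))"
    then obtain g where *: "affine_lift circle_map \<sigma> g" "\<forall>\<alpha>\<in>simplex_pts \<sigma>. g \<alpha> \<le> g (vertex_pt x)" by blast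
    show "\<forall>y\<in>\<sigma>. rise x y \<le> 0"
    proof
      fix y assume y: "y \<in> \<sigma>"
      show "rise x y \<le> 0" using gv[OF *(1) y] *(2) v[OF y] by fastforce
    qed
  next
    assume r: "\<forall>y\<in>\<sigma>. rise x y \<le> 0"
    have "lift \<sigma> \<alpha> \<le> lift \<sigma> (vertex_pt x)" if "\<alpha> \<in> simplex_pts \<sigma>" for \<alpha>
    proof -
      have "(\<Sum>y\<in>\<sigma>. \<alpha> y * rise x y) \<le> 0" using that r
        by (intro sum_nonpos mult_nonneg_nonpos) (auto simp: simplex_pts_def)
      then show ?thesis using g[OF l that] by simp
    qed
    then show "\<exists>g. affine_lift circle_map \<sigma> g \<and> (\<forall>\<alpha>\<in>simplex_pts \<sigma>. g \<alpha> \<le> g (vertex_pt x))" using l by blast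
  qed
qed

lemma sd_filter: "sd {y \<in> Q. R y} = {S \<in> sd Q. \<forall>y\<in>S. R y}"
  unfolding sd_def by auto

text \<open>Belonging to one of the links is a condition on single vertices, so both links are full
  in the link of \<open>x\<close> and consist of all chains in a set of cubes. By \<open>nz\<close>
  the inequalities become strict.\<close>

lemma links_circle_map:
  assumes x: "x \<in> C"
  shows "ascending_link (sd C) circle_map x = sd {y \<in> C. x \<subset> y \<and> 0 < d x y \<or> y \<subset> x \<and> d y x < 0}"
    and "descending_link (sd C) circle_map x = sd {y \<in> C. x \<subset> y \<and> d x y < 0 \<or> y \<subset> x \<and> 0 < d y x}"
proof -
  let ?N = "{y \<in> C. y \<noteq> x \<and> (y \<subseteq> x \<or> x \<subseteq> y)}"
  have link: "link (sd C) x = sd ?N" by (rule link_sd[OF x])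
  have ins: "insert x \<tau> \<in> sd C" if "\<tau> \<in> link (sd C) x" for \<tau> using that by (simp add: link_def)
  have r: "0 \<le> rise x y \<longleftrightarrow> x \<subset> y \<and> 0 < d x y \<or> y \<subset> x \<and> d y x < 0"
    "rise x y \<le> 0 \<longleftrightarrow> x \<subset> y \<and> d x y < 0 \<or> y \<subset> x \<and> 0 < d y x" if "y \<in> ?N" for y
  proof -
    have 0: "rise x y \<noteq> 0" using rise_nz[OF x] that by auto
    have "x \<subset> y \<and> \<not> y \<subset> x \<and> rise x y = d x y \<or> y \<subset> x \<and> \<not> x \<subset> y \<and> rise x y = - d y x"
    proof (cases "x \<subseteq> y")
      case True
      then show ?thesis using that by (auto simp: rise_def)
    next
      case False
      then show ?thesis using that by (auto simp: rise_def)
    qed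
    then show "0 \<le> rise x y \<longleftrightarrow> x \<subset> y \<and> 0 < d x y \<or> y \<subset> x \<and> d y x < 0"
      "rise x y \<le> 0 \<longleftrightarrow> x \<subset> y \<and> d x y < 0 \<or> y \<subset> x \<and> 0 < d y x"
      using 0 by (elim disjE conjE; simp add: less_le)+
  qed
  have "ascending_link (sd C) circle_map x = {\<tau> \<in> sd ?N. \<forall>y\<in>\<tau>. 0 \<le> rise x y}"
    unfolding ascending_link_def link[symmetric]
    using lift_min_iff(1)[OF ins] rise_zero[OF x] by (intro Collect_cong conj_cong refl) simp
  also have "\<dots> = sd {y \<in> ?N. 0 \<le> rise x y}" by (rule sd_filter[symmetric])
  also have "{y \<in> ?N. 0 \<le> rise x y} = {y \<in> C. x \<subset> y \<and> 0 < d x y \<or> y \<subset> x \<and> d y x < 0}"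
    using r(1) by (auto simp: psubset_eq)
  finally show "ascending_link (sd C) circle_map x = sd {y \<in> C. x \<subset> y \<and> 0 < d x y \<or> y \<subset> x \<and> d y x < 0}" .
  have "descending_link (sd C) circle_map x = {\<tau> \<in> sd ?N. \<forall>y\<in>\<tau>. rise x y \<le> 0}"
    unfolding descending_link_def link[symmetric]
    using lift_min_iff(2)[OF ins] rise_zero[OF x] by (intro Collect_cong conj_cong refl) simp
  also have "\<dots> = sd {y \<in> ?N. rise x y \<le> 0}" by (rule sd_filter[symmetric])
  also have "{y \<in> ?N. rise x y \<le> 0} = {y \<in> C. x \<subset> y \<and> d x y < 0 \<or> y \<subset> x \<and> 0 < d y x}"
    using r(2) by (auto simp: psubset_eq)
  finally show "descending_link (sd C) circle_map x = sd {y \<in> C. x \<subset> y \<and> d x y < 0 \<or> y \<subset> x \<and> 0 < d y x}" .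
qed

end

section \<open>The Morse function of a set of moves\<close>

lemma le_chains_Un:
  assumes "\<And>a b. a \<in> A \<Longrightarrow> b \<in> B \<Longrightarrow> le a b"
  shows "le_chains le (A \<union> B) = join (le_chains le A) (le_chains le B)"
proof (intro equalityI subsetI)
  fix S assume S: "S \<in> le_chains le (A \<union> B)"
  then have "S \<inter> A \<in> insert {} (le_chains le A)" "S \<inter> B \<in> insert {} (le_chains le B)"
    by (auto simp: le_chains_def)
  moreover have "S = (S \<inter> A) \<union> (S \<inter> B)" "S \<noteq> {}" using S by (auto simp: le_chains_def)
  ultimately show "S \<in> join (le_chains le A) (le_chains le B)" unfolding join_def by blast
next
  fix S assume "S \<in> join (le_chains le A) (le_chains le B)"
  then obtain \<kappa> \<mu> where *: "S = \<kappa> \<union> \<mu>" "S \<noteq> {}" "\<kappa> \<in> insert {} (le_chains le A)" "\<mu> \<in> insert {} (le_chains le B)"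
    by (auto simp: join_def)
  then have k: "finite \<kappa>" "\<kappa> \<subseteq> A" "\<And>a b. a \<in> \<kappa> \<Longrightarrow> b \<in> \<kappa> \<Longrightarrow> le a b \<or> le b a"
    and l: "finite \<mu>" "\<mu> \<subseteq> B" "\<And>a b. a \<in> \<mu> \<Longrightarrow> b \<in> \<mu> \<Longrightarrow> le a b \<or> le b a" by (auto simp: le_chains_def)
  have "le a b \<or> le b a" if "a \<in> S" "b \<in> S" for a b
    using that k l assms unfolding *(1) by blast
  then show "S \<in> le_chains le (A \<union> B)" using * k l by (auto simp: le_chains_def)
qed

lemma sd_Un: "(\<And>a b. a \<in> A \<Longrightarrow> b \<in> B \<Longrightarrow> a \<subseteq> b) \<Longrightarrow> sd (A \<union> B) = join (sd A) (sd B)"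
  unfolding sd_eq_le_chains(1) by (rule le_chains_Un)

lemma Union_sd: "\<Union>(sd Q) = Q"
proof -
  have "{q} \<in> sd Q" if "q \<in> Q" for q using that by (auto simp: sd_def)
  then show ?thesis by (auto simp: sd_def)
qed

lemma in_vadd: "F \<in> vadd v w \<longleftrightarrow> (F \<in> v) \<noteq> (F \<in> w)"
  by (auto simp: vadd_def)

lemma vadd_subset_iff: "vadd v w \<subseteq> S \<longleftrightarrow> (\<forall>F. F \<notin> S \<longrightarrow> (F \<in> v \<longleftrightarrow> F \<in> w))"
  by (auto simp: vadd_def)

text \<open>The faces are recorded by the family \<open>N\<close> of their sets of defining facets, and \<open>st v\<close> is the
  state of the copy of the polytope indexed by \<open>v\<close>.\<close>

locale cube_moves =
  fixes Fs :: "'f set" and N :: "'f set set" and Ms :: "'f set set" and st :: "'f set \<Rightarrow> 'f \<Rightarrow> status"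
  assumes finFs: "finite Fs" and N_sub: "\<And>S. S \<in> N \<Longrightarrow> S \<subseteq> Fs"
    and N_down: "\<And>S T. S \<in> N \<Longrightarrow> T \<subseteq> S \<Longrightarrow> T \<in> N"
    and moves: "partition_on Fs Ms"
    and st_cong: "\<And>v w A F. v \<subseteq> Fs \<Longrightarrow> w \<subseteq> Fs \<Longrightarrow> A \<in> Ms \<Longrightarrow> F \<in> A \<Longrightarrow> v \<inter> A = w \<inter> A \<Longrightarrow> st v F = st w F"
    and st_flip: "\<And>v F. v \<subseteq> Fs \<Longrightarrow> F \<in> Fs \<Longrightarrow> st (vadd v {F}) F = invert (st v F)"
    and st_compatible: "\<And>v S A F G. v \<subseteq> Fs \<Longrightarrow> S \<in> N \<Longrightarrow> A \<in> Ms \<Longrightarrow> F \<in> S \<inter> A \<Longrightarrow> G \<in> S \<inter> A \<Longrightarrow> st v F = st v G"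
begin

lemma move_ex: "F \<in> Fs \<Longrightarrow> \<exists>A\<in>Ms. F \<in> A"
  using moves by (auto simp: partition_on_def)

lemma move_unique: "A \<in> Ms \<Longrightarrow> B \<in> Ms \<Longrightarrow> F \<in> A \<Longrightarrow> F \<in> B \<Longrightarrow> A = B"
  using moves unfolding partition_on_def disjoint_def by blast

lemma finMs: "finite Ms"
  using finite_elements[OF finFs moves] .

definition cube :: "'f set \<Rightarrow> 'f set \<Rightarrow> 'f set set" where
  "cube v S = {w. w \<subseteq> Fs \<and> vadd v w \<subseteq> S}"

definition cubes :: "'f set set set" where
  "cubes = {cube v S |v S. v \<subseteq> Fs \<and> S \<in> N}"

lemma cube_self: "v \<subseteq> Fs \<Longrightarrow> v \<in> cube v S"
  by (simp add: cube_def vadd_subset_iff)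

lemma cube_sub: "w \<in> cube v S \<Longrightarrow> w \<subseteq> Fs"
  by (simp add: cube_def)

lemma cube_subset_iff:
  assumes "v \<subseteq> Fs" "w \<subseteq> Fs" "S \<subseteq> Fs" "T \<subseteq> Fs"
  shows "cube v S \<subseteq> cube w T \<longleftrightarrow> S \<subseteq> T \<and> vadd v w \<subseteq> T"
proof
  assume *: "cube v S \<subseteq> cube w T"
  have 1: "F \<notin> T \<Longrightarrow> F \<in> w \<longleftrightarrow> F \<in> v" for F
    using cube_self[OF assms(1), of S] * by (auto simp: cube_def vadd_subset_iff)
  have "F \<in> T" if F: "F \<in> S" for F
  proof (rule ccontr)
    assume nF: "F \<notin> T"
    have "vadd v {F} \<in> cube v S" using F assms by (auto simp: cube_def vadd_def)
    then have "vadd v {F} \<in> cube w T" using * by auto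
    then have "F \<in> w \<longleftrightarrow> F \<in> vadd v {F}" using nF by (auto simp: cube_def vadd_subset_iff)
    then show False using 1[OF nF] by (simp add: in_vadd)
  qed
  then show "S \<subseteq> T \<and> vadd v w \<subseteq> T" using 1 by (auto simp: vadd_subset_iff)
next
  assume *: "S \<subseteq> T \<and> vadd v w \<subseteq> T"
  show "cube v S \<subseteq> cube w T"
  proof
    fix u assume "u \<in> cube v S"
    then have "u \<subseteq> Fs" "\<And>F. F \<notin> S \<Longrightarrow> F \<in> v \<longleftrightarrow> F \<in> u" by (auto simp: cube_def vadd_subset_iff)
    moreover have "\<And>F. F \<notin> T \<Longrightarrow> F \<in> v \<longleftrightarrow> F \<in> w" using * by (simp add: vadd_subset_iff)
    ultimately show "u \<in> cube w T" using * unfolding cube_def vadd_subset_iff by blast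
  qed
qed

lemma cube_cong:
  assumes "v \<subseteq> Fs" "w \<in> cube v S"
  shows "cube w S = cube v S"
  using assms unfolding cube_def vadd_subset_iff by blast

text \<open>Recovers the directions of a cube from its vertex set, which is all that a vertex of the
  subdivision carries; \<open>height\<close> and \<open>climb\<close> have to be functions of that
  set.\<close>

definition dirs :: "'f set set \<Rightarrow> 'f set" where
  "dirs c = (\<Union>v\<in>c. \<Union>w\<in>c. vadd v w)"

lemma dirs_cube:
  assumes "v \<subseteq> Fs" "S \<subseteq> Fs"
  shows "dirs (cube v S) = S"
proof (intro equalityI subsetI)
  fix F assume "F \<in> dirs (cube v S)"
  then obtain u w where "u \<in> cube v S" "w \<in> cube v S" "F \<in> vadd u w" by (auto simp: dirs_def)
  then show "F \<in> S" unfolding cube_def vadd_subset_iff in_vadd by blast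
next
  fix F assume F: "F \<in> S"
  have "vadd v {F} \<in> cube v S" using F assms by (auto simp: cube_def vadd_def)
  moreover have "F \<in> vadd v (vadd v {F})" by (simp add: in_vadd)
  ultimately show "F \<in> dirs (cube v S)" using cube_self[OF assms(1)] unfolding dirs_def by blast
qed

lemma cube_above:
  assumes v: "v \<subseteq> Fs" "S \<in> N" and y: "y \<in> cubes" "cube v S \<subseteq> y"
  obtains T where "T \<in> N" "y = cube v T" "S \<subseteq> T"
proof -
  obtain w T where wT: "w \<subseteq> Fs" "T \<in> N" "y = cube w T" using y(1) by (auto simp: cubes_def)
  have "v \<in> cube w T" using cube_self[OF v(1), of S] y(2) wT(3) by auto
  then have "y = cube v T" using cube_cong[OF wT(1)] wT(3) by simp
  moreover have "S \<subseteq> T" using y(2) wT cube_subset_iff[OF v(1) wT(1)] N_sub v(2) by auto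
  ultimately show ?thesis using that wT(2) by blast
qed

lemma cube_below:
  assumes v: "v \<subseteq> Fs" "T \<in> N" and y: "y \<in> cubes" "y \<subseteq> cube v T"
  obtains w S where "w \<in> cube v T" "S \<subseteq> T" "y = cube w S"
proof -
  obtain w S where wS: "w \<subseteq> Fs" "S \<in> N" "y = cube w S" using y(1) by (auto simp: cubes_def)
  have "w \<in> cube v T" using cube_self[OF wS(1), of S] y(2) wS(3) by auto
  moreover have "S \<subseteq> T" using y(2) wS cube_subset_iff[OF wS(1) v(1)] N_sub v(2) by auto
  ultimately show ?thesis using that wS(3) by blast
qed

lemma finite_cubes: "finite cubes"
proof -
  have "cubes \<subseteq> Pow (Pow Fs)" by (auto simp: cubes_def cube_def)
  then show ?thesis using finFs by (meson finite_Pow_iff finite_subset)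
qed

text \<open>The inherited state, read on facets of the polytope instead of their intersections with
  the face. On \<open>S\<close> itself it is \<open>StO\<close>, as every facet of \<open>S\<close>
  lies in a move that meets \<open>S\<close>.\<close>

definition inh :: "'f set \<Rightarrow> 'f set \<Rightarrow> 'f \<Rightarrow> status" where
  "inh v S F = (if \<forall>A\<in>Ms. F \<in> A \<longrightarrow> A \<inter> S = {} then st v F else StO)"

text \<open>The moves that lower the lift by 1 each. Quantifying over the vertices of
  \<open>x\<close> makes the set depend on the two cubes only; since these moves avoid the
  directions of \<open>x\<close>, the status of a facet in them is the same at all vertices of
  \<open>x\<close>.\<close>

definition opened :: "'f set set \<Rightarrow> 'f set set \<Rightarrow> 'f set set" where
  "opened x y = {A \<in> Ms. A \<inter> dirs x = {} \<and> (\<exists>F\<in>A \<inter> dirs y. \<exists>v\<in>x. st v F = StI)}"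

lemma opened_cube:
  assumes "v \<subseteq> Fs" "S \<subseteq> Fs" "T \<subseteq> Fs"
  shows "opened (cube v S) (cube v T) = {A \<in> Ms. A \<inter> S = {} \<and> (\<exists>F\<in>A \<inter> T. st v F = StI)}"
proof -
  have k: "(\<exists>u\<in>cube v S. st u F = StI) \<longleftrightarrow> st v F = StI" if "A \<in> Ms" "A \<inter> S = {}" "F \<in> A" for A F
  proof -
    have eq: "st u F = st v F" if u: "u \<in> cube v S" for u
    proof (rule st_cong[OF cube_sub[OF u] assms(1) \<open>A \<in> Ms\<close> \<open>F \<in> A\<close>])
      show "u \<inter> A = v \<inter> A" using u \<open>A \<inter> S = {}\<close> unfolding cube_def vadd_subset_iff by blast
    qed
    show ?thesis
    proof
      assume "\<exists>u\<in>cube v S. st u F = StI"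
      then obtain u where "u \<in> cube v S" "st u F = StI" by auto
      then show "st v F = StI" using eq[of u] by simp
    next
      assume "st v F = StI"
      then show "\<exists>u\<in>cube v S. st u F = StI" using cube_self[OF assms(1)] by (intro bexI[of _ v])
    qed
  qed
  show ?thesis unfolding opened_def dirs_cube[OF assms(1,2)] dirs_cube[OF assms(1,3)]
    by (intro Collect_cong conj_cong refl bex_cong k) auto
qed

lemma opened_empty_iff:
  assumes "v \<subseteq> Fs" "S \<subseteq> T" "T \<subseteq> Fs"
  shows "opened (cube v S) (cube v T) = {} \<longleftrightarrow> (\<forall>F\<in>T. inh v S F = StO)"
proof -
  have o: "opened (cube v S) (cube v T) = {A \<in> Ms. A \<inter> S = {} \<and> (\<exists>F\<in>A \<inter> T. st v F = StI)}"
    by (rule opened_cube) (use assms in auto)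
  have "inh v S F = StO \<longleftrightarrow> \<not> ((\<exists>A\<in>Ms. F \<in> A \<and> A \<inter> S = {}) \<and> st v F = StI)" if F: "F \<in> T" for F
  proof -
    obtain A where A: "A \<in> Ms" "F \<in> A" using move_ex[of F] F assms(3) by auto
    have u: "B = A" if "B \<in> Ms" "F \<in> B" for B using move_unique[OF that(1) A(1) that(2) A(2)] .
    have "(\<forall>B\<in>Ms. F \<in> B \<longrightarrow> B \<inter> S = {}) \<longleftrightarrow> A \<inter> S = {}" "(\<exists>B\<in>Ms. F \<in> B \<and> B \<inter> S = {}) \<longleftrightarrow> A \<inter> S = {}"
      by (metis u A)+
    then show ?thesis by (cases "st v F") (simp_all add: inh_def)
  qed
  then have "(\<forall>F\<in>T. inh v S F = StO) \<longleftrightarrow> (\<forall>F\<in>T. \<not> ((\<exists>A\<in>Ms. F \<in> A \<and> A \<inter> S = {}) \<and> st v F = StI))" by simp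
  also have "\<dots> \<longleftrightarrow> opened (cube v S) (cube v T) = {}" unfolding o by auto
  finally show ?thesis by simp
qed

text \<open>A move counted from \<open>S\<close> to \<open>U\<close> is counted from
  \<open>S\<close> to \<open>T\<close> if it meets \<open>T\<close>, and from \<open>T\<close> to
  \<open>U\<close> otherwise. In the first case its status \<open>I\<close> may be witnessed only
  outside \<open>T\<close>; compatibility transfers it to a facet of \<open>T\<close>.\<close>

lemma opened_add:
  assumes "v \<subseteq> Fs" "S \<subseteq> T" "T \<subseteq> U" "U \<in> N"
  shows "card (opened (cube v S) (cube v U)) = card (opened (cube v S) (cube v T)) + card (opened (cube v T) (cube v U))"
proof -
  have sub: "S \<subseteq> Fs" "T \<subseteq> Fs" "U \<subseteq> Fs" using assms N_sub by blast+
  let ?a = "{A \<in> Ms. A \<inter> S = {} \<and> (\<exists>F\<in>A \<inter> T. st v F = StI)}"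
  let ?b = "{A \<in> Ms. A \<inter> T = {} \<and> (\<exists>F\<in>A \<inter> U. st v F = StI)}"
  have "{A \<in> Ms. A \<inter> S = {} \<and> (\<exists>F\<in>A \<inter> U. st v F = StI)} = ?a \<union> ?b"
  proof (intro equalityI subsetI)
    fix A assume A: "A \<in> {A \<in> Ms. A \<inter> S = {} \<and> (\<exists>F\<in>A \<inter> U. st v F = StI)}"
    then obtain F where F: "A \<in> Ms" "A \<inter> S = {}" "F \<in> A \<inter> U" "st v F = StI" by auto
    show "A \<in> ?a \<union> ?b"
    proof (cases "A \<inter> T = {}")
      case False
      then obtain G where G: "G \<in> A \<inter> T" by auto
      then have "st v G = st v F"
        using st_compatible[OF assms(1,4) F(1), of G F] F(3) assms(3) by auto
      then show ?thesis using F G by auto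
    qed (use F in auto)
  qed (use assms(2,3) in auto)
  moreover have "?a \<inter> ?b = {}" by auto
  moreover have "finite ?a" "finite ?b" using finMs by auto
  ultimately show ?thesis
    unfolding opened_cube[OF assms(1) sub(1,3)] opened_cube[OF assms(1) sub(1,2)] opened_cube[OF assms(1) sub(2,3)]
    by (simp add: card_Un_disjoint)
qed

text \<open>The \<open>+ 1\<close> keeps \<open>eps * card Fs\<close> below 1, so no difference of
  heights outweighs a single opened move.\<close>

definition eps :: real where "eps = 1 / (card Fs + 1)"

definition height :: "'f set set \<Rightarrow> real" where
  "height x = eps * card (dirs x)"

definition climb :: "'f set set \<Rightarrow> 'f set set \<Rightarrow> real" where
  "climb x y = height y - height x - card (opened x y)"

text \<open>The difference of heights is strictly between 0 and 1 and the number of opened moves is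
  an integer, so the sign is decided by whether that number is 0.\<close>

lemma climb_sign:
  assumes v: "v \<subseteq> Fs" "S \<subset> T" "T \<in> N"
  shows "0 < climb (cube v S) (cube v T) \<longleftrightarrow> (\<forall>F\<in>T. inh v S F = StO)"
    and "climb (cube v S) (cube v T) < 0 \<longleftrightarrow> \<not> (\<forall>F\<in>T. inh v S F = StO)"
proof -
  have sub: "S \<subseteq> T" "S \<subseteq> Fs" "T \<subseteq> Fs" using v N_sub by blast+
  have fin: "finite T" using sub(3) finFs by (rule finite_subset)
  have eps: "eps > 0" by (simp add: eps_def)
  define a where "a = height (cube v T) - height (cube v S)"
  have a: "a = eps * (real (card T) - real (card S))"
    unfolding a_def height_def dirs_cube[OF v(1) sub(2)] dirs_cube[OF v(1) sub(3)] by (simp add: algebra_simps)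
  have "card S < card T" using psubset_card_mono[OF fin v(2)] .
  then have a0: "0 < a" unfolding a using eps by simp
  have "card T \<le> card Fs" using card_mono[OF finFs sub(3)] .
  then have "a \<le> eps * card Fs" unfolding a using eps by (intro mult_left_mono) auto
  also have "\<dots> < 1" by (simp add: eps_def)
  finally have a1: "a < 1" .
  have fo: "finite (opened (cube v S) (cube v T))" using finMs by (simp add: opened_def)
  have cl: "climb (cube v S) (cube v T) = a - card (opened (cube v S) (cube v T))" by (simp add: climb_def a_def)
  have e: "opened (cube v S) (cube v T) = {} \<longleftrightarrow> (\<forall>F\<in>T. inh v S F = StO)" by (rule opened_empty_iff[OF v(1) sub(1,3)])
  have "climb (cube v S) (cube v T) < 0" if "opened (cube v S) (cube v T) \<noteq> {}"
  proof -
    have "card (opened (cube v S) (cube v T)) \<ge> 1" using that fo by (simp add: Suc_le_eq card_gt_0_iff)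
    then show ?thesis using a1 cl by linarith
  qed
  moreover have "0 < climb (cube v S) (cube v T)" if "opened (cube v S) (cube v T) = {}" using that a0 cl by simp
  ultimately show "0 < climb (cube v S) (cube v T) \<longleftrightarrow> (\<forall>F\<in>T. inh v S F = StO)"
    "climb (cube v S) (cube v T) < 0 \<longleftrightarrow> \<not> (\<forall>F\<in>T. inh v S F = StO)"
    unfolding e[symmetric] by force+
qed

lemma cube_in: "v \<subseteq> Fs \<Longrightarrow> S \<in> N \<Longrightarrow> cube v S \<in> cubes"
  by (auto simp: cubes_def)

lemma cube_psubset:
  assumes "v \<subseteq> Fs" "S \<subseteq> Fs" "T \<subseteq> Fs"
  shows "cube v S \<subset> cube v T \<longleftrightarrow> S \<subset> T" "cube v S \<subseteq> cube v T \<longleftrightarrow> S \<subseteq> T"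
proof -
  have v: "vadd v v \<subseteq> R" for R by (auto simp: vadd_def)
  show "cube v S \<subseteq> cube v T \<longleftrightarrow> S \<subseteq> T" using cube_subset_iff[OF assms(1,1,2,3)] v by simp
  then show "cube v S \<subset> cube v T \<longleftrightarrow> S \<subset> T"
    using cube_subset_iff[OF assms(1,1,3,2)] v unfolding less_le_not_le by simp
qed

sublocale circle_cocycle cubes height climb
proof
  show "finite cubes" by (rule finite_cubes)
next
  fix x y z assume *: "x \<in> cubes" "y \<in> cubes" "z \<in> cubes" "x \<subseteq> y" "y \<subseteq> z"
  obtain v S where v: "v \<subseteq> Fs" "S \<in> N" "x = cube v S" using *(1) by (auto simp: cubes_def)
  obtain T where T: "T \<in> N" "y = cube v T" "S \<subseteq> T" using cube_above[OF v(1,2) *(2)] *(4) v(3) by blast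
  obtain U where U: "U \<in> N" "z = cube v U" "T \<subseteq> U" using cube_above[OF v(1) T(1) *(3)] *(5) T(2) by blast
  show "climb x z = climb x y + climb y z"
    unfolding climb_def v(3) T(2) U(2) using opened_add[OF v(1) T(3) U(3,1)] by simp
next
  fix x y assume "x \<in> cubes" "y \<in> cubes" "x \<subseteq> y"
  have "climb x y - (height y - height x) = - real (card (opened x y))" by (simp add: climb_def)
  then show "climb x y - (height y - height x) \<in> \<int>" by simp
next
  fix x y assume *: "x \<in> cubes" "y \<in> cubes" "x \<subset> y"
  obtain v S where v: "v \<subseteq> Fs" "S \<in> N" "x = cube v S" using *(1) by (auto simp: cubes_def)
  obtain T where T: "T \<in> N" "y = cube v T" "S \<subseteq> T" using cube_above[OF v(1,2) *(2)] *(3) v(3) by blast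
  have "S \<subset> T" using *(3) T v by auto
  then show "climb x y \<noteq> 0" using climb_sign[OF v(1) _ T(1), of S] unfolding v(3) T(2) by linarith
qed

end

lemma status_neq: "s \<noteq> StO \<longleftrightarrow> s = StI" "s \<noteq> StI \<longleftrightarrow> s = StO"
  by (cases s; simp)+

section \<open>The cubes above and below a barycentre\<close>

context cube_moves
begin

definition upper :: "'f set \<Rightarrow> 'f set \<Rightarrow> status \<Rightarrow> 'f set set set" where
  "upper v D b = {cube v (D \<union> R) |R. R \<noteq> {} \<and> R \<inter> D = {} \<and> D \<union> R \<in> N \<and> (\<forall>F\<in>R. inh v D F = b)}"

definition upper_mixed :: "'f set \<Rightarrow> 'f set \<Rightarrow> 'f set set set" where
  "upper_mixed v D = {cube v (D \<union> R) |R. R \<noteq> {} \<and> R \<inter> D = {} \<and> D \<union> R \<in> N \<and> (\<exists>F\<in>R. inh v D F = StI)}"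

text \<open>With \<open>b\<close> = True the lift rises from the face to the cube, so these faces
  form the lower part of the descending link; False gives that of the ascending link.\<close>

definition lower :: "'f set \<Rightarrow> 'f set \<Rightarrow> bool \<Rightarrow> 'f set set set" where
  "lower v D b = {cube w S |w S. w \<in> cube v D \<and> S \<subset> D \<and> (\<forall>F\<in>D. inh w S F = StO) = b}"

lemma inh_own: "D \<subseteq> Fs \<Longrightarrow> F \<in> D \<Longrightarrow> inh v D F = StO"
  unfolding inh_def using move_ex[of F] by auto

lemma upper_cells:
  assumes v: "v \<subseteq> Fs" "D \<in> N"
  shows "{y \<in> cubes. cube v D \<subset> y \<and> 0 < climb (cube v D) y} = upper v D StO"
    and "{y \<in> cubes. cube v D \<subset> y \<and> climb (cube v D) y < 0} = upper_mixed v D"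
proof -
  have D: "D \<subseteq> Fs" using N_sub v(2) .
  have *: "y \<in> cubes \<and> cube v D \<subset> y \<longleftrightarrow> (\<exists>R. R \<noteq> {} \<and> R \<inter> D = {} \<and> D \<union> R \<in> N \<and> y = cube v (D \<union> R))" for y
  proof
    assume y: "y \<in> cubes \<and> cube v D \<subset> y"
    then obtain T where T: "T \<in> N" "y = cube v T" "D \<subseteq> T" using cube_above[OF v, of y] by auto
    then have "T - D \<noteq> {}" using y by auto
    then show "\<exists>R. R \<noteq> {} \<and> R \<inter> D = {} \<and> D \<union> R \<in> N \<and> y = cube v (D \<union> R)"
      using T by (intro exI[of _ "T - D"]) (auto simp: Un_absorb1)
  next
    assume "\<exists>R. R \<noteq> {} \<and> R \<inter> D = {} \<and> D \<union> R \<in> N \<and> y = cube v (D \<union> R)"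
    then obtain R where R: "R \<noteq> {}" "R \<inter> D = {}" "D \<union> R \<in> N" "y = cube v (D \<union> R)" by auto
    have "D \<subset> D \<union> R" using R by auto
    then show "y \<in> cubes \<and> cube v D \<subset> y"
      using R cube_in[OF v(1)] cube_psubset(1)[OF v(1) D N_sub[OF R(3)]] by auto
  qed
  have sgn: "0 < climb (cube v D) (cube v (D \<union> R)) \<longleftrightarrow> (\<forall>F\<in>R. inh v D F = StO)"
    "climb (cube v D) (cube v (D \<union> R)) < 0 \<longleftrightarrow> (\<exists>F\<in>R. inh v D F = StI)"
    if "R \<noteq> {}" "R \<inter> D = {}" "D \<union> R \<in> N" for R
  proof -
    have s: "D \<subset> D \<union> R" using that by auto
    have "(\<forall>F\<in>D \<union> R. inh v D F = StO) \<longleftrightarrow> (\<forall>F\<in>R. inh v D F = StO)" using inh_own[OF D] by auto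
    then show "0 < climb (cube v D) (cube v (D \<union> R)) \<longleftrightarrow> (\<forall>F\<in>R. inh v D F = StO)"
      "climb (cube v D) (cube v (D \<union> R)) < 0 \<longleftrightarrow> (\<exists>F\<in>R. inh v D F = StI)"
      using climb_sign[OF v(1) s that(3)] by (auto simp: status_neq)
  qed
  show "{y \<in> cubes. cube v D \<subset> y \<and> 0 < climb (cube v D) y} = upper v D StO"
  proof (intro set_eqI)
    fix y
    have "y \<in> {y \<in> cubes. cube v D \<subset> y \<and> 0 < climb (cube v D) y} \<longleftrightarrow>
        (\<exists>R. R \<noteq> {} \<and> R \<inter> D = {} \<and> D \<union> R \<in> N \<and> y = cube v (D \<union> R)) \<and> 0 < climb (cube v D) y"
      by (simp only: mem_Collect_eq conj_assoc[symmetric] *)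
    also have "\<dots> \<longleftrightarrow> (\<exists>R. y = cube v (D \<union> R) \<and> R \<noteq> {} \<and> R \<inter> D = {} \<and> D \<union> R \<in> N \<and> (\<forall>F\<in>R. inh v D F = StO))"
      using sgn(1) by metis
    finally show "y \<in> {y \<in> cubes. cube v D \<subset> y \<and> 0 < climb (cube v D) y} \<longleftrightarrow> y \<in> upper v D StO"
      unfolding upper_def by simp
  qed
  show "{y \<in> cubes. cube v D \<subset> y \<and> climb (cube v D) y < 0} = upper_mixed v D"
  proof (intro set_eqI)
    fix y
    have "y \<in> {y \<in> cubes. cube v D \<subset> y \<and> climb (cube v D) y < 0} \<longleftrightarrow>
        (\<exists>R. R \<noteq> {} \<and> R \<inter> D = {} \<and> D \<union> R \<in> N \<and> y = cube v (D \<union> R)) \<and> climb (cube v D) y < 0"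
      by (simp only: mem_Collect_eq conj_assoc[symmetric] *)
    also have "\<dots> \<longleftrightarrow> (\<exists>R. y = cube v (D \<union> R) \<and> R \<noteq> {} \<and> R \<inter> D = {} \<and> D \<union> R \<in> N \<and> (\<exists>F\<in>R. inh v D F = StI))"
      using sgn(2) by metis
    finally show "y \<in> {y \<in> cubes. cube v D \<subset> y \<and> climb (cube v D) y < 0} \<longleftrightarrow> y \<in> upper_mixed v D"
      unfolding upper_mixed_def by simp
  qed
qed

lemma lower_cells:
  assumes v: "v \<subseteq> Fs" "D \<in> N"
  shows "{y \<in> cubes. y \<subset> cube v D \<and> climb y (cube v D) < 0} = lower v D False"
    and "{y \<in> cubes. y \<subset> cube v D \<and> 0 < climb y (cube v D)} = lower v D True"
proof -
  have D: "D \<subseteq> Fs" using N_sub v(2) .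
  have *: "y \<in> cubes \<and> y \<subset> cube v D \<longleftrightarrow> (\<exists>w S. w \<in> cube v D \<and> S \<subset> D \<and> y = cube w S)" for y
  proof
    assume y: "y \<in> cubes \<and> y \<subset> cube v D"
    then obtain w S where w: "w \<in> cube v D" "S \<subseteq> D" "y = cube w S" using cube_below[OF v, of y] by auto
    have "S \<noteq> D" using y w cube_cong[OF v(1) w(1)] by auto
    then show "\<exists>w S. w \<in> cube v D \<and> S \<subset> D \<and> y = cube w S" using w by auto
  next
    assume "\<exists>w S. w \<in> cube v D \<and> S \<subset> D \<and> y = cube w S"
    then obtain w S where w: "w \<in> cube v D" "S \<subset> D" "y = cube w S" by auto
    have wF: "w \<subseteq> Fs" using cube_sub[OF w(1)] .
    have "S \<in> N" using N_down[OF v(2)] w(2) by auto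
    then show "y \<in> cubes \<and> y \<subset> cube v D"
      using cube_in[OF wF] cube_psubset(1)[OF wF _ D, of S] w cube_cong[OF v(1) w(1)] D by auto
  qed
  have sgn: "0 < climb (cube w S) (cube v D) \<longleftrightarrow> (\<forall>F\<in>D. inh w S F = StO)"
    "climb (cube w S) (cube v D) < 0 \<longleftrightarrow> \<not> (\<forall>F\<in>D. inh w S F = StO)"
    if "w \<in> cube v D" "S \<subset> D" for w S
    using climb_sign[OF cube_sub[OF that(1)] that(2) v(2)] cube_cong[OF v(1) that(1)] by simp_all
  show "{y \<in> cubes. y \<subset> cube v D \<and> climb y (cube v D) < 0} = lower v D False"
  proof (intro set_eqI)
    fix y
    have "y \<in> {y \<in> cubes. y \<subset> cube v D \<and> climb y (cube v D) < 0} \<longleftrightarrow>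
        (\<exists>w S. w \<in> cube v D \<and> S \<subset> D \<and> y = cube w S) \<and> climb y (cube v D) < 0"
      by (simp only: mem_Collect_eq conj_assoc[symmetric] *)
    also have "\<dots> \<longleftrightarrow> (\<exists>w S. y = cube w S \<and> w \<in> cube v D \<and> S \<subset> D \<and> (\<forall>F\<in>D. inh w S F = StO) = False)"
      using sgn(2) by metis
    finally show "y \<in> {y \<in> cubes. y \<subset> cube v D \<and> climb y (cube v D) < 0} \<longleftrightarrow> y \<in> lower v D False"
      unfolding lower_def by simp
  qed
  show "{y \<in> cubes. y \<subset> cube v D \<and> 0 < climb y (cube v D)} = lower v D True"
  proof (intro set_eqI)
    fix y
    have "y \<in> {y \<in> cubes. y \<subset> cube v D \<and> 0 < climb y (cube v D)} \<longleftrightarrow>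
        (\<exists>w S. w \<in> cube v D \<and> S \<subset> D \<and> y = cube w S) \<and> 0 < climb y (cube v D)"
      by (simp only: mem_Collect_eq conj_assoc[symmetric] *)
    also have "\<dots> \<longleftrightarrow> (\<exists>w S. y = cube w S \<and> w \<in> cube v D \<and> S \<subset> D \<and> (\<forall>F\<in>D. inh w S F = StO) = True)"
      using sgn(1) by metis
    finally show "y \<in> {y \<in> cubes. y \<subset> cube v D \<and> 0 < climb y (cube v D)} \<longleftrightarrow> y \<in> lower v D True"
      unfolding lower_def by simp
  qed
qed

text \<open>Every cell of the lower part is contained in every cell of the upper part, with the cube
  itself in between, so a chain in the link is a free combination of a chain in each part.\<close>

lemma links_join:
  assumes v: "v \<subseteq> Fs" "D \<in> N"
  shows "ascending_link (sd cubes) circle_map (cube v D) = join (sd (lower v D False)) (sd (upper v D StO))"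
    and "descending_link (sd cubes) circle_map (cube v D) = join (sd (lower v D True)) (sd (upper_mixed v D))"
    and "\<And>a b. a \<in> lower v D c \<Longrightarrow> b \<in> upper v D s \<union> upper_mixed v D \<Longrightarrow> a \<subset> b"
    and "lower v D c \<subseteq> cubes" "upper v D s \<subseteq> cubes" "upper_mixed v D \<subseteq> cubes"
proof -
  let ?x = "cube v D"
  have lo: "a \<in> cubes \<and> a \<subset> ?x" if "a \<in> lower v D c" for a c
    using that lower_cells[OF v] by (cases c) auto
  have up: "b \<in> cubes \<and> ?x \<subset> b" if "b \<in> upper v D s" for b s
  proof -
    obtain R where R: "R \<noteq> {}" "R \<inter> D = {}" "D \<union> R \<in> N" "b = cube v (D \<union> R)" using \<open>b \<in> upper v D s\<close> by (auto simp: upper_def)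
    have "D \<subset> D \<union> R" using R by auto
    then show ?thesis
      using R cube_in[OF v(1)] cube_psubset(1)[OF v(1) N_sub[OF v(2)] N_sub[OF R(3)]] by auto
  qed
  have um: "b \<in> cubes \<and> ?x \<subset> b" if "b \<in> upper_mixed v D" for b
    using that upper_cells(2)[OF v] by auto
  show lu: "a \<subset> b" if "a \<in> lower v D c" "b \<in> upper v D s \<union> upper_mixed v D" for a b c s
    using lo[OF that(1)] up um that(2) by (meson UnE psubset_trans)
  show "lower v D c \<subseteq> cubes" "upper v D s \<subseteq> cubes" "upper_mixed v D \<subseteq> cubes" using lo up um by auto
  have "{y \<in> cubes. ?x \<subset> y \<and> 0 < climb ?x y \<or> y \<subset> ?x \<and> climb y ?x < 0} = lower v D False \<union> upper v D StO"
    using lower_cells(1)[OF v] upper_cells(1)[OF v] by auto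
  moreover have "sd (lower v D False \<union> upper v D StO) = join (sd (lower v D False)) (sd (upper v D StO))"
    by (intro sd_Un psubset_imp_subset lu[where c=False and s=StO] UnI1)
  ultimately show "ascending_link (sd cubes) circle_map ?x = join (sd (lower v D False)) (sd (upper v D StO))"
    using links_circle_map(1)[OF cube_in[OF v]] by simp
  have "{y \<in> cubes. ?x \<subset> y \<and> climb ?x y < 0 \<or> y \<subset> ?x \<and> 0 < climb y ?x} = lower v D True \<union> upper_mixed v D"
    using lower_cells(2)[OF v] upper_cells(2)[OF v] by auto
  moreover have "sd (lower v D True \<union> upper_mixed v D) = join (sd (lower v D True)) (sd (upper_mixed v D))"
    by (intro sd_Un psubset_imp_subset lu[where c=True and s=StO] UnI2)
  ultimately show "descending_link (sd cubes) circle_map ?x = join (sd (lower v D True)) (sd (upper_mixed v D))"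
    using links_circle_map(2)[OF cube_in[OF v]] by simp
qed

text \<open>Forgetting the facets with status \<open>O\<close> retracts the upper part of the descending link.\<close>

lemma upper_mixed_retract:
  assumes v: "v \<subseteq> Fs" "D \<in> N"
  shows "strong_step\<^sup>*\<^sup>* (sd (upper_mixed v D)) (sd (upper v D StI))"
proof -
  have D: "D \<subseteq> Fs" using N_sub v(2) .
  define r where "r y = cube v (D \<union> {F \<in> dirs y. inh v D F = StI})" for y
  have DI: "inh v D F \<noteq> StI" if "F \<in> D" for F using inh_own[OF D that] by simp
  have r: "r (cube v (D \<union> R)) = cube v (D \<union> {F \<in> R. inh v D F = StI})" if "D \<union> R \<in> N" for R
  proof -
    have "{F \<in> dirs (cube v (D \<union> R)). inh v D F = StI} = {F \<in> R. inh v D F = StI}"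
      using dirs_cube[OF v(1) N_sub[OF that]] DI by auto
    then show ?thesis by (simp add: r_def)
  qed
  have sub: "D \<union> {F \<in> R. inh v D F = StI} \<in> N" if "D \<union> R \<in> N" for R
    by (rule N_down[OF that]) auto
  have rin: "r y \<in> upper v D StI" "r y \<subseteq> y" "r (r y) = r y" if "y \<in> upper_mixed v D" for y
  proof -
    obtain R where R: "R \<inter> D = {}" "D \<union> R \<in> N" "y = cube v (D \<union> R)" "\<exists>F\<in>R. inh v D F = StI"
      using \<open>y \<in> upper_mixed v D\<close> unfolding upper_mixed_def by auto
    let ?R = "{F \<in> R. inh v D F = StI}"
    show "r y \<in> upper v D StI"
      unfolding upper_def R(3) r[OF R(2)] using R sub[OF R(2)] by (intro CollectI exI[of _ ?R]) auto
    show "r y \<subseteq> y"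
      unfolding R(3) r[OF R(2)] cube_psubset(2)[OF v(1) N_sub[OF sub[OF R(2)]] N_sub[OF R(2)]] by auto
    show "r (r y) = r y" unfolding R(3) r[OF R(2)] r[OF sub[OF R(2)]] by simp
  qed
  have fixed: "r y = y" and um: "y \<in> upper_mixed v D" if "y \<in> upper v D StI" for y
  proof -
    obtain R where R: "R \<noteq> {}" "R \<inter> D = {}" "D \<union> R \<in> N" "y = cube v (D \<union> R)" "\<forall>F\<in>R. inh v D F = StI"
      using \<open>y \<in> upper v D StI\<close> unfolding upper_def by auto
    have "{F \<in> R. inh v D F = StI} = R" using R(5) by auto
    then show "r y = y" unfolding R(4) r[OF R(3)] by simp
    show "y \<in> upper_mixed v D" unfolding upper_mixed_def using R by auto
  qed
  have "strong_step\<^sup>*\<^sup>* (sd (upper_mixed v D)) (sd (r ` upper_mixed v D))"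
  proof (rule sd_closure)
    show "finite (upper_mixed v D)" using links_join(6)[OF v] finite_cubes by (rule finite_subset)
    show "r y \<in> upper_mixed v D \<and> r (r y) = r y" if "y \<in> upper_mixed v D" for y
      using rin[OF that] um by auto
    show "r y \<subseteq> r z" if "y \<in> upper_mixed v D" "z \<in> upper_mixed v D" "y \<subseteq> z" for y z
    proof -
      obtain R where R: "D \<union> R \<in> N" "y = cube v (D \<union> R)" using \<open>y \<in> upper_mixed v D\<close> unfolding upper_mixed_def by auto
      obtain T where T: "D \<union> T \<in> N" "z = cube v (D \<union> T)" using \<open>z \<in> upper_mixed v D\<close> unfolding upper_mixed_def by auto
      have "D \<union> R \<subseteq> D \<union> T" using \<open>y \<subseteq> z\<close> cube_psubset(2)[OF v(1) N_sub[OF R(1)] N_sub[OF T(1)]] R T by simp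
      then have "D \<union> {F \<in> R. inh v D F = StI} \<subseteq> D \<union> {F \<in> T. inh v D F = StI}" by auto
      then show ?thesis
        unfolding R(2) T(2) r[OF R(1)] r[OF T(1)]
        using cube_psubset(2)[OF v(1) N_sub[OF sub[OF R(1)]] N_sub[OF sub[OF T(1)]]] by simp
    qed
    show "(\<forall>y\<in>upper_mixed v D. r y \<subseteq> y) \<or> (\<forall>y\<in>upper_mixed v D. y \<subseteq> r y)" using rin(2) by auto
  qed
  moreover have "r ` upper_mixed v D = upper v D StI"
  proof (intro equalityI subsetI)
    fix y assume "y \<in> upper v D StI"
    then show "y \<in> r ` upper_mixed v D" using fixed um by (metis imageI)
  qed (use rin(1) in auto)
  ultimately show ?thesis by simp
qed

text \<open>If a move contains a single defining facet \<open>F\<close>, the cube is a product of an edge with a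
  smaller cube; the map is monotone along the edge, so both parts of the boundary deform onto
  one end of the product.\<close>

lemma lower_collapsible:
  assumes v: "v \<subseteq> Fs" "D \<in> N" and A: "A \<in> Ms" "A \<inter> D = {F}"
  shows "collapsible (sd (lower v D c))"
proof -
  let ?x = "cube v D"
  have D: "D \<subseteq> Fs" using N_sub v(2) .
  have F: "F \<in> D" "F \<in> A" "F \<in> Fs" using A D by auto
  define flip where "flip u = vadd u {F}" for u
  \<comment> \<open>\<open>full\<close> is the product with the edge dual to \<open>F\<close>,
    \<open>side b\<close> the end of this product where \<open>F\<close> has status
    \<open>b\<close>, and \<open>T b\<close> says that a cube lies within that end.\<close>
  define full where "full y = y \<union> flip ` y" for y
  define side where "side b y = {u \<in> full y. st u F = b}" for b y
  define T where "T b y \<longleftrightarrow> (\<forall>u\<in>y. st u F = b)" for b y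
  have flip_flip: "flip (flip u) = u" for u by (simp add: flip_def vadd_simps)
  have flip_mem: "G \<in> flip u \<longleftrightarrow> (G \<in> u) \<noteq> (G = F)" for G u by (auto simp: flip_def in_vadd)
  have flip_x: "flip w \<in> ?x" if "w \<in> ?x" for w
    using that F(1) F(3) unfolding cube_def vadd_subset_iff flip_def by (auto simp: in_vadd vadd_def)
  have flip_st: "st (flip w) F = invert (st w F)" if "w \<subseteq> Fs" for w
    unfolding flip_def by (rule st_flip[OF that F(3)])
  have inv: "invert s \<noteq> s" "invert s = b \<longleftrightarrow> s \<noteq> b" for s b by (cases s; cases b; simp)+
  have x_sub: "w \<subseteq> Fs" if "w \<in> ?x" for w using cube_sub[OF that] .
  have cubeI: "w \<in> cube u S \<longleftrightarrow> w \<subseteq> Fs \<and> (\<forall>G. G \<notin> S \<longrightarrow> (G \<in> u \<longleftrightarrow> G \<in> w))" for w u S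
    by (simp add: cube_def vadd_subset_iff)
  have full_cube: "full (cube w S) = cube w (insert F S)" if w: "w \<in> ?x" "S \<subseteq> D" for w S
  proof (intro set_eqI iffI)
    fix u assume "u \<in> full (cube w S)"
    then consider "u \<in> cube w S" | u' where "u' \<in> cube w S" "u = flip u'" by (auto simp: full_def)
    then show "u \<in> cube w (insert F S)"
    proof cases
      case 2
      then have "u \<subseteq> Fs" using F(3) by (auto simp: flip_def vadd_def cubeI)
      then show ?thesis using 2 by (auto simp: cubeI flip_mem)
    qed (auto simp: cubeI)
  next
    fix u assume u: "u \<in> cube w (insert F S)"
    show "u \<in> full (cube w S)"
    proof (cases "F \<in> u \<longleftrightarrow> F \<in> w")
      case True
      then have "u \<in> cube w S" using u by (auto simp: cubeI)
      then show ?thesis by (simp add: full_def)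
    next
      case False
      have "flip u \<subseteq> Fs" using u F(3) by (auto simp: flip_def vadd_def cubeI)
      then have "flip u \<in> cube w S" using u False by (auto simp: cubeI flip_mem)
      then have "flip (flip u) \<in> full (cube w S)" by (auto simp: full_def)
      then show ?thesis by (simp add: flip_flip)
    qed
  qed
  \<comment> \<open>The status of \<open>F\<close> depends only on the coordinates in its own move,
    and there the cube \<open>?x\<close> varies in no direction but \<open>F\<close>.\<close>
  have st_same: "st u F = st w F" if "u \<subseteq> Fs" "w \<subseteq> Fs" "\<And>G. G \<in> A \<Longrightarrow> G \<in> u \<longleftrightarrow> G \<in> w" for u w
    by (rule st_cong[OF that(1,2) A(1) F(2)]) (use that(3) in auto)
  have AD: "G \<notin> S" if "S \<subseteq> D" "G \<in> A" "G \<noteq> F" for G S using A(2) that by auto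
  have Tcube: "T b (cube w S) \<longleftrightarrow> F \<notin> S \<and> st w F = b" if w: "w \<in> ?x" "S \<subseteq> D" for b w S
  proof
    assume t: "T b (cube w S)"
    have w1: "w \<in> cube w S" using cube_self[OF x_sub[OF w(1)]] .
    have "F \<notin> S"
    proof
      assume "F \<in> S"
      then have "flip w \<in> cube w S"
        using x_sub[OF w(1)] x_sub[OF flip_x[OF w(1)]] by (auto simp: cubeI flip_mem)
      then have "st (flip w) F = b" "st w F = b" using t w1 by (simp_all add: T_def)
      then show False using flip_st[OF x_sub[OF w(1)]] inv(1)[of b] by simp
    qed
    then show "F \<notin> S \<and> st w F = b" using t w1 by (simp add: T_def)
  next
    assume *: "F \<notin> S \<and> st w F = b"
    show "T b (cube w S)"
      unfolding T_def
    proof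
      fix u assume u: "u \<in> cube w S"
      have "st u F = st w F"
        by (rule st_same) (use u * AD[OF w(2)] x_sub[OF w(1)] in \<open>auto simp: cubeI\<close>)
      then show "st u F = b" using * by simp
    qed
  qed
  \<comment> \<open>The end with status \<open>b\<close> of the edge through \<open>w\<close> in the
    direction \<open>F\<close>.\<close>
  define wb where "wb b w = (if st w F = b then w else flip w)" for b w
  have wb: "wb b w \<in> ?x" "st (wb b w) F = b" if "w \<in> ?x" for b w
    using that flip_x[OF that] flip_st[OF x_sub[OF that]] inv(2) by (auto simp: wb_def)
  have side_cube: "side b (cube w S) = cube (wb b w) (S - {F})" if w: "w \<in> ?x" "S \<subseteq> D" for b w S
  proof -
    have "cube w (insert F S) = cube (wb b w) (insert F S)"
      by (rule cube_cong[symmetric]) (use x_sub[OF w(1)] x_sub[OF flip_x[OF w(1)]] in \<open>auto simp: cubeI wb_def flip_mem\<close>)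
    then have "side b (cube w S) = {u \<in> cube (wb b w) (insert F S). st u F = b}"
      by (simp add: side_def full_cube[OF w])
    also have "\<dots> = cube (wb b w) (S - {F})"
    proof (intro set_eqI iffI)
      fix u assume u: "u \<in> {u \<in> cube (wb b w) (insert F S). st u F = b}"
      have "F \<in> u \<longleftrightarrow> F \<in> wb b w"
      proof (rule ccontr)
        assume n: "\<not> (F \<in> u \<longleftrightarrow> F \<in> wb b w)"
        have uF: "u \<subseteq> Fs" using u by (auto simp: cubeI)
        have "G \<in> u \<longleftrightarrow> G \<in> flip (wb b w)" if "G \<in> A" for G
        proof (cases "G = F")
          case False
          then have "G \<notin> insert F S" using AD[OF w(2) that] by auto
          then show ?thesis using u False unfolding mem_Collect_eq cubeI flip_mem by blast
        qed (use n in \<open>simp add: flip_mem\<close>)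
        then have "st u F = st (flip (wb b w)) F"
          by (rule st_same[OF uF x_sub[OF flip_x[OF wb(1)[OF w(1)]]]])
        then show False using u flip_st[OF x_sub[OF wb(1)[OF w(1)]]] wb(2)[OF w(1)] inv(1) by auto
      qed
      then show "u \<in> cube (wb b w) (S - {F})" using u by (auto simp: cubeI)
    next
      fix u assume u: "u \<in> cube (wb b w) (S - {F})"
      have "G \<in> u \<longleftrightarrow> G \<in> wb b w" if "G \<in> A" for G
      proof -
        have "G \<notin> S - {F}" using AD[OF w(2) that] by auto
        then show ?thesis using u unfolding cubeI by blast
      qed
      then have "st u F = st (wb b w) F"
        by (rule st_same[OF cube_sub[OF u] x_sub[OF wb(1)[OF w(1)]]])
      then show "u \<in> {u \<in> cube (wb b w) (insert F S). st u F = b}" using u wb(2)[OF w(1)] by (auto simp: cubeI)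
    qed
    finally show ?thesis .
  qed
  \<comment> \<open>An inherited \<open>I\<close> at a defining facet other than \<open>F\<close>.
    It is independent of the coordinate \<open>F\<close>, since no other defining facet lies in the
    move of \<open>F\<close>.\<close>
  define cnd where "cnd w S \<longleftrightarrow> (\<exists>G\<in>D - {F}. inh w S G = StI)" for w S
  have cnd_cong: "cnd w S = cnd w' S'"
    if w: "w \<in> ?x" "w' \<in> ?x" "\<And>G. G \<noteq> F \<Longrightarrow> G \<in> w \<longleftrightarrow> G \<in> w'" "\<And>G. G \<noteq> F \<Longrightarrow> G \<in> S \<longleftrightarrow> G \<in> S'" for w w' S S'
  proof -
    have "inh w S G = inh w' S' G" if G: "G \<in> D - {F}" for G
    proof -
      obtain B where B: "B \<in> Ms" "G \<in> B" using move_ex[of G] G D by auto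
      have FB: "F \<notin> B"
      proof
        assume "F \<in> B"
        then have "B = A" using move_unique[OF B(1) A(1)] F(2) by simp
        then show False using A(2) G B by auto
      qed
      have u: "B' = B" if "B' \<in> Ms" "G \<in> B'" for B' using move_unique[OF that(1) B(1) that(2) B(2)] .
      have ne: "H \<noteq> F" if "H \<in> B" for H using that FB by auto
      have 1: "(\<forall>B'\<in>Ms. G \<in> B' \<longrightarrow> B' \<inter> R = {}) \<longleftrightarrow> B \<inter> R = {}" for R by (metis u B)
      have 2: "B \<inter> S = {} \<longleftrightarrow> B \<inter> S' = {}" using w(4) ne by auto
      have 3: "st w G = st w' G"
        by (rule st_cong[OF x_sub[OF w(1)] x_sub[OF w(2)] B]) (use w(3) ne in auto)
      show ?thesis unfolding inh_def 1 using 2 3 by simp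
    qed
    then show ?thesis unfolding cnd_def by simp
  qed
  have neg: "\<not> (\<forall>G\<in>D. inh w S G = StO) \<longleftrightarrow> cnd w S \<or> F \<notin> S \<and> st w F = StI"
    if w: "w \<in> ?x" "S \<subseteq> D" for w S
  proof -
    have u: "B = A" if "B \<in> Ms" "F \<in> B" for B using move_unique[OF that(1) A(1) that(2) F(2)] .
    have 1: "(\<forall>B\<in>Ms. F \<in> B \<longrightarrow> B \<inter> S = {}) \<longleftrightarrow> A \<inter> S = {}" by (metis u A(1) F(2))
    have 2: "A \<inter> S = {} \<longleftrightarrow> F \<notin> S" using AD[OF w(2)] F(2) by auto
    have "inh w S F = StI \<longleftrightarrow> F \<notin> S \<and> st w F = StI" unfolding inh_def 1 2 by simp
    moreover have "\<not> (\<forall>G\<in>D. inh w S G = StO) \<longleftrightarrow> (\<exists>G\<in>D. inh w S G = StI)" by (simp add: status_neq)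
    moreover have "D = insert F (D - {F})" using F(1) by auto
    then have "(\<exists>G\<in>D. inh w S G = StI) \<longleftrightarrow> inh w S F = StI \<or> cnd w S" unfolding cnd_def by blast
    ultimately show ?thesis by auto
  qed
  have cndD: "\<not> cnd w D" if "w \<in> ?x" for w
    unfolding cnd_def using inh_own[OF D] by auto
  have low: "y \<in> lower v D c \<longleftrightarrow> (\<exists>w S. y = cube w S \<and> w \<in> ?x \<and> S \<subset> D \<and> (cnd w S \<or> F \<notin> S \<and> st w F = StI) = (\<not> c))" for y c
  proof -
    have k: "(\<forall>G\<in>D. inh w S G = StO) = c \<longleftrightarrow> (cnd w S \<or> F \<notin> S \<and> st w F = StI) = (\<not> c)" if "w \<in> ?x" "S \<subset> D" for w S
      using neg[of w S] that by auto
    have "y \<in> lower v D c \<longleftrightarrow> (\<exists>w S. y = cube w S \<and> w \<in> ?x \<and> S \<subset> D \<and> (\<forall>G\<in>D. inh w S G = StO) = c)"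
      unfolding lower_def by (rule mem_Collect_eq)
    also have "\<dots> \<longleftrightarrow> (\<exists>w S. y = cube w S \<and> w \<in> ?x \<and> S \<subset> D \<and> (cnd w S \<or> F \<notin> S \<and> st w F = StI) = (\<not> c))"
      by (intro ex_cong1 conj_cong refl k)
    finally show ?thesis .
  qed
  have ysub: "y \<subseteq> ?x" if "y \<in> lower v D c" for y c
    using that lower_cells[OF v] by (cases c) auto
  have fin: "finite (lower v D c)" for c
    using links_join(4)[OF v, of c] finite_cubes by (rule finite_subset)
  have full_mono: "full y \<subseteq> full z" if "y \<subseteq> z" for y z using that by (auto simp: full_def)
  have side_mono: "side b y \<subseteq> side b z" if "y \<subseteq> z" for b y z using full_mono[OF that] by (auto simp: side_def)
  have wb_mem: "G \<in> wb b w \<longleftrightarrow> G \<in> w" if "G \<noteq> F" for G b w using that by (auto simp: wb_def flip_mem)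
  have cnd_wb: "cnd (wb b w) (S - {F}) = cnd w S" if "w \<in> ?x" for b w S
    by (rule cnd_cong[OF wb(1)[OF that] that]) (auto simp: wb_mem)
  have vx: "v \<in> ?x" using cube_self[OF v(1)] .
  have DF: "S - {F} \<subset> D" if "S \<subseteq> D" for S using that F(1) by auto
  have side_side: "side b (side b (cube w S)) = side b (cube w S)" if w: "w \<in> ?x" "S \<subseteq> D" for b w S
  proof -
    have "side b (cube (wb b w) (S - {F})) = cube (wb b (wb b w)) (S - {F} - {F})"
      by (rule side_cube[OF wb(1)[OF w(1)]]) (use w in auto)
    moreover have "wb b (wb b w) = wb b w" using wb(2)[OF w(1)] by (simp add: wb_def[of b "wb b w"])
    ultimately show ?thesis unfolding side_cube[OF w] by simp
  qed
  have side_sub: "side b (cube w S) \<subseteq> cube w S" if w: "w \<in> ?x" "S \<subseteq> D" "F \<in> S \<or> st w F = b" for b w S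
  proof
    fix u assume u: "u \<in> side b (cube w S)"
    show "u \<in> cube w S"
    proof (cases "F \<in> S")
      case True
      then have "full (cube w S) = cube w S" using full_cube[OF w(1,2)] by (simp add: insert_absorb)
      then show ?thesis using u by (simp add: side_def)
    next
      case False
      then have "side b (cube w S) = cube w S" unfolding side_cube[OF w(1,2)] using w(3) by (simp add: wb_def)
      then show ?thesis using u by simp
    qed
  qed
  show ?thesis
  proof (cases c)
    case True
    \<comment> \<open>Here \<open>F\<close> is a direction of the face or has status
      \<open>O\<close> on it, so every cell meets the \<open>O\<close> end. Intersecting with this
      end is a decreasing retraction, and the whole end is the largest element of the image.\<close>
    let ?L = "lower v D True" and ?r = "side StO"
    have r: "?r y \<in> ?L \<and> ?r (?r y) = ?r y \<and> ?r y \<subseteq> y" if "y \<in> ?L" for y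
    proof -
      obtain w S where w: "y = cube w S" "w \<in> ?x" "S \<subset> D" "\<not> cnd w S" "F \<in> S \<or> st w F \<noteq> StI"
        using iffD1[OF low \<open>y \<in> ?L\<close>] by auto
      then have S: "S \<subseteq> D" "F \<in> S \<or> st w F = StO" by (auto simp: status_neq)
      have "cube (wb StO w) (S - {F}) \<in> ?L"
        unfolding low using wb[OF w(2), of StO] cnd_wb[OF w(2), of StO S] w(4) DF[OF S(1)]
        by (intro exI[of _ "wb StO w"] exI[of _ "S - {F}"]) simp
      then show ?thesis using side_side[OF w(2) S(1)] side_sub[OF w(2) S] side_cube[OF w(2) S(1)] w(1) by simp
    qed
    have e: "side StO ?x \<in> ?L"
    proof -
      have "side StO ?x = cube (wb StO v) (D - {F})" by (rule side_cube[OF vx]) simp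
      moreover have "\<not> cnd (wb StO v) (D - {F})" using cnd_wb[OF vx, of StO D] cndD[OF vx] by simp
      ultimately show ?thesis unfolding low using wb[OF vx, of StO] DF[of D]
        by (intro exI[of _ "wb StO v"] exI[of _ "D - {F}"]) simp
    qed
    have "collapsible (sd (?r ` ?L))"
    proof (rule collapsible_sd_apex)
      show "finite (?r ` ?L)" using fin by simp
      show "side StO ?x \<in> ?r ` ?L" using e side_side[OF vx order_refl, of StO] by (metis imageI)
      show "(\<forall>q\<in>?r ` ?L. q \<subseteq> side StO ?x) \<or> (\<forall>q\<in>?r ` ?L. side StO ?x \<subseteq> q)"
        using side_mono ysub by blast
    qed
    then have "collapsible (sd ?L)"
      by (rule sd_retract_collapsible[OF fin, rotated 3]) (use r side_mono in auto)
    then show ?thesis using True by simp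
  next
    case False
    let ?L = "lower v D False"
    \<comment> \<open>A cell inside the \<open>O\<close> end belongs to \<open>?L\<close> only
      because of \<open>cnd\<close>, which survives thickening by the edge. After this enlargement
      every cell meets the \<open>I\<close> end and can be shrunk to it.\<close>
    define r1 where "r1 y = (if T StO y then full y else y)" for y
    have L: "\<exists>w S. y = cube w S \<and> w \<in> ?x \<and> S \<subseteq> D \<and> (cnd w S \<or> F \<notin> S \<and> st w F = StI)" if "y \<in> ?L" for y
      using iffD1[OF low that] by auto
    have LI: "cube w S \<in> ?L" if "w \<in> ?x" "S \<subseteq> D" "cnd w S \<or> F \<notin> S \<and> st w F = StI" for w S
    proof -
      have "S \<noteq> D" using that cndD[OF that(1)] F(1) by auto
      then show ?thesis unfolding low using that by (intro exI[of _ w] exI[of _ S]) auto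
    qed
    have r1: "r1 y \<in> ?L \<and> r1 (r1 y) = r1 y \<and> y \<subseteq> r1 y \<and> \<not> T StO (r1 y)" if "y \<in> ?L" for y
    proof (cases "T StO y")
      case False
      then show ?thesis using that by (simp add: r1_def)
    next
      case True
      obtain w S where w: "y = cube w S" "w \<in> ?x" "S \<subseteq> D" "cnd w S \<or> F \<notin> S \<and> st w F = StI" using L[OF \<open>y \<in> ?L\<close>] by blast
      have t: "F \<notin> S" "st w F = StO" using True Tcube[OF w(2,3)] w(1) by auto
      have fy: "r1 y = cube w (insert F S)" using True full_cube[OF w(2,3)] w(1) by (simp add: r1_def)
      have FS: "insert F S \<subseteq> D" using w(3) F(1) by auto
      have nT: "\<not> T StO (r1 y)" unfolding fy using Tcube[OF w(2) FS] by simp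
      have "cnd w (insert F S)" using w(4) t cnd_cong[OF w(2,2), of S "insert F S"] by auto
      then have "r1 y \<in> ?L" unfolding fy by (intro LI w(2) FS) simp
      moreover have "y \<subseteq> r1 y" by (auto simp: r1_def full_def)
      moreover have "r1 (r1 y) = r1 y" using nT by (simp add: r1_def[of "r1 y"])
      ultimately show ?thesis using nT by simp
    qed
    have r1_mono: "r1 y \<subseteq> r1 z" if yz: "y \<in> ?L" "z \<in> ?L" "y \<subseteq> z" for y z
    proof (cases "T StO y \<and> \<not> T StO z")
      case False
      have "T StO z \<Longrightarrow> T StO y" using yz(3) by (auto simp: T_def)
      then show ?thesis using False yz(3) full_mono[OF yz(3)] by (auto simp: r1_def)
    next
      case True
      obtain w S where w: "z = cube w S" "w \<in> ?x" "S \<subseteq> D" using L[OF yz(2)] by blast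
      obtain w' S' where w': "y = cube w' S'" "w' \<in> ?x" "S' \<subseteq> D" using L[OF yz(1)] by blast
      have "w' \<in> z" using cube_self[OF x_sub[OF w'(2)], of S'] yz(3) w'(1) by auto
      moreover have "st w' F = StO" using True Tcube[OF w'(2,3)] w'(1) by auto
      \<comment> \<open>As \<open>z\<close> contains a vertex of the \<open>O\<close> end without
        lying in that end, \<open>F\<close> must be one of its directions, so thickening does not
        change it.\<close>
      ultimately have "\<not> T StI z" unfolding T_def by (metis status.distinct(1))
      then have "F \<in> S" using True Tcube[OF w(2,3)] w(1) by (cases "st w F") auto
      then have "full z = z" using full_cube[OF w(2,3)] w(1) by (simp add: insert_absorb)
      then show ?thesis using True full_mono[OF yz(3)] by (auto simp: r1_def)
    qed
    let ?M = "r1 ` ?L" and ?r = "side StI"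
    have M: "\<exists>w S. y = cube w S \<and> w \<in> ?x \<and> S \<subseteq> D \<and> (F \<in> S \<or> st w F = StI)" and MinL: "y \<in> ?L" if yM: "y \<in> ?M" for y
    proof -
      obtain y0 where "y0 \<in> ?L" "y = r1 y0" using yM by auto
      then have y: "y \<in> ?L" "\<not> T StO y" using r1 by auto
      show "y \<in> ?L" by (rule y)
      obtain w S where w: "y = cube w S" "w \<in> ?x" "S \<subseteq> D" using L[OF y(1)] by blast
      then show "\<exists>w S. y = cube w S \<and> w \<in> ?x \<and> S \<subseteq> D \<and> (F \<in> S \<or> st w F = StI)"
        using Tcube[OF w(2,3)] y(2) by (metis status_neq(1))
    qed
    have MI: "cube (wb StI w) (S - {F}) \<in> ?M" if w: "w \<in> ?x" "S \<subseteq> D" for w S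
    proof -
      have S: "S - {F} \<subseteq> D" using w by auto
      have "cube (wb StI w) (S - {F}) \<in> ?L" by (rule LI[OF wb(1)[OF w(1)] S]) (simp add: wb(2)[OF w(1)])
      moreover have "\<not> T StO (cube (wb StI w) (S - {F}))"
        unfolding Tcube[OF wb(1)[OF w(1)] S] using wb(2)[OF w(1)] by simp
      then have "r1 (cube (wb StI w) (S - {F})) = cube (wb StI w) (S - {F})" by (simp add: r1_def)
      ultimately show ?thesis by (metis imageI)
    qed
    have r: "?r y \<in> ?M \<and> ?r (?r y) = ?r y \<and> ?r y \<subseteq> y" if "y \<in> ?M" for y
    proof -
      obtain w S where w: "y = cube w S" "w \<in> ?x" "S \<subseteq> D" "F \<in> S \<or> st w F = StI" using M[OF \<open>y \<in> ?M\<close>] by blast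
      show ?thesis
        using MI[OF w(2,3)] side_side[OF w(2,3)] side_sub[OF w(2-4)] side_cube[OF w(2,3)] w(1) by simp
    qed
    have e: "side StI ?x \<in> ?M"
      unfolding side_cube[OF vx order_refl] by (rule MI[OF vx order_refl])
    have "collapsible (sd (?r ` ?M))"
    proof (rule collapsible_sd_apex)
      show "finite (?r ` ?M)" using fin by simp
      show "side StI ?x \<in> ?r ` ?M" using e side_side[OF vx order_refl, of StI] by (metis imageI)
      show "(\<forall>q\<in>?r ` ?M. q \<subseteq> side StI ?x) \<or> (\<forall>q\<in>?r ` ?M. side StI ?x \<subseteq> q)"
        using side_mono ysub MinL by blast
    qed
    then have "collapsible (sd ?M)"
      by (rule sd_retract_collapsible[rotated 4]) (use fin r side_mono in auto)
    then have "collapsible (sd ?L)"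
      by (rule sd_retract_collapsible[OF fin, rotated 3]) (use r1 r1_mono in auto)
    then show ?thesis using False by simp
  qed
qed

end

section \<open>Inherited states\<close>

text \<open>\<psi> is an isomorphism of posets onto its image, so chains correspond to chains in
  both directions.\<close>

lemma collapsible_sd_image:
  assumes K: "simplicial K" "collapsible K" and \<psi>: "\<And>S T. S \<in> K \<Longrightarrow> T \<in> K \<Longrightarrow> \<psi> S \<subseteq> \<psi> T \<longleftrightarrow> S \<subseteq> T"
  shows "collapsible (sd (\<psi> ` K))"
proof -
  have inj: "inj_on \<psi> K"
  proof (rule inj_onI)
    fix S T assume "S \<in> K" "T \<in> K" "\<psi> S = \<psi> T"
    then have "S \<subseteq> T" "T \<subseteq> S" using \<psi>[of S T] \<psi>[of T S] by auto
    then show "S = T" by simp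
  qed
  have "sd (\<psi> ` K) = (`) \<psi> ` sd K"
  proof (intro equalityI subsetI)
    fix c assume c: "c \<in> sd (\<psi> ` K)"
    then obtain C where C: "C \<subseteq> K" "c = \<psi> ` C" unfolding sd_def by (auto simp: subset_image_iff)
    have "S \<subseteq> T \<or> T \<subseteq> S" if "S \<in> C" "T \<in> C" for S T
    proof -
      have "\<psi> S \<in> c" "\<psi> T \<in> c" "S \<in> K" "T \<in> K" using C that by auto
      then show ?thesis using c \<psi>[of S T] \<psi>[of T S] unfolding sd_def by blast
    qed
    moreover have "finite C" using C(1) simplicialD(1)[OF K(1)] by (rule finite_subset)
    moreover have "C \<noteq> {}" using c C by (auto simp: sd_def)
    ultimately have "C \<in> sd K" using C(1) by (simp add: sd_def)
    then show "c \<in> (`) \<psi> ` sd K" using C(2) by auto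
  next
    fix c assume "c \<in> (`) \<psi> ` sd K"
    then obtain C where C: "C \<in> sd K" "c = \<psi> ` C" by auto
    then have CK: "C \<subseteq> K" by (simp add: sd_def)
    have "\<psi> S \<subseteq> \<psi> T \<or> \<psi> T \<subseteq> \<psi> S" if "S \<in> C" "T \<in> C" for S T
    proof -
      have "S \<in> K" "T \<in> K" using CK that by auto
      then show ?thesis using C(1) that \<psi>[of S T] \<psi>[of T S] unfolding sd_def by blast
    qed
    then show "c \<in> sd (\<psi> ` K)" unfolding C(2) sd_def using C(1) CK by (auto simp: sd_def)
  qed
  moreover have "collapsible ((`) \<psi> ` sd K)"
  proof (rule collapsible_image)
    show "collapsible (sd K)" using collapsible_sd K by blast
    show "simplicial (sd K)" using simplicial_sd simplicialD(1)[OF K(1)] by blast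
    show "inj_on \<psi> (\<Union>(sd K))" using inj by (simp add: Union_sd)
  qed
  ultimately show ?thesis by simp
qed

lemma apply_move_commute: "apply_move A (apply_move B s) = apply_move B (apply_move A s)"
  by (auto simp: apply_move_def)

lemma move_of_eq:
  assumes "partition_on X Ms" "A \<in> Ms" "F \<in> A"
  shows "move_of Ms F = A"
  unfolding move_of_def
proof (rule the_equality)
  show "B = A" if "B \<in> Ms \<and> F \<in> B" for B
    using assms that unfolding partition_on_def disjoint_def by (metis IntI empty_iff)
qed (use assms in simp)

lemma invert_invert [simp]: "invert (invert s) = s"
  by (cases s) auto

text \<open>Each facet of \<open>v\<close> in the move of \<open>F\<close> inverts the status of
  \<open>F\<close> once, and the moves commute, so the fold can be evaluated one facet at a
  time.\<close>

lemma act_eq: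
  assumes ms: "partition_on X Ms" "A \<in> Ms" "F \<in> A" and v: "finite v" "v \<subseteq> X"
  shows "act Ms v s F = (if odd (card (v \<inter> A)) then invert (s F) else s F)"
  using v
proof (induction v rule: finite_induct)
  case empty
  then show ?case by (simp add: act_def)
next
  case (insert G v)
  interpret comp_fun_commute "\<lambda>F. apply_move (move_of Ms F)"
    by standard (auto simp: apply_move_commute o_def)
  obtain B where B: "B \<in> Ms" "G \<in> B" using insert.prems ms(1) by (auto simp: partition_on_def)
  have "act Ms (insert G v) s F = apply_move (move_of Ms G) (act Ms v s) F"
    unfolding act_def using insert.hyps by simp
  also have "\<dots> = (if F \<in> B then invert (act Ms v s F) else act Ms v s F)"
    using move_of_eq[OF ms(1) B] by (simp add: apply_move_def)
  also have "F \<in> B \<longleftrightarrow> G \<in> A"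
    using move_of_eq[OF ms(1) B] move_of_eq[OF ms] move_of_eq[OF ms(1) B(1)] move_of_eq[OF ms(1,2)] B ms(3) by metis
  finally show ?case
    using insert by (auto simp: Int_insert_left)
qed

lemma hface_subset: "hface Q P \<Longrightarrow> Q \<subseteq> P"
  by (auto simp: hface_def)

section \<open>The cube complex of a polytope with moves\<close>

locale polytope_moves =
  fixes P :: "'a::euclidean_space mink set" and Ms :: "'a mink set set set" and s0 :: "'a state"
  assumes poly: "hyp_polytope P" and right: "right_angled P"
    and moves_P: "set_of_moves P Ms" and compat: "compatible Ms s0"
begin

text \<open>For the empty set the intersection is \<open>P\<close> itself, so the vertices of the
  cube complex are included as cubes without directions.\<close>

definition nerve :: "'a mink set set set" where
  "nerve = {S. S \<subseteq> hfacets P \<and> P \<inter> \<Inter>S \<noteq> {}}"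

lemma part: "partition_on (hfacets P) Ms"
  using moves_P by (simp add: set_of_moves_def)

lemma finite_facets: "finite (hfacets P)"
  by (rule right_angled_faces(1)[OF poly right])

lemma act_cong:
  assumes "v \<subseteq> hfacets P" "A \<in> Ms" "F \<in> A"
  shows "act Ms v s0 F = (if odd (card (v \<inter> A)) then invert (s0 F) else s0 F)"
  using act_eq[OF part assms(2,3) _ assms(1)] finite_subset[OF assms(1) finite_facets] by simp

sublocale cube_moves "hfacets P" nerve Ms "\<lambda>v. act Ms v s0"
proof
  show "finite (hfacets P)" by (rule finite_facets)
  show "S \<subseteq> hfacets P" if "S \<in> nerve" for S using that by (simp add: nerve_def)
  show "T \<in> nerve" if "S \<in> nerve" "T \<subseteq> S" for S T
  proof -
    have "P \<inter> \<Inter>S \<subseteq> P \<inter> \<Inter>T" using that(2) by (intro Int_mono order_refl Inter_anti_mono)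
    then show ?thesis using that by (auto simp: nerve_def)
  qed
  show "partition_on (hfacets P) Ms" by (rule part)
  show "act Ms v s0 F = act Ms w s0 F"
    if "v \<subseteq> hfacets P" "w \<subseteq> hfacets P" "A \<in> Ms" "F \<in> A" "v \<inter> A = w \<inter> A" for v w A F
    using act_cong[OF that(1,3,4)] act_cong[OF that(2,3,4)] that(5) by simp
  show "act Ms (vadd v {F}) s0 F = invert (act Ms v s0 F)" if v: "v \<subseteq> hfacets P" and F: "F \<in> hfacets P" for v F
  proof -
    obtain A where A: "A \<in> Ms" "F \<in> A" using F part by (auto simp: partition_on_def)
    have fin: "finite (v \<inter> A)" using finite_subset[OF v finite_facets] by simp
    have w: "vadd v {F} \<subseteq> hfacets P" using v F by (auto simp: vadd_def)
    have "odd (card (vadd v {F} \<inter> A)) \<longleftrightarrow> even (card (v \<inter> A))"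
    proof (cases "F \<in> v")
      case True
      then have "vadd v {F} \<inter> A = (v \<inter> A) - {F}" by (auto simp: vadd_def)
      moreover have "card (v \<inter> A) = Suc (card ((v \<inter> A) - {F}))"
        by (rule card.remove[OF fin]) (use True A in simp)
      ultimately show ?thesis by simp
    next
      case False
      then have "vadd v {F} \<inter> A = insert F (v \<inter> A)" using A(2) by (auto simp: vadd_def)
      then show ?thesis using False fin by simp
    qed
    then show ?thesis using act_cong[OF v A] act_cong[OF w A] by simp
  qed
  show "act Ms v s0 F = act Ms v s0 G"
    if v: "v \<subseteq> hfacets P" and S: "S \<in> nerve" and A: "A \<in> Ms" and FG: "F \<in> S \<inter> A" "G \<in> S \<inter> A" for v S A F G
  proof -
    \<comment> \<open>Two facets in a member of the nerve share a point, so they are adjacent and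
      compatibility of the initial state applies. Being in one move, they are then inverted equally
      often.\<close>
    have "s0 F = s0 G"
    proof (cases "F = G")
      case False
      obtain p where "p \<in> \<Inter>S" using S by (auto simp: nerve_def)
      then have "p \<in> F \<inter> G" using FG by auto
      then have "adjacent F G" using False by (auto simp: adjacent_def)
      then show ?thesis using compat A FG unfolding compatible_def by blast
    qed simp
    then show ?thesis using act_cong[OF v A, of F] act_cong[OF v A, of G] FG by simp
  qed
qed

lemma face_nerve:
  assumes "hface Q P"
  shows "defining_facets P Q \<in> nerve" "Q = P \<inter> \<Inter>(defining_facets P Q)"
proof -
  show eq: "Q = P \<inter> \<Inter>(defining_facets P Q)" by (rule right_angled_faces(3)[OF poly right assms])
  have "Q \<noteq> {}" by (rule right_angled_faces(2)[OF poly right assms])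
  then show "defining_facets P Q \<in> nerve" using eq by (auto simp: nerve_def defining_facets_def)
qed

lemma dual_cube_eq:
  assumes "hface Q P" "v \<subseteq> hfacets P"
  shows "dual_cube P (copy_of P Q v) = cube v (defining_facets P Q)"
  unfolding cube_def by (rule dual_cube_copy_of[OF finite_facets assms(2) hface_subset[OF assms(1)]])

lemma dual_cube_complex_eq: "dual_cube_complex P = cubes"
proof (intro equalityI subsetI)
  fix c assume "c \<in> dual_cube_complex P"
  then obtain Q v where "hface Q P" "v \<subseteq> hfacets P" "c = dual_cube P (copy_of P Q v)"
    unfolding dual_cube_complex_def loebell_cells_def by auto
  then show "c \<in> cubes" using dual_cube_eq face_nerve(1) cube_in by simp
next
  fix c assume "c \<in> cubes"
  then obtain v S where v: "v \<subseteq> hfacets P" "S \<in> nerve" "c = cube v S" by (auto simp: cubes_def)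
  have f: "hface (P \<inter> \<Inter>S) P \<and> defining_facets P (P \<inter> \<Inter>S) = S"
    using right_angled_faces(4)[OF poly right] v(2) by (simp add: nerve_def)
  then have "c = dual_cube P (copy_of P (P \<inter> \<Inter>S) v)" using dual_cube_eq[OF _ v(1)] v(3) by simp
  then show "c \<in> dual_cube_complex P"
    unfolding dual_cube_complex_def loebell_cells_def using f v(1) by blast
qed

text \<open>Facets of the face \<open>Q\<close> correspond to the facets of \<open>P\<close> that
  meet \<open>Q\<close> without containing it, and simplices to sets of such facets with a common
  point. So \<psi> is an isomorphism of posets onto the cubes above, which is the form in which
  \<open>m_connected_sd\<close> and \<open>collapsible_sd_image\<close> apply.\<close>

lemma state_complex_upper:
  fixes Q v b
  defines "D \<equiv> defining_facets P Q" and "s \<equiv> inherited_state P Ms (act Ms v s0) Q"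
  defines "K \<equiv> state_complex Q s b"
  defines "\<psi> \<equiv> \<lambda>X. cube v (D \<union> {F \<in> hfacets P - D. F \<inter> Q \<in> X})"
  assumes Q: "hface Q P" and v: "v \<subseteq> hfacets P"
  shows "simplicial K" "\<psi> ` K = upper v D b" "\<And>S T. S \<in> K \<Longrightarrow> T \<in> K \<Longrightarrow> \<psi> S \<subseteq> \<psi> T \<longleftrightarrow> S \<subseteq> T"
proof -
  define pre where "pre X = {F \<in> hfacets P - D. F \<inter> Q \<in> X}" for X
  have \<psi>_pre: "\<psi> X = cube v (D \<union> pre X)" for X by (simp add: \<psi>_def pre_def)
  have DN: "D \<in> nerve" and QD: "Q = P \<inter> \<Inter>D" using face_nerve[OF Q] by (simp_all add: D_def)
  have DF: "D \<subseteq> hfacets P" using DN by (simp add: nerve_def)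
  have facets_Q: "hfacets Q = {F \<inter> Q |F. F \<in> hfacets P - D \<and> F \<inter> Q \<noteq> {}}"
    unfolding D_def by (rule right_angled_faces(5)[OF poly right Q])
  have ins: "defining_facets P (F \<inter> Q) = insert F D" if "F \<in> hfacets P" "F \<inter> Q \<noteq> {}" for F
  proof -
    have "F \<inter> Q = P \<inter> \<Inter>(insert F D)" unfolding QD by auto
    then show ?thesis using right_angled_faces(4)[OF poly right, of "insert F D"] that DF by simp
  qed
  \<comment> \<open>\<open>F\<close> is recovered from its trace on \<open>Q\<close> as the one
    defining facet of the trace outside \<open>D\<close>. This also resolves the \<open>THE\<close>
    in \<open>inherited_state\<close>.\<close>
  have inj: "F' = F" if "F \<in> hfacets P - D" "F' \<in> hfacets P" "F \<inter> Q \<noteq> {}" "F \<inter> Q = F' \<inter> Q" for F F'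
  proof -
    have "insert F D = insert F' D" using ins[of F] ins[of F'] that by simp
    then show ?thesis using that(1) by (metis DiffD2 insertE insertI1)
  qed
  have s_eq: "s (F \<inter> Q) = inh v D F" if F: "F \<in> hfacets P - D" "F \<inter> Q \<noteq> {}" for F
  proof -
    have "(THE F'. F' \<in> hfacets P \<and> F \<inter> Q = F' \<inter> Q) = F"
      by (rule the_equality) (use F inj[OF F(1) _ F(2)] in auto)
    then have 1: "s (F \<inter> Q) = (if \<forall>F'\<in>D. move_of Ms F \<noteq> move_of Ms F' then act Ms v s0 F else StO)"
      by (simp add: s_def inherited_state_def D_def Let_def)
    obtain A where A: "A \<in> Ms" "F \<in> A" using move_ex[of F] F by auto
    have u: "B = A" if "B \<in> Ms" "F \<in> B" for B using move_unique[OF that(1) A(1) that(2) A(2)] .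
    have "move_of Ms F' = A \<longleftrightarrow> F' \<in> A" if F': "F' \<in> D" for F'
    proof -
      obtain B where B: "B \<in> Ms" "F' \<in> B" using move_ex[of F'] F' DF by auto
      have "move_of Ms F' = B" by (rule move_of_eq[OF part B])
      moreover have "B = A" if "F' \<in> A" using move_unique[OF B(1) A(1) B(2) that] .
      ultimately show ?thesis using B(2) by auto
    qed
    then have "(\<forall>F'\<in>D. move_of Ms F \<noteq> move_of Ms F') \<longleftrightarrow> A \<inter> D = {}"
      using move_of_eq[OF part A] by (metis disjoint_iff)
    also have "\<dots> \<longleftrightarrow> (\<forall>B\<in>Ms. F \<in> B \<longrightarrow> B \<inter> D = {})" by (metis u A)
    finally show ?thesis unfolding 1 inh_def by simp
  qed
  have K_iff: "X \<in> K \<longleftrightarrow> X \<noteq> {} \<and> finite X \<and> X \<subseteq> hfacets Q \<and> \<Inter>X \<noteq> {} \<and> (\<forall>G\<in>X. s G = b)" for X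
    unfolding K_def state_complex_def full_subcomplex_def facet_complex_def by auto
  have KD: "X \<noteq> {}" "finite X" "X \<subseteq> hfacets Q" "\<Inter>X \<noteq> {}" "G \<in> X \<Longrightarrow> s G = b" if "X \<in> K" for X G
    using iffD1[OF K_iff that] by simp_all
  have finQ: "finite (hfacets Q)"
  proof -
    have "hfacets Q \<subseteq> (\<lambda>F. F \<inter> Q) ` hfacets P" unfolding facets_Q by auto
    then show ?thesis using finite_facets by (meson finite_imageI finite_subset)
  qed
  show "simplicial K"
    unfolding simplicial_def
  proof (intro conjI ballI allI impI)
    have "K \<subseteq> Pow (hfacets Q)" by (rule subsetI, rule PowI, rule KD(3))
    then show "finite K" using finQ by (meson finite_Pow_iff finite_subset)
    show "\<sigma> \<noteq> {}" "finite \<sigma>" if "\<sigma> \<in> K" for \<sigma> using KD(1,2)[OF that] .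
    show "\<tau> \<in> K" if "\<sigma> \<in> K" "\<tau> \<subseteq> \<sigma> \<and> \<tau> \<noteq> {}" for \<sigma> \<tau>
    proof -
      have "\<Inter>\<sigma> \<subseteq> \<Inter>\<tau>" using that(2) by (intro Inter_anti_mono) simp
      then have "\<Inter>\<tau> \<noteq> {}" using KD(4)[OF that(1)] by (metis subset_empty)
      moreover have "finite \<tau>" using that(2) KD(2)[OF that(1)] finite_subset by metis
      moreover have "\<tau> \<subseteq> hfacets Q" using that(2) KD(3)[OF that(1)] by (metis subset_trans)
      moreover have "\<forall>G\<in>\<tau>. s G = b" using that(2) KD(5)[OF that(1)] by (meson subsetD)
      ultimately show ?thesis unfolding K_iff using that(2) by simp
    qed
  qed
  have memQ: "\<exists>F\<in>pre X. G = F \<inter> Q" if "X \<in> K" "G \<in> X" for X G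
  proof -
    have "G \<in> hfacets Q" using that(2) KD(3)[OF that(1)] by (rule rev_subsetD)
    then obtain F where F: "F \<in> hfacets P - D" "G = F \<inter> Q" unfolding facets_Q by (elim CollectE exE conjE) simp
    then have "F \<in> pre X" using that(2) by (simp add: pre_def)
    then show ?thesis using F(2) by (intro bexI[of _ F])
  qed
  have K_ne: "F \<inter> Q \<noteq> {}" if "X \<in> K" "F \<inter> Q \<in> X" for X F
  proof -
    have "F \<inter> Q \<in> hfacets Q" using that(2) KD(3)[OF that(1)] by (rule rev_subsetD)
    then show ?thesis unfolding facets_Q by (elim CollectE exE conjE) simp
  qed
  have pre_N: "D \<union> pre X \<in> nerve" if X: "X \<in> K" for X
  proof -
    obtain p where p: "p \<in> \<Inter>X" using KD(4)[OF X] by (metis ex_in_conv)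
    obtain G where G: "G \<in> X" using KD(1)[OF X] by (metis ex_in_conv)
    then obtain F0 where "G = F0 \<inter> Q" using memQ[OF X G] by auto
    then have "p \<in> Q" using p G by auto
    moreover have "p \<in> F" if "F \<in> pre X" for F using p that by (auto simp: pre_def)
    ultimately have "p \<in> P \<inter> \<Inter>(D \<union> pre X)" using QD by auto
    then show ?thesis using DF by (auto simp: nerve_def pre_def)
  qed
  show "\<psi> S \<subseteq> \<psi> T \<longleftrightarrow> S \<subseteq> T" if S: "S \<in> K" and T: "T \<in> K" for S T
  proof -
    have "\<psi> S \<subseteq> \<psi> T \<longleftrightarrow> D \<union> pre S \<subseteq> D \<union> pre T"
      unfolding \<psi>_pre by (rule cube_psubset(2)[OF v N_sub[OF pre_N[OF S]] N_sub[OF pre_N[OF T]]])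
    also have "\<dots> \<longleftrightarrow> pre S \<subseteq> pre T" by (auto simp: pre_def)
    also have "\<dots> \<longleftrightarrow> S \<subseteq> T"
    proof
      assume st: "pre S \<subseteq> pre T"
      show "S \<subseteq> T"
      proof
        fix G assume "G \<in> S"
        then obtain F where "F \<in> pre S" "G = F \<inter> Q" using memQ[OF S] by blast
        then show "G \<in> T" using st by (auto simp: pre_def)
      qed
    qed (auto simp: pre_def)
    finally show ?thesis .
  qed
  show "\<psi> ` K = upper v D b"
  proof (intro equalityI subsetI)
    fix y assume "y \<in> \<psi> ` K"
    then obtain X where X: "X \<in> K" "y = cube v (D \<union> pre X)" by (auto simp: \<psi>_pre)
    obtain G where "G \<in> X" using KD(1)[OF X(1)] by (metis ex_in_conv)
    then have "pre X \<noteq> {}" using memQ[OF X(1), of G] by auto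
    moreover have "inh v D F = b" if F: "F \<in> pre X" for F
    proof -
      have "F \<inter> Q \<in> X" "F \<in> hfacets P - D" using F by (auto simp: pre_def)
      then show ?thesis using s_eq[of F] K_ne[OF X(1)] KD(5)[OF X(1)] by simp
    qed
    moreover have "pre X \<inter> D = {}" by (auto simp: pre_def)
    ultimately show "y \<in> upper v D b" unfolding upper_def using pre_N[OF X(1)] X(2) by auto
  next
    fix y assume "y \<in> upper v D b"
    then obtain R where R: "R \<noteq> {}" "R \<inter> D = {}" "D \<union> R \<in> nerve" "\<forall>F\<in>R. inh v D F = b" "y = cube v (D \<union> R)"
      unfolding upper_def by auto
    have "P \<inter> \<Inter>(D \<union> R) \<noteq> {}" using R(3) by (simp add: nerve_def)
    then obtain p where p: "p \<in> P \<inter> \<Inter>(D \<union> R)" by (metis ex_in_conv)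
    have pQ: "p \<in> Q" using p QD by auto
    have RF: "F \<in> hfacets P - D" if "F \<in> R" for F using R(2,3) that by (auto simp: nerve_def)
    have ne: "F \<inter> Q \<noteq> {}" if "F \<in> R" for F using p pQ that by auto
    let ?X = "(\<lambda>F. F \<inter> Q) ` R"
    have "?X \<in> K"
      unfolding K_iff
    proof (intro conjI)
      show "?X \<noteq> {}" using R(1) by simp
      show "?X \<subseteq> hfacets Q" unfolding facets_Q using RF ne by auto
      then show "finite ?X" using finQ by (rule finite_subset)
      have "p \<in> \<Inter>?X" using p pQ by auto
      then show "\<Inter>?X \<noteq> {}" by (metis empty_iff)
      show "\<forall>G\<in>?X. s G = b" using s_eq RF ne R(4) by auto
    qed
    moreover have "pre ?X = R"
    proof (rule equalityI; rule subsetI)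
      fix F assume F0: "F \<in> pre ?X"
      then have F: "F \<in> hfacets P - D" and "F \<inter> Q \<in> ?X" by (simp_all add: pre_def)
      then obtain F' where F': "F' \<in> R" "F \<inter> Q = F' \<inter> Q" by blast
      then have "F = F'" using inj[OF RF[OF F'(1)] _ ne[OF F'(1)]] F by simp
      then show "F \<in> R" using F'(1) by simp
    next
      fix F assume "F \<in> R"
      then show "F \<in> pre ?X" using RF by (simp add: pre_def)
    qed
    then have "y = \<psi> ?X" unfolding \<psi>_pre R(5) by simp
    ultimately show "y \<in> \<psi> ` K" by blast
  qed
qed

text \<open>Legality controls the upper factor of both joins and goodness the lower one; the other
  factor is arbitrary in each case.\<close>

lemma links:
  fixes Q v
  defines "s \<equiv> inherited_state P Ms (act Ms v s0) Q" and "b \<equiv> dual_cube P (copy_of P Q v)"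
  assumes Q: "hface Q P" and v: "v \<subseteq> hfacets P"
  shows "m_legal m Q s \<Longrightarrow> m_connected m (ascending_link (sd cubes) circle_map b) \<and>
      m_connected m (descending_link (sd cubes) circle_map b)"
    and "good P Ms Q \<or> totally_legal Q s \<Longrightarrow> collapsible (ascending_link (sd cubes) circle_map b) \<and>
      collapsible (descending_link (sd cubes) circle_map b)"
proof -
  define D where "D = defining_facets P Q"
  have DN: "D \<in> nerve" using face_nerve(1)[OF Q] by (simp add: D_def)
  have b: "b = cube v D" unfolding b_def D_def by (rule dual_cube_eq[OF Q v])
  note lj = links_join[OF v DN]
  have asc: "ascending_link (sd cubes) circle_map b = join (sd (lower v D False)) (sd (upper v D StO))"
    and desc: "descending_link (sd cubes) circle_map b = join (sd (lower v D True)) (sd (upper_mixed v D))"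
    unfolding b by (rule lj)+
  have simp_lo: "simplicial (sd (lower v D c))" for c
    by (rule simplicial_sd[OF finite_subset[OF lj(4) finite_cubes]])
  have simp_up: "simplicial (sd (upper v D c))" for c
    by (rule simplicial_sd[OF finite_subset[OF lj(5) finite_cubes]])
  have simp_mix: "simplicial (sd (upper_mixed v D))"
    by (rule simplicial_sd[OF finite_subset[OF lj(6) finite_cubes]])
  have disj1: "\<Union>(sd (lower v D c)) \<inter> \<Union>(sd (upper v D c')) = {}" for c c'
    unfolding Union_sd using lj(3)[of _ c _ c'] by (metis (no_types, lifting) UnI1 disjoint_iff psubset_eq)
  have disj2: "\<Union>(sd (lower v D c)) \<inter> \<Union>(sd (upper_mixed v D)) = {}" for c
    unfolding Union_sd using lj(3)[of _ c] by (metis (no_types, lifting) UnI2 disjoint_iff psubset_eq)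
  note sc = state_complex_upper[OF Q v, folded s_def D_def]
  have mc: "m_connected m (sd (upper v D c))" if "m_connected m (state_complex Q s c)" for m c
    using m_connected_sd[OF sc(1) sc(3) that] unfolding sc(2) .
  have cc: "collapsible (sd (upper v D c))" if "collapsible (state_complex Q s c)" for c
    using collapsible_sd_image[OF sc(1) that sc(3)] unfolding sc(2) .
  note retract = upper_mixed_retract[OF v DN]
  show "m_connected m (ascending_link (sd cubes) circle_map b) \<and> m_connected m (descending_link (sd cubes) circle_map b)"
    if "m_legal m Q s"
  proof
    have O: "m_connected m (sd (upper v D StO))" and I: "m_connected m (sd (upper v D StI))"
      using that mc by (simp_all add: m_legal_def)
    have "m_connected m (join (sd (upper v D StO)) (sd (lower v D False)))"
      by (rule m_connected_join[OF simp_up simp_lo _ O]) (use disj1 in \<open>simp add: Int_commute\<close>)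
    then show "m_connected m (ascending_link (sd cubes) circle_map b)" unfolding asc by (simp add: join_commute)
    have "m_connected m (sd (upper_mixed v D))" by (rule m_connected_strong_steps[OF retract simp_mix I])
    then have "m_connected m (join (sd (upper_mixed v D)) (sd (lower v D True)))"
      by (intro m_connected_join[OF simp_mix simp_lo]) (use disj2 in \<open>simp_all add: Int_commute\<close>)
    then show "m_connected m (descending_link (sd cubes) circle_map b)" unfolding desc by (simp add: join_commute)
  qed
  show "collapsible (ascending_link (sd cubes) circle_map b) \<and> collapsible (descending_link (sd cubes) circle_map b)"
    if "good P Ms Q \<or> totally_legal Q s"
    using that
  proof
    assume "good P Ms Q"
    then obtain A F where A: "A \<in> Ms" "A \<inter> D = {F}" unfolding good_def D_def by blast
    have lo: "collapsible (sd (lower v D c))" for c by (rule lower_collapsible[OF v DN A])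
    show ?thesis
      unfolding asc desc using collapsible_join[OF lo simp_lo simp_up disj1] collapsible_join[OF lo simp_lo simp_mix disj2] by blast
  next
    assume "totally_legal Q s"
    then have O: "collapsible (sd (upper v D StO))" and I: "collapsible (sd (upper v D StI))"
      using cc by (simp_all add: totally_legal_def)
    have M: "collapsible (sd (upper_mixed v D))"
      using strong_steps_collapse[OF retract simp_mix] collapsible_trans I by blast
    have "collapsible (join (sd (upper v D StO)) (sd (lower v D False)))"
      by (rule collapsible_join[OF O simp_up simp_lo]) (use disj1 in \<open>simp add: Int_commute\<close>)
    moreover have "collapsible (join (sd (upper_mixed v D)) (sd (lower v D True)))"
      by (rule collapsible_join[OF M simp_mix simp_lo]) (use disj2 in \<open>simp add: Int_commute\<close>)
    ultimately show ?thesis unfolding asc desc by (simp add: join_commute)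
  qed
qed

end

theorem theorem3p1:
  fixes P :: "('a::euclidean_space \<times> real) set"
    and Ms :: "('a \<times> real) set set set"
    and s0 :: "('a \<times> real) set \<Rightarrow> status"
  assumes "hyp_polytope P"
    and "right_angled P"
    and "set_of_moves P Ms"
    and "compatible Ms s0"
  shows "\<exists>f. morse_function (sd (dual_cube_complex P)) f \<and>
    (\<forall>P' v. hface P' P \<and> v \<subseteq> hfacets P \<longrightarrow>
      (let s = inherited_state P Ms (act Ms v s0) P';
           b = dual_cube P (copy_of P P' v);
           asc = ascending_link (sd (dual_cube_complex P)) f b;
           desc = descending_link (sd (dual_cube_complex P)) f b
       in (\<forall>m. m_legal m P' s \<longrightarrow> m_connected m asc \<and> m_connected m desc) \<and>
          (good P Ms P' \<or> totally_legal P' s \<longrightarrow> collapsible asc \<and> collapsible desc)))"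
proof -
  interpret polytope_moves P Ms s0 using assms by unfold_locales
  show ?thesis
    unfolding dual_cube_complex_eq Let_def
  proof (intro exI conjI allI impI; (elim conjE)?)
    show "morse_function (sd cubes) circle_map" by (rule morse_circle_map)
  qed (simp_all add: links)
qed

end
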